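(* Let $\Bbbk$ be a field of characteristic $0$. Let $G$ be a finitely generated group, and suppose $G$ is filtered-formal (over $\Bbbk$). Then all the nilpotent quotients $G/\Gamma_i(G)$ are filtered-formal (over $\Bbbk$).
   Context: $\Gamma_1(G)=G$, $\Gamma_{k+1}(G)=[\Gamma_k(G),G]$ is the lower central series. The Malcev Lie algebra $\mathfrak{m}(G;\Bbbk)$ of a finitely generated group $G$ is the complete, separated, filtered Lie algebra of primitive elements in the complete Hopf algebra $\widehat{\Bbbk G}=\varprojlim_k\Bbbk G/I^k$ ($I$ the augmentation ideal), with filtration induced from $\widehat{I^k}=\varprojlim_{j\ge k} I^k/I^j$. For a complete, separated, filtered Lie algebra $\mathfrak{m}$ (decreasing filtration $\{\mathcal{F}_k\mathfrak m\}_{k\ge 1}$, $\mathcal F_1\mathfrak m=\mathfrak m$, with $[\mathcal{F}_r\mathfrak m,\mathcal{F}_s\mathfrak m]\subseteq\mathcal{F}_{r+s}\mathfrak m$), let $\operatorname{gr}(\mathfrak{m})$ be its associated graded Lie algebra and $\widehat{\operatorname{gr}}(\mathfrak{m})=\prod_{i\ge1}\operatorname{gr}_i(\mathfrak{m})$, filtered by $\prod_{i\ge k}\operatorname{gr}_i(\mathfrak m)$; $\mathfrak m$ is filtered-formal if there is a filtered Lie algebra isomorphism $\mathfrak{m}\cong\widehat{\operatorname{gr}}(\mathfrak{m})$ inducing the identity on associated graded Lie algebras. $G$ is filtered-formal over $\Bbbk$ if $\mathfrak{m}(G;\Bbbk)$ is filtered-formal. *)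

theory Defs
  imports "HOL-Algebra.Ideal_Product" "HOL-Algebra.QuotRing" "HOL-Algebra.Module" "HOL-Algebra.Generated_Groups"
    "HOL-Library.Poly_Mapping"
begin

section \<open>Groups\<close>

text \<open>The series is indexed from 1; the value at 0 is a harmless convention.\<close>

fun lower_central :: "('g, 'b) monoid_scheme \<Rightarrow> nat \<Rightarrow> 'g set" where
  "lower_central G 0 = carrier G"
| "lower_central G (Suc 0) = carrier G"
| "lower_central G (Suc (Suc n)) =
     generate G (\<Union>h \<in> lower_central G (Suc n). \<Union>g \<in> carrier G.
       {h \<otimes>\<^bsub>G\<^esub> g \<otimes>\<^bsub>G\<^esub> inv\<^bsub>G\<^esub> h \<otimes>\<^bsub>G\<^esub> inv\<^bsub>G\<^esub> g})"

definition finitely_generated_group :: "('g, 'b) monoid_scheme \<Rightarrow> bool" where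
  "finitely_generated_group G \<longleftrightarrow>
     group G \<and> (\<exists>S. finite S \<and> S \<subseteq> carrier G \<and> generate G S = carrier G)"


section \<open>Group algebras and their tensor squares\<close>

text \<open>The field of coefficients is the type \<open>'k\<close>; elements of the group algebra are
  the finitely supported functions whose support lies in the carrier of the group.\<close>

definition group_algebra ::
  "('g, 'b) monoid_scheme \<Rightarrow> ('k::field, 'g \<Rightarrow>\<^sub>0 'k) module" where
  "group_algebra G =
     \<lparr>carrier = {a. Poly_Mapping.keys a \<subseteq> carrier G},
      mult = (\<lambda>a b. \<Sum>g \<in> Poly_Mapping.keys a. \<Sum>h \<in> Poly_Mapping.keys b.
                Poly_Mapping.single (g \<otimes>\<^bsub>G\<^esub> h)
                  (Poly_Mapping.lookup a g * Poly_Mapping.lookup b h)),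
      one = Poly_Mapping.single \<one>\<^bsub>G\<^esub> 1,
      zero = 0,
      add = (+),
      smult = (\<lambda>c. Poly_Mapping.map (\<lambda>t. c * t))\<rparr>"

definition augmentation :: "('g \<Rightarrow>\<^sub>0 'k::field) \<Rightarrow> 'k" where
  "augmentation a = (\<Sum>g \<in> Poly_Mapping.keys a. Poly_Mapping.lookup a g)"

definition augmentation_ideal :: "('g, 'b) monoid_scheme \<Rightarrow> ('g \<Rightarrow>\<^sub>0 'k::field) set" where
  "augmentation_ideal G = {a. Poly_Mapping.keys a \<subseteq> carrier G \<and> augmentation a = 0}"

fun augmentation_power ::
  "('g, 'b) monoid_scheme \<Rightarrow> nat \<Rightarrow> ('g \<Rightarrow>\<^sub>0 'k::field) set" where
  "augmentation_power G 0 = carrier (group_algebra G)"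
| "augmentation_power G (Suc n) =
     ideal_prod (group_algebra G) (augmentation_power G n) (augmentation_ideal G)"

text \<open>Since the group elements form a basis of \<open>kG\<close>, the pairs of group elements form a
  basis of \<open>kG \<otimes> kG\<close>. The tensor square is represented in this basis; as an algebra it is
  the group algebra of \<open>G \<times> G\<close>.\<close>

definition tensor_square ::
  "('g, 'b) monoid_scheme \<Rightarrow> ('k::field, 'g \<times> 'g \<Rightarrow>\<^sub>0 'k) module" where
  "tensor_square G = group_algebra (G \<times>\<times> G)"

definition tensor ::
  "('g \<Rightarrow>\<^sub>0 'k::field) \<Rightarrow> ('g \<Rightarrow>\<^sub>0 'k) \<Rightarrow> ('g \<times> 'g \<Rightarrow>\<^sub>0 'k)" where
  "tensor a b = (\<Sum>g \<in> Poly_Mapping.keys a. \<Sum>h \<in> Poly_Mapping.keys b.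
     Poly_Mapping.single (g, h) (Poly_Mapping.lookup a g * Poly_Mapping.lookup b h))"

text \<open>The linear extension of \<open>g \<mapsto> g \<otimes> g\<close>.\<close>

definition comultiplication :: "('g \<Rightarrow>\<^sub>0 'k::field) \<Rightarrow> ('g \<times> 'g \<Rightarrow>\<^sub>0 'k)" where
  "comultiplication a =
     (\<Sum>g \<in> Poly_Mapping.keys a. Poly_Mapping.single (g, g) (Poly_Mapping.lookup a g))"

text \<open>The tensor product filtration, whose \<open>n\<close>-th term is the sum of the subspaces
  \<open>I\<^sup>p \<otimes> I\<^sup>q\<close> with \<open>p + q = n\<close>.\<close>

definition tensor_filtration ::
  "('g, 'b) monoid_scheme \<Rightarrow> nat \<Rightarrow> ('g \<times> 'g \<Rightarrow>\<^sub>0 'k::field) set" where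
  "tensor_filtration G n =
     generate (add_monoid (tensor_square G))
       {tensor a b | a b. \<exists>p q. p + q = n \<and> a \<in> augmentation_power G p
                                         \<and> b \<in> augmentation_power G q}"


section \<open>Completions\<close>

text \<open>A map \<open>f\<close> on representatives induces a map from coset sequences to coset sequences
  modulo \<open>K 0\<close>, \<open>K 1\<close>, \dots. When \<open>f\<close> is compatible with the filtrations all cosets in
  the union below coincide, exactly as in the library's multiplication of cosets.\<close>

definition induced ::
  "('b, 'r) ring_scheme \<Rightarrow> (nat \<Rightarrow> 'b set) \<Rightarrow> ('a \<Rightarrow> 'b) \<Rightarrow> (nat \<Rightarrow> 'a set) \<Rightarrow> nat \<Rightarrow> 'b set" where
  "induced B K f x = (\<lambda>n. \<Union>a \<in> x n. K n +>\<^bsub>B\<^esub> f a)"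

definition induced2 ::
  "('b, 'r) ring_scheme \<Rightarrow> (nat \<Rightarrow> 'b set) \<Rightarrow> ('a \<Rightarrow> 'c \<Rightarrow> 'b) \<Rightarrow>
     (nat \<Rightarrow> 'a set) \<Rightarrow> (nat \<Rightarrow> 'c set) \<Rightarrow> nat \<Rightarrow> 'b set" where
  "induced2 B K f x y = (\<lambda>n. \<Union>a \<in> x n. \<Union>b \<in> y n. K n +>\<^bsub>B\<^esub> f a b)"

text \<open>The inverse limit of the quotients \<open>A Quot J n\<close>, for a decreasing sequence \<open>J\<close> of
  ideals of a \<open>k\<close>-algebra \<open>A\<close>. The projection from \<open>A Quot J (Suc n)\<close> to \<open>A Quot J n\<close>
  maps a coset to the coset containing it.\<close>

definition completion ::
  "('k, 'a) module \<Rightarrow> (nat \<Rightarrow> 'a set) \<Rightarrow> ('k, nat \<Rightarrow> 'a set) module" where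
  "completion A J =
     \<lparr>carrier = {x. \<forall>n. x n \<in> carrier (A Quot J n) \<and> x (Suc n) \<subseteq> x n},
      mult = (\<lambda>x y n. x n \<otimes>\<^bsub>A Quot J n\<^esub> y n),
      one = (\<lambda>n. \<one>\<^bsub>A Quot J n\<^esub>),
      zero = (\<lambda>n. \<zero>\<^bsub>A Quot J n\<^esub>),
      add = (\<lambda>x y n. x n \<oplus>\<^bsub>A Quot J n\<^esub> y n),
      smult = (\<lambda>c. induced A J (\<lambda>a. c \<odot>\<^bsub>A\<^esub> a))\<rparr>"

text \<open>The inverse limit of \<open>J k / J j\<close> over \<open>j \<ge> k\<close>, inside the inverse limit of \<open>A / J j\<close>;
  the components with \<open>j < k\<close> of such an element are forced to be zero.\<close>

definition completion_filtration ::
  "('k, 'a) module \<Rightarrow> (nat \<Rightarrow> 'a set) \<Rightarrow> nat \<Rightarrow> (nat \<Rightarrow> 'a set) set" where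
  "completion_filtration A J k = {x \<in> carrier (completion A J). \<forall>j\<ge>k. x j \<subseteq> J k}"

abbreviation completed_group_algebra ::
  "('g, 'b) monoid_scheme \<Rightarrow> ('k::field, nat \<Rightarrow> ('g \<Rightarrow>\<^sub>0 'k) set) module" where
  "completed_group_algebra G \<equiv> completion (group_algebra G) (augmentation_power G)"

text \<open>The completed tensor product of the completed group algebra with itself is the
  completion of \<open>kG \<otimes> kG\<close> with respect to the tensor product filtration.\<close>

abbreviation completed_tensor_square ::
  "('g, 'b) monoid_scheme \<Rightarrow> ('k::field, nat \<Rightarrow> ('g \<times> 'g \<Rightarrow>\<^sub>0 'k) set) module" where
  "completed_tensor_square G \<equiv> completion (tensor_square G) (tensor_filtration G)"

abbreviation completed_tensor ::
  "('g, 'b) monoid_scheme \<Rightarrow> (nat \<Rightarrow> ('g \<Rightarrow>\<^sub>0 'k::field) set) \<Rightarrow>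
     (nat \<Rightarrow> ('g \<Rightarrow>\<^sub>0 'k) set) \<Rightarrow> nat \<Rightarrow> ('g \<times> 'g \<Rightarrow>\<^sub>0 'k) set" where
  "completed_tensor G \<equiv> induced2 (tensor_square G) (tensor_filtration G) tensor"

abbreviation completed_comultiplication ::
  "('g, 'b) monoid_scheme \<Rightarrow> (nat \<Rightarrow> ('g \<Rightarrow>\<^sub>0 'k::field) set) \<Rightarrow>
     nat \<Rightarrow> ('g \<times> 'g \<Rightarrow>\<^sub>0 'k) set" where
  "completed_comultiplication G \<equiv>
     induced (tensor_square G) (tensor_filtration G) comultiplication"

definition primitive_elements ::
  "('g, 'b) monoid_scheme \<Rightarrow> (nat \<Rightarrow> ('g \<Rightarrow>\<^sub>0 'k::field) set) set" where
  "primitive_elements G =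
     {x \<in> carrier (completed_group_algebra G).
        completed_comultiplication G x =
          completed_tensor G x \<one>\<^bsub>completed_group_algebra G\<^esub>
            \<oplus>\<^bsub>completed_tensor_square G\<^esub>
          completed_tensor G \<one>\<^bsub>completed_group_algebra G\<^esub> x}"


section \<open>Filtered Lie algebras\<close>

text \<open>The field \<open>mult\<close> of the record holds the Lie bracket, and \<open>one\<close> is not used (it is
  set to zero below). The relevant indices of the filtration are those from 1 on.\<close>

record ('k, 'm) filtered_lie = "('k, 'm) module" +
  filt :: "nat \<Rightarrow> 'm set"

abbreviation bracket :: "('k, 'm, 'r) filtered_lie_scheme \<Rightarrow> 'm \<Rightarrow> 'm \<Rightarrow> 'm" where
  "bracket M \<equiv> mult M"

abbreviation gr_piece :: "('k, 'm) filtered_lie \<Rightarrow> nat \<Rightarrow> 'm set monoid" where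
  "gr_piece M i \<equiv> (M\<lparr>carrier := filt M i\<rparr>) A_Mod (filt M (Suc i))"

definition gr_smult ::
  "('k, 'm) filtered_lie \<Rightarrow> nat \<Rightarrow> 'k \<Rightarrow> 'm set \<Rightarrow> 'm set" where
  "gr_smult M i c X = (\<Union>u \<in> X. filt M (Suc i) +>\<^bsub>M\<^esub> (c \<odot>\<^bsub>M\<^esub> u))"

definition gr_bracket ::
  "('k, 'm) filtered_lie \<Rightarrow> nat \<Rightarrow> nat \<Rightarrow> 'm set \<Rightarrow> 'm set \<Rightarrow> 'm set" where
  "gr_bracket M p q X Y = (\<Union>u \<in> X. \<Union>v \<in> Y. filt M (Suc (p + q)) +>\<^bsub>M\<^esub> bracket M u v)"

text \<open>The product of the pieces of degree at least 1. Additive notation is used for the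
  pieces informally, but in the library a quotient by an additive subgroup is a
  multiplicatively written group, so that the sum over \<open>p + q = n\<close> in the bracket
  is written as a product.\<close>

definition completed_gr ::
  "('k, 'm) filtered_lie \<Rightarrow> ('k, nat \<Rightarrow> 'm set) filtered_lie" where
  "completed_gr M =
     \<lparr>carrier = (\<Pi>\<^sub>E i \<in> {1..}. carrier (gr_piece M i)),
      mult = (\<lambda>x y. \<lambda>n \<in> {1..}.
                \<Otimes>\<^bsub>gr_piece M n\<^esub> p \<in> {1..<n}. gr_bracket M p (n - p) (x p) (y (n - p))),
      one = (\<lambda>i \<in> {1..}. \<one>\<^bsub>gr_piece M i\<^esub>),
      zero = (\<lambda>i \<in> {1..}. \<one>\<^bsub>gr_piece M i\<^esub>),
      add = (\<lambda>x y. \<lambda>i \<in> {1..}. x i \<otimes>\<^bsub>gr_piece M i\<^esub> y i),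
      smult = (\<lambda>c x. \<lambda>i \<in> {1..}. gr_smult M i c (x i)),
      filt = (\<lambda>k. {x \<in> (\<Pi>\<^sub>E i \<in> {1..}. carrier (gr_piece M i)).
                     \<forall>i \<in> {1..<k}. x i = \<one>\<^bsub>gr_piece M i\<^esub>})\<rparr>"

definition filtered_lie_iso ::
  "('k, 'm) filtered_lie \<Rightarrow> ('k, 'n) filtered_lie \<Rightarrow> ('m \<Rightarrow> 'n) set" where
  "filtered_lie_iso M L =
     {\<phi>. bij_betw \<phi> (carrier M) (carrier L) \<and>
         (\<forall>x \<in> carrier M. \<forall>y \<in> carrier M. \<phi> (x \<oplus>\<^bsub>M\<^esub> y) = \<phi> x \<oplus>\<^bsub>L\<^esub> \<phi> y) \<and>
         (\<forall>c. \<forall>x \<in> carrier M. \<phi> (c \<odot>\<^bsub>M\<^esub> x) = c \<odot>\<^bsub>L\<^esub> \<phi> x) \<and>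
         (\<forall>x \<in> carrier M. \<forall>y \<in> carrier M. \<phi> (bracket M x y) = bracket L (\<phi> x) (\<phi> y)) \<and>
         (\<forall>k\<ge>1. \<phi> ` filt M k = filt L k)}"

text \<open>The degree \<open>k\<close> piece of the associated graded of \<open>completed_gr M\<close> is identified with
  \<open>gr_piece M k\<close> through the component of index \<open>k\<close>. Hence \<open>\<phi>\<close> induces the identity
  on associated graded Lie algebras iff, for every element \<open>x\<close> of the \<open>k\<close>-th term of the
  filtration, the component of index \<open>k\<close> of \<open>\<phi> x\<close> is the class of \<open>x\<close>.\<close>

definition filtered_formal_lie :: "('k, 'm) filtered_lie \<Rightarrow> bool" where
  "filtered_formal_lie M \<longleftrightarrow>
     (\<exists>\<phi> \<in> filtered_lie_iso M (completed_gr M).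
        \<forall>k\<ge>1. \<forall>x \<in> filt M k. \<phi> x k = filt M (Suc k) +>\<^bsub>M\<^esub> x)"


section \<open>Malcev Lie algebras\<close>

definition malcev_lie ::
  "('g, 'b) monoid_scheme \<Rightarrow> ('k::field, nat \<Rightarrow> ('g \<Rightarrow>\<^sub>0 'k) set) filtered_lie" where
  "malcev_lie G =
     (let A = completed_group_algebra G in
      \<lparr>carrier = primitive_elements G,
       mult = (\<lambda>x y. (x \<otimes>\<^bsub>A\<^esub> y) \<ominus>\<^bsub>A\<^esub> (y \<otimes>\<^bsub>A\<^esub> x)),
       one = \<zero>\<^bsub>A\<^esub>,
       zero = \<zero>\<^bsub>A\<^esub>,
       add = add A,
       smult = smult A,
       filt = (\<lambda>k. primitive_elements G \<inter>
                   completion_filtration (group_algebra G) (augmentation_power G) k)\<rparr>)"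

definition filtered_formal_group ::
  "'k::field itself \<Rightarrow> ('g, 'b) monoid_scheme \<Rightarrow> bool" where
  "filtered_formal_group K G \<longleftrightarrow>
     filtered_formal_lie (malcev_lie G :: ('k, nat \<Rightarrow> ('g \<Rightarrow>\<^sub>0 'k) set) filtered_lie)"

end

theory Submission
  imports "HOL.Vector_Spaces" "HOL-Computational_Algebra.Polynomial" Defs
begin

text \<open>Let \<open>H = G Mod \<Gamma>\<^sub>i\<close>, where \<open>\<Gamma>\<^sub>n\<close> is the lower central series of \<open>G\<close>, let \<open>I\<close> be the
augmentation ideal, and let \<open>m(G)\<close> be the Malcev Lie algebra with its filtration \<open>F\<^sub>k\<close>. The
projection \<open>G \<rightarrow> H\<close> induces a map \<open>\<pi> : m(G) \<rightarrow> m(H)\<close>. The theorem holds because \<open>\<pi>\<close> identifies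
\<open>m(H)\<close>, with its filtration, with \<open>m(G) / F\<^sub>i m(G)\<close> (lemma \<open>malcev_quotient\<close>), and because
filtered formality passes to such a quotient: an isomorphism of \<open>m(G)\<close> with its completed
associated graded algebra carries \<open>F\<^sub>i\<close> to the part of degree at least \<open>i\<close>, so it induces an
isomorphism of the quotients (lemma \<open>filtered_formal_quotient\<close>).

One half of the description of \<open>\<pi>\<close> is elementary. Since \<open>\<gamma> - 1 \<in> I\<^sup>i\<close> for \<open>\<gamma> \<in> \<Gamma>\<^sub>i\<close>, the map
\<open>kG \<rightarrow> kH\<close> is an isomorphism modulo \<open>I\<^sup>n\<close> for every \<open>n \<le> i\<close> (lemma
\<open>pushforward_reflects_power\<close>). Hence the kernel of \<open>\<pi>\<close> lies in \<open>F\<^sub>i m(G)\<close>, and for \<open>k \<le> i\<close> an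
element of \<open>m(G)\<close> lies in \<open>F\<^sub>k\<close> as soon as its image does. It remains to see that \<open>F\<^sub>i m(H) = 0\<close>
and that \<open>\<pi>\<close> is onto. Both are consequences of the following part of Quillen's theorem on the
associated graded ring of a group algebra (lemma \<open>approx_primitive_in_bracket_part\<close>), valid for
every group and every \<open>n \<ge> 1\<close>:

  an element of \<open>I\<^sup>n\<close> that is primitive modulo the term \<open>n + 1\<close> of the tensor filtration is
  congruent modulo \<open>I\<^sup>n\<^sup>+\<^sup>1\<close> to a linear combination of elements \<open>g - 1\<close> with \<open>g \<in> \<Gamma>\<^sub>n\<close>.

For \<open>H\<close> and \<open>n \<ge> i\<close> the group \<open>\<Gamma>\<^sub>n\<close> is trivial, so \<open>F\<^sub>n m(H) = F\<^sub>n\<^sub>+\<^sub>1 m(H)\<close>, and \<open>F\<^sub>i m(H) = 0\<close> by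
separation. For \<open>n < i\<close> one subtracts from an element of \<open>F\<^sub>n m(H)\<close> the corresponding combination
of the primitive elements \<open>log g\<close>, which lift to \<open>m(G)\<close>, and moves on to \<open>n + 1\<close>; this
ends at \<open>n = i\<close>.

The statement on approximately primitive elements is proved with Dynkin's operator, the
convolution of the antipode with the operator that multiplies by the degree. It acts as
multiplication by \<open>n\<close> on primitive elements of degree \<open>n\<close>, and it sends a product of \<open>n\<close> factors
\<open>g - 1\<close> to their iterated commutator, which is congruent to \<open>c - 1\<close> for an iterated group
commutator \<open>c \<in> \<Gamma>\<^sub>n\<close>. Characteristic 0 allows the division by \<open>n\<close>.

Elements of completions are sequences of cosets. All arguments are carried out on sequences of
representatives in the group algebra.\<close>

section \<open>Finitely supported functions as a vector space\<close>

abbreviation pt :: "'g \<Rightarrow> 'g \<Rightarrow>\<^sub>0 'k::field" where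
  "pt g \<equiv> Poly_Mapping.single g 1"

definition scale :: "'k::field \<Rightarrow> ('g \<Rightarrow>\<^sub>0 'k) \<Rightarrow> ('g \<Rightarrow>\<^sub>0 'k)" where
  "scale c = Poly_Mapping.map (\<lambda>t. c * t)"

lemma lookup_scale [simp]: "Poly_Mapping.lookup (scale c a) g = c * Poly_Mapping.lookup a g"
  unfolding scale_def by transfer (simp add: when_def)

global_interpretation pm: vector_space "scale :: 'k::field \<Rightarrow> ('g \<Rightarrow>\<^sub>0 'k) \<Rightarrow> ('g \<Rightarrow>\<^sub>0 'k)"
  by unfold_locales (auto intro!: poly_mapping_eqI simp: lookup_add algebra_simps)

global_interpretation pmp: vector_space_pair
  "scale :: 'k::field \<Rightarrow> ('g \<Rightarrow>\<^sub>0 'k) \<Rightarrow> ('g \<Rightarrow>\<^sub>0 'k)"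
  "scale :: 'k::field \<Rightarrow> ('h \<Rightarrow>\<^sub>0 'k) \<Rightarrow> ('h \<Rightarrow>\<^sub>0 'k)"
  by unfold_locales

abbreviation lmap :: "(('g \<Rightarrow>\<^sub>0 'k::field) \<Rightarrow> ('h \<Rightarrow>\<^sub>0 'k)) \<Rightarrow> bool" where
  "lmap \<equiv> Vector_Spaces.linear scale scale"

lemma lmapI:
  assumes "\<And>a b. T (a + b) = T a + T b" "\<And>c a. T (scale c a) = scale c (T a)"
  shows "lmap T"
  using assms by unfold_locales

lemma scale_single: "scale c (Poly_Mapping.single g d) = Poly_Mapping.single g (c * d)"
  by (rule poly_mapping_eqI) (simp add: lookup_single when_def)

lemma lmapD:
  assumes "lmap T"
  shows "T (a + b) = T a + T b" "T (a - b) = T a - T b" "T (- a) = - T a"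
    "T (scale c a) = scale c (T a)" "T 0 = 0" "T (\<Sum>i\<in>K. f i) = (\<Sum>i\<in>K. T (f i))"
proof -
  have m: "module_hom scale scale T" using assms by (simp add: linear_iff_module_hom)
  show "T (a + b) = T a + T b" "T (a - b) = T a - T b" "T (- a) = - T a"
    "T (scale c a) = scale c (T a)" "T 0 = 0" "T (\<Sum>i\<in>K. f i) = (\<Sum>i\<in>K. T (f i))"
    by (rule m[THEN module_hom.add] m[THEN module_hom.diff] m[THEN module_hom.neg]
      m[THEN module_hom.scale] m[THEN module_hom.zero] m[THEN module_hom.sum])+
qed

lemma scale_pt: "scale c (pt g) = Poly_Mapping.single g c"
  by (rule poly_mapping_eqI) (simp add: lookup_single when_def)

lemma sum_pt: "(\<Sum>g\<in>Poly_Mapping.keys a. scale (Poly_Mapping.lookup a g) (pt g)) = a"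
proof (rule poly_mapping_eqI)
  fix k
  show "Poly_Mapping.lookup (\<Sum>g\<in>Poly_Mapping.keys a. scale (Poly_Mapping.lookup a g) (pt g)) k
      = Poly_Mapping.lookup a k"
    by (simp add: lookup_sum lookup_single when_def if_distrib in_keys_iff cong: if_cong)
qed

lemma pm_subspace_induct:
  assumes W: "pm.subspace W" and keys: "Poly_Mapping.keys a \<subseteq> C" and pt: "\<And>g. g \<in> C \<Longrightarrow> pt g \<in> W"
  shows "a \<in> W"
proof -
  have "(\<Sum>g\<in>Poly_Mapping.keys a. scale (Poly_Mapping.lookup a g) (pt g)) \<in> W"
    using keys pt by (intro pm.subspace_sum[OF W] pm.subspace_scale[OF W]) auto
  then show ?thesis by (simp add: sum_pt)
qed

lemma lmap_id: "lmap (\<lambda>x. x)"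
  by (rule lmapI) auto

lemma lmap_eq_on:
  assumes "lmap S" "lmap T" "Poly_Mapping.keys a \<subseteq> C" "\<And>g. g \<in> C \<Longrightarrow> S (pt g) = T (pt g)"
  shows "S a = T a"
proof -
  have "pm.subspace {x. S x = T x}"
    using assms(1,2)
    by (auto simp: pm.subspace_def lmapD)
  from pm_subspace_induct[OF this assms(3)] assms(4) show ?thesis by simp
qed

lemma lmap_eq:
  assumes "lmap S" "lmap T" "\<And>g. S (pt g) = T (pt g)"
  shows "S a = T a"
  by (rule lmap_eq_on[OF assms(1,2), of _ UNIV]) (auto simp: assms)

definition lin_ext :: "('g \<Rightarrow> ('h \<Rightarrow>\<^sub>0 'k)) \<Rightarrow> ('g \<Rightarrow>\<^sub>0 'k::field) \<Rightarrow> ('h \<Rightarrow>\<^sub>0 'k)" where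
  "lin_ext f a = (\<Sum>g\<in>Poly_Mapping.keys a. scale (Poly_Mapping.lookup a g) (f g))"

lemma lin_ext_superset:
  assumes "finite K" "Poly_Mapping.keys a \<subseteq> K"
  shows "lin_ext f a = (\<Sum>g\<in>K. scale (Poly_Mapping.lookup a g) (f g))"
  unfolding lin_ext_def using assms
  by (intro sum.mono_neutral_left) (auto simp: in_keys_iff)

lemma lmap_lin_ext: "lmap (lin_ext (f :: 'a \<Rightarrow> ('c \<Rightarrow>\<^sub>0 'b::field)))"
proof (rule lmapI)
  fix a b :: "'a \<Rightarrow>\<^sub>0 'b"
  let ?K = "Poly_Mapping.keys a \<union> Poly_Mapping.keys b"
  have "Poly_Mapping.keys (a + b) \<subseteq> ?K" by (rule keys_add)
  then show "lin_ext f (a + b) = lin_ext f a + lin_ext f b"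
    by (simp add: lin_ext_superset[of ?K] lookup_add pm.scale_left_distrib sum.distrib)
next
  fix c and a :: "'a \<Rightarrow>\<^sub>0 'b"
  have "Poly_Mapping.keys (scale c a) \<subseteq> Poly_Mapping.keys a" by (auto simp: in_keys_iff)
  then show "lin_ext f (scale c a) = scale c (lin_ext f a)"
    by (simp add: lin_ext_superset[of "Poly_Mapping.keys a"] pm.scale_sum_right)
qed

lemma lin_ext_pt [simp]: "lin_ext f (pt g) = f g"
  by (simp add: lin_ext_def)

lemmas lin_ext_lin = lmapD[OF lmap_lin_ext]

lemma lin_ext_fun_add: "lin_ext (\<lambda>g. f g + f' g) a = lin_ext f a + lin_ext f' a"
  by (simp add: lin_ext_def pm.scale_right_distrib sum.distrib)

lemma lin_ext_fun_scale: "lin_ext (\<lambda>g. scale c (f g)) a = scale c (lin_ext f a)"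
  by (simp add: lin_ext_def pm.scale_sum_right mult.commute)

section \<open>Products, tensors and comultiplication\<close>

abbreviation gmul :: "('g, 'b) monoid_scheme \<Rightarrow> ('g \<Rightarrow>\<^sub>0 'k::field) \<Rightarrow> ('g \<Rightarrow>\<^sub>0 'k) \<Rightarrow> ('g \<Rightarrow>\<^sub>0 'k)" where
  "gmul G \<equiv> mult (group_algebra G)"

abbreviation galg :: "('g, 'b) monoid_scheme \<Rightarrow> ('g \<Rightarrow>\<^sub>0 'k::field) set" where
  "galg G \<equiv> carrier (group_algebra G)"

lemma group_algebra_simps [simp]:
  "one (group_algebra G) = pt \<one>\<^bsub>G\<^esub>"
  "zero (group_algebra G) = 0"
  "add (group_algebra G) = (+)"
  "smult (group_algebra G) = scale"
  by (auto simp: group_algebra_def scale_def fun_eq_iff)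

lemma galg_iff: "a \<in> galg G \<longleftrightarrow> Poly_Mapping.keys a \<subseteq> carrier G"
  by (simp add: group_algebra_def)

lemma gmul_lin_ext: "gmul G a b = lin_ext (\<lambda>g. lin_ext (\<lambda>h. pt (g \<otimes>\<^bsub>G\<^esub> h)) b) a"
  by (simp add: group_algebra_def lin_ext_def pm.scale_sum_right scale_single)

lemma tensor_lin_ext: "tensor a b = lin_ext (\<lambda>g. lin_ext (\<lambda>h. pt (g, h)) b) a"
  by (simp add: tensor_def lin_ext_def pm.scale_sum_right scale_single)

lemma comultiplication_lin_ext: "comultiplication = lin_ext (\<lambda>g. pt (g, g))"
  by (rule ext) (simp add: comultiplication_def lin_ext_def scale_pt)

definition bilinear :: "(('g \<Rightarrow>\<^sub>0 'k::field) \<Rightarrow> ('h \<Rightarrow>\<^sub>0 'k) \<Rightarrow> ('i \<Rightarrow>\<^sub>0 'k)) \<Rightarrow> bool" where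
  "bilinear B \<longleftrightarrow> (\<forall>a. lmap (B a)) \<and> (\<forall>b. lmap (\<lambda>a. B a b))"

lemma bilinear_lin_ext: "bilinear (\<lambda>a b. lin_ext (\<lambda>g. lin_ext (f g) b) a)"
  unfolding bilinear_def
  by (auto intro!: lmapI simp: lin_ext_lin lin_ext_fun_add lin_ext_fun_scale)

lemma bilinear_gmul: "bilinear (gmul G)"
  using bilinear_lin_ext by (simp add: gmul_lin_ext[abs_def])

lemma bilinear_tensor: "bilinear tensor"
  using bilinear_lin_ext by (simp add: tensor_lin_ext[abs_def])

lemma bilinearD:
  assumes "bilinear B"
  shows "B (a + a') b = B a b + B a' b" "B a (b + b') = B a b + B a b'"
    "B (a - a') b = B a b - B a' b" "B a (b - b') = B a b - B a b'"
    "B (- a) b = - B a b" "B a (- b) = - B a b"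
    "B (scale c a) b = scale c (B a b)" "B a (scale c b) = scale c (B a b)"
    "B 0 b = 0" "B a 0 = 0"
    "B (\<Sum>i\<in>K. f i) b = (\<Sum>i\<in>K. B (f i) b)" "B a (\<Sum>i\<in>K'. f' i) = (\<Sum>i\<in>K'. B a (f' i))"
proof -
  have l: "lmap (B a)" and r: "lmap (\<lambda>a. B a b)" for a b
    using assms unfolding bilinear_def by blast+
  show "B (a + a') b = B a b + B a' b" "B (a - a') b = B a b - B a' b"
    "B (- a) b = - B a b" "B (scale c a) b = scale c (B a b)"
    "B 0 b = 0" "B (\<Sum>i\<in>K. f i) b = (\<Sum>i\<in>K. B (f i) b)"
    by (rule r[THEN lmapD(1)] r[THEN lmapD(2)] r[THEN lmapD(3)] r[THEN lmapD(4)] r[THEN lmapD(5)] r[THEN lmapD(6)])+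
  show "B a (b + b') = B a b + B a b'" "B a (b - b') = B a b - B a b'"
    "B a (- b) = - B a b" "B a (scale c b) = scale c (B a b)"
    "B a 0 = 0" "B a (\<Sum>i\<in>K'. f' i) = (\<Sum>i\<in>K'. B a (f' i))"
    by (rule l[THEN lmapD(1)] l[THEN lmapD(2)] l[THEN lmapD(3)] l[THEN lmapD(4)] l[THEN lmapD(5)] l[THEN lmapD(6)])+
qed

lemmas gmul_bilinear = bilinearD[OF bilinear_gmul]
lemmas tensor_bilinear = bilinearD[OF bilinear_tensor]

lemma gmul_pt [simp]: "gmul G (pt g) (pt h) = pt (g \<otimes>\<^bsub>G\<^esub> h)"
  by (simp add: gmul_lin_ext)

lemma tensor_pt [simp]: "tensor (pt g) (pt h) = pt (g, h)"
  by (simp add: tensor_lin_ext)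

lemma comultiplication_pt [simp]: "comultiplication (pt g) = pt (g, g)"
  by (simp add: comultiplication_lin_ext)

lemma lmap_comultiplication: "lmap comultiplication"
  by (simp add: comultiplication_lin_ext lmap_lin_ext)

lemmas comul_lin = lmapD[OF lmap_comultiplication]

lemma lmap_gmul_left: "lmap (gmul G a)" and lmap_gmul_right: "lmap (\<lambda>a. gmul G a b)"
  using bilinear_gmul by (auto simp: bilinear_def)

lemma bilinear_span:
  assumes B: "bilinear B" and W: "pm.subspace W"
    and "a \<in> pm.span S" "b \<in> pm.span T" and ST: "\<And>x y. x \<in> S \<Longrightarrow> y \<in> T \<Longrightarrow> B x y \<in> W"
  shows "B a b \<in> W"
proof -
  have 1: "B x b \<in> W" if "x \<in> S" for x
    using \<open>b \<in> pm.span T\<close>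
    by (induction rule: pm.span_induct_alt)
      (auto simp: bilinearD[OF B] that pm.subspace_0[OF W] intro!: pm.subspace_add[OF W] pm.subspace_scale[OF W] ST)
  show ?thesis using \<open>a \<in> pm.span S\<close>
    by (induction rule: pm.span_induct_alt)
      (auto simp: bilinearD[OF B] 1 pm.subspace_0[OF W] intro!: pm.subspace_add[OF W] pm.subspace_scale[OF W])
qed

lemma pt_span:
  "pm.span (pt ` C) = {a :: 'a \<Rightarrow>\<^sub>0 'b::field. Poly_Mapping.keys a \<subseteq> C}"
proof -
  have s: "pm.subspace {a :: 'a \<Rightarrow>\<^sub>0 'b::field. Poly_Mapping.keys a \<subseteq> C}"
  proof (rule pm.subspaceI)
    fix x y :: "'a \<Rightarrow>\<^sub>0 'b" assume "x \<in> {a. Poly_Mapping.keys a \<subseteq> C}" "y \<in> {a. Poly_Mapping.keys a \<subseteq> C}"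
    then show "x + y \<in> {a. Poly_Mapping.keys a \<subseteq> C}"
      using keys_add[of x y] by blast
  next
    fix c and x :: "'a \<Rightarrow>\<^sub>0 'b" assume "x \<in> {a. Poly_Mapping.keys a \<subseteq> C}"
    then show "scale c x \<in> {a. Poly_Mapping.keys a \<subseteq> C}"
      by (auto simp: in_keys_iff)
  qed simp
  show ?thesis
  proof (intro equalityI)
    show "pm.span (pt ` C) \<subseteq> {a :: 'a \<Rightarrow>\<^sub>0 'b. Poly_Mapping.keys a \<subseteq> C}"
      by (rule pm.span_minimal[OF _ s]) auto
    show "{a :: 'a \<Rightarrow>\<^sub>0 'b. Poly_Mapping.keys a \<subseteq> C} \<subseteq> pm.span (pt ` C)"
      using pm_subspace_induct[of "pm.span (pt ` C)" _ C]
      by (auto simp: pm.span_base)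
  qed
qed

lemma galg_span: "galg G = pm.span (pt ` carrier G)"
  by (auto simp: galg_iff pt_span)

lemma subspace_galg: "pm.subspace (galg G)"
  by (simp add: galg_span)

lemma pt_galg: "g \<in> carrier G \<Longrightarrow> pt g \<in> galg G"
  by (simp add: galg_iff)

lemma augmentation_superset:
  assumes "finite K" "Poly_Mapping.keys a \<subseteq> K"
  shows "augmentation a = (\<Sum>g\<in>K. Poly_Mapping.lookup a g)"
  unfolding augmentation_def using assms
  by (intro sum.mono_neutral_left) (auto simp: in_keys_iff)

lemma augmentation_add: "augmentation (a + b) = augmentation a + augmentation b"
proof -
  let ?K = "Poly_Mapping.keys a \<union> Poly_Mapping.keys b"
  have "Poly_Mapping.keys (a + b) \<subseteq> ?K" by (rule keys_add)
  then show ?thesis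
    by (simp add: augmentation_superset[of ?K] lookup_add sum.distrib)
qed

lemma augmentation_scale: "augmentation (scale c a) = c * augmentation a"
proof -
  have "Poly_Mapping.keys (scale c a) \<subseteq> Poly_Mapping.keys a" by (auto simp: in_keys_iff)
  then show ?thesis
    by (simp add: augmentation_superset[of "Poly_Mapping.keys a"] sum_distrib_left)
qed

lemma augmentation_diff: "augmentation (a - b) = augmentation a - augmentation b"
proof -
  have "augmentation (a - b) + augmentation b = augmentation a"
    by (simp flip: augmentation_add)
  then show ?thesis by (simp add: eq_diff_eq)
qed

lemma augmentation_pt [simp]: "augmentation (pt g) = 1"
  by (simp add: augmentation_def)

lemma augmentation_zero [simp]: "augmentation 0 = 0"
  by (simp add: augmentation_def)

lemma augmentation_ideal_iff: "a \<in> augmentation_ideal G \<longleftrightarrow> a \<in> galg G \<and> augmentation a = 0"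
  by (simp add: augmentation_ideal_def galg_iff)

lemma subspace_augmentation_kernel: "pm.subspace {a. augmentation a = 0}"
  by (auto simp: pm.subspace_def augmentation_add augmentation_scale)

lemma subspace_augmentation_ideal: "pm.subspace (augmentation_ideal G)" (is "pm.subspace ?I")
proof -
  have "?I = galg G \<inter> {a. augmentation a = 0}"
    by (auto simp: augmentation_ideal_iff)
  then show ?thesis by (simp add: pm.subspace_inter subspace_galg subspace_augmentation_kernel)
qed

text \<open>An element \<open>a\<close> differs from \<open>augmentation a\<close> times a fixed group element \<open>u\<close> by a combination
of differences \<open>g - u\<close>.\<close>

lemma augmentation_ideal_span:
  assumes o: "u \<in> carrier G"
  shows "augmentation_ideal G = pm.span {pt g - pt u | g. g \<in> carrier G}" (is "_ = pm.span ?S")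
proof (intro equalityI)
  show "pm.span ?S \<subseteq> augmentation_ideal G"
    using o by (intro pm.span_minimal subspace_augmentation_ideal)
      (auto simp: augmentation_ideal_iff augmentation_diff intro!: pm.subspace_diff[OF subspace_galg] pt_galg)
  have *: "a - scale (augmentation a) (pt u) \<in> pm.span ?S" if "a \<in> galg G" for a
  proof -
    have "pm.subspace {a. a - scale (augmentation a) (pt u) \<in> pm.span ?S}"
    proof (rule pm.subspaceI; unfold mem_Collect_eq)
      show "0 - scale (augmentation 0) (pt u) \<in> pm.span ?S" by (simp add: pm.span_zero)
    next
      fix x y assume "x - scale (augmentation x) (pt u) \<in> pm.span ?S" "y - scale (augmentation y) (pt u) \<in> pm.span ?S"
      from pm.span_add[OF this] show "x + y - scale (augmentation (x + y)) (pt u) \<in> pm.span ?S"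
        by (simp add: augmentation_add pm.scale_left_distrib algebra_simps)
    next
      fix c x assume "x - scale (augmentation x) (pt u) \<in> pm.span ?S"
      from pm.span_scale[OF this, of c] show "scale c x - scale (augmentation (scale c x)) (pt u) \<in> pm.span ?S"
        by (simp add: augmentation_scale pm.scale_right_diff_distrib)
    qed
    moreover have "pt g - pt u \<in> pm.span ?S" if "g \<in> carrier G" for g
      using that by (intro pm.span_base) auto
    ultimately show ?thesis
      using pm_subspace_induct[of _ a "carrier G"] \<open>a \<in> galg G\<close> by (fastforce simp: galg_iff)
  qed
  then show "augmentation_ideal G \<subseteq> pm.span ?S"
    by (force simp: augmentation_ideal_iff)
qed

lemma gmul_tensor:
  "gmul (G \<times>\<times> H) (tensor a b) (tensor c d) = tensor (gmul G a c) (gmul H b d)"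
proof -
  have 1: "gmul (G \<times>\<times> H) (tensor (pt x) (pt y)) (tensor (pt z) d) = tensor (gmul G (pt x) (pt z)) (gmul H (pt y) d)" for x y z
    by (rule lmap_eq[of _ _ d]) (auto intro!: lmapI simp: gmul_bilinear tensor_bilinear)
  have 2: "gmul (G \<times>\<times> H) (tensor (pt x) (pt y)) (tensor c d) = tensor (gmul G (pt x) c) (gmul H (pt y) d)" for x y
    by (rule lmap_eq[of _ _ c]) (auto intro!: lmapI simp: gmul_bilinear tensor_bilinear 1[simplified])
  have 3: "gmul (G \<times>\<times> H) (tensor (pt x) b) (tensor c d) = tensor (gmul G (pt x) c) (gmul H b d)" for x
    by (rule lmap_eq[of _ _ b]) (auto intro!: lmapI simp: gmul_bilinear tensor_bilinear 2[simplified])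
  show ?thesis
    by (rule lmap_eq[of _ _ a]) (auto intro!: lmapI simp: gmul_bilinear tensor_bilinear 3[simplified])
qed

lemma comultiplication_gmul:
  "comultiplication (gmul G a b) = gmul (G \<times>\<times> G) (comultiplication a) (comultiplication b)"
proof -
  have 1: "comultiplication (gmul G (pt x) b) = gmul (G \<times>\<times> G) (comultiplication (pt x)) (comultiplication b)" for x
    by (rule lmap_eq[of _ _ b]) (auto intro!: lmapI simp: gmul_bilinear comul_lin)
  show ?thesis
    by (rule lmap_eq[of _ _ a]) (auto intro!: lmapI simp: gmul_bilinear comul_lin 1[simplified])
qed

lemma augmentation_gmul: "augmentation (gmul G a b) = augmentation a * augmentation b"
proof -
  have 1: "augmentation (gmul G (pt x) b) = augmentation b" for x
  proof -
    have "pm.subspace {b. augmentation (gmul G (pt x) b) = augmentation b}"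
      by (auto simp: pm.subspace_def gmul_bilinear augmentation_add augmentation_scale)
    from pm_subspace_induct[OF this, of b UNIV] show ?thesis by simp
  qed
  have "pm.subspace {a. augmentation (gmul G a b) = augmentation a * augmentation b}"
      by (auto simp: pm.subspace_def gmul_bilinear augmentation_add augmentation_scale algebra_simps)
  from pm_subspace_induct[OF this, of a UNIV] show ?thesis by (simp add: 1)
qed

lemma augmentation_tensor: "augmentation (tensor a b) = augmentation a * augmentation b"
proof -
  have 1: "augmentation (tensor (pt x) b) = augmentation b" for x
  proof -
    have "pm.subspace {b. augmentation (tensor (pt x) b) = augmentation b}"
      by (auto simp: pm.subspace_def tensor_bilinear augmentation_add augmentation_scale)
    from pm_subspace_induct[OF this, of b UNIV] show ?thesis by simp
  qed
  have "pm.subspace {a. augmentation (tensor a b) = augmentation a * augmentation b}"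
      by (auto simp: pm.subspace_def tensor_bilinear augmentation_add augmentation_scale algebra_simps)
  from pm_subspace_induct[OF this, of a UNIV] show ?thesis by (simp add: 1)
qed

lemma augmentation_comultiplication: "augmentation (comultiplication a) = augmentation a"
proof -
  have "pm.subspace {a. augmentation (comultiplication a) = augmentation a}"
    by (auto simp: pm.subspace_def comul_lin augmentation_add augmentation_scale)
  from pm_subspace_induct[OF this, of a UNIV] show ?thesis by simp
qed

section \<open>The filtrations by powers of the augmentation ideal\<close>

abbreviation Ipow :: "('g, 'b) monoid_scheme \<Rightarrow> nat \<Rightarrow> ('g \<Rightarrow>\<^sub>0 'k::field) set" where
  "Ipow \<equiv> augmentation_power"

abbreviation Tfil :: "('g, 'b) monoid_scheme \<Rightarrow> nat \<Rightarrow> ('g \<times> 'g \<Rightarrow>\<^sub>0 'k::field) set" where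
  "Tfil \<equiv> tensor_filtration"

text \<open>Both the powers of the augmentation ideal and the terms of the tensor filtration are ideals of
this kind, for \<open>G\<close> and for \<open>G \<times>\<times> G\<close> respectively. One treatment of completions therefore
serves both.\<close>

definition galg_ideal :: "('g, 'b) monoid_scheme \<Rightarrow> ('g \<Rightarrow>\<^sub>0 'k::field) set \<Rightarrow> bool" where
  "galg_ideal G J \<longleftrightarrow> pm.subspace J \<and> J \<subseteq> galg G \<and>
     (\<forall>a\<in>galg G. \<forall>x\<in>J. gmul G a x \<in> J \<and> gmul G x a \<in> J)"

lemma galg_idealD:
  assumes "galg_ideal G J"
  shows "pm.subspace J" "J \<subseteq> galg G" "x \<in> J \<Longrightarrow> x \<in> galg G"
    "a \<in> galg G \<Longrightarrow> x \<in> J \<Longrightarrow> gmul G a x \<in> J" "a \<in> galg G \<Longrightarrow> x \<in> J \<Longrightarrow> gmul G x a \<in> J"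
  using assms unfolding galg_ideal_def by auto

lemma lmap_span:
  assumes T: "lmap T" and W: "pm.subspace W" and "a \<in> pm.span S" and S: "\<And>x. x \<in> S \<Longrightarrow> T x \<in> W"
  shows "T a \<in> W"
  using \<open>a \<in> pm.span S\<close>
  by (induction rule: pm.span_induct_alt)
    (auto simp: lmapD[OF T] pm.subspace_0[OF W] S intro!: pm.subspace_add[OF W] pm.subspace_scale[OF W])

lemma subspace_diff_cancel:
  assumes "pm.subspace W" "a - b \<in> W"
  shows "a \<in> W \<longleftrightarrow> b \<in> W"
  using pm.subspace_diff[OF assms(1), of a "a - b"] pm.subspace_add[OF assms(1), of b "a - b"] assms(2)
  by auto

context group
begin

abbreviation gm (infixl "\<star>" 70) where "a \<star> b \<equiv> gmul G a b"

lemma gmul_galg: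
  assumes "a \<in> galg G" "b \<in> galg G"
  shows "a \<star> b \<in> galg G"
proof (rule bilinear_span[OF bilinear_gmul subspace_galg])
  show "a \<in> pm.span (pt ` carrier G)" "b \<in> pm.span (pt ` carrier G)"
    using assms by (auto simp: galg_span)
qed (auto intro!: pt_galg)

lemma gmul_assoc:
  assumes "a \<in> galg G" "b \<in> galg G" "c \<in> galg G"
  shows "(a \<star> b) \<star> c = a \<star> (b \<star> c)"
proof -
  have 1: "(pt x \<star> pt y) \<star> c = pt x \<star> (pt y \<star> c)" if "x \<in> carrier G" "y \<in> carrier G" for x y
    by (rule lmap_eq_on[of _ _ c "carrier G"])
      (use that assms in \<open>auto intro!: lmapI simp: gmul_bilinear m_assoc galg_iff\<close>)
  have 2: "(pt x \<star> b) \<star> c = pt x \<star> (b \<star> c)" if "x \<in> carrier G" for x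
    by (rule lmap_eq_on[of _ _ b "carrier G"])
      (use that assms 1 in \<open>auto intro!: lmapI simp: gmul_bilinear galg_iff\<close>)
  show ?thesis
    by (rule lmap_eq_on[of _ _ a "carrier G"])
      (use assms 2 in \<open>auto intro!: lmapI simp: gmul_bilinear galg_iff\<close>)
qed

lemma gmul_one:
  assumes "a \<in> galg G"
  shows "pt \<one> \<star> a = a" "a \<star> pt \<one> = a"
  by (rule lmap_eq_on[of _ _ a "carrier G"],
      use assms in \<open>auto intro!: lmapI simp: gmul_bilinear galg_iff\<close>)+

text \<open>Scalars can be absorbed into the first factor, so the sums of products already form a
subspace.\<close>

lemma ideal_prod_span:
  assumes "pm.subspace J" "pm.subspace K"
  shows "ideal_prod (group_algebra G) J K = pm.span {x \<star> y | x y. x \<in> J \<and> y \<in> K}" (is "?L = pm.span ?S")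
proof (intro equalityI subsetI)
  fix z assume "z \<in> ?L"
  then show "z \<in> pm.span ?S"
    by induction (auto intro: pm.span_base pm.span_add)
next
  fix z assume "z \<in> pm.span ?S"
  then show "z \<in> ?L"
  proof (induction rule: pm.span_induct_alt)
    case base
    have "0 \<star> 0 \<in> ?L" by (intro ideal_prod.prod pm.subspace_0 assms)
    then show ?case by (simp add: gmul_bilinear)
  next
    case (step c x z)
    then obtain u v where x: "x = u \<star> v" "u \<in> J" "v \<in> K" by auto
    have "scale c u \<star> v \<in> ?L"
      using x by (intro ideal_prod.prod pm.subspace_scale assms)
    then have "scale c x \<in> ?L" by (simp add: x gmul_bilinear)
    from ideal_prod.sum[OF this step.IH] show ?case by simp
  qed
qed

lemma subspace_power: "pm.subspace (Ipow G n)"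
  by (induction n) (simp_all add: subspace_galg ideal_prod_span subspace_augmentation_ideal)

lemma power_Suc_span:
  "Ipow G (Suc n) =
    pm.span {x \<star> y | x y. x \<in> Ipow G n \<and> y \<in> augmentation_ideal G}"
  by (simp add: ideal_prod_span subspace_power subspace_augmentation_ideal)

declare augmentation_power.simps(2) [simp del]

text \<open>Containments for powers are proved by induction on the exponent: a linear map sends \<open>I\<^sup>n\<^sup>+\<^sup>1\<close> into a
subspace as soon as it does so for the products that span it. The variant
\<open>power_Suc_lmap_pt\<close> below uses the smaller spanning set of products with \<open>g - 1\<close>.\<close>

lemma power_Suc_lmap:
  assumes "lmap T" "pm.subspace W" "x \<in> Ipow G (Suc n)"
    and "\<And>u v. u \<in> Ipow G n \<Longrightarrow> v \<in> augmentation_ideal G \<Longrightarrow> T (u \<star> v) \<in> W"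
  shows "T x \<in> W"
  by (rule lmap_span[OF assms(1,2) assms(3)[unfolded power_Suc_span]]) (use assms(4) in auto)

lemma augmentation_ideal_mult:
  assumes "a \<in> galg G" "x \<in> augmentation_ideal G"
  shows "a \<star> x \<in> augmentation_ideal G" "x \<star> a \<in> augmentation_ideal G"
  using assms by (auto simp: augmentation_ideal_iff augmentation_gmul gmul_galg)

lemma power_galg: "x \<in> Ipow G n \<Longrightarrow> x \<in> galg G"
proof (induction n arbitrary: x)
  case (Suc n)
  have "Ipow G (Suc n) \<subseteq> (galg G :: ('a \<Rightarrow>\<^sub>0 'c) set)"
    unfolding power_Suc_span
    by (intro pm.span_minimal subspace_galg) (auto intro!: gmul_galg dest: Suc.IH simp: augmentation_ideal_iff)
  with Suc.prems show ?case by blast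
qed simp

lemma power_right:
  assumes "x \<in> Ipow G n" "a \<in> galg G"
  shows "x \<star> a \<in> Ipow G n"
proof (cases n)
  case 0
  then show ?thesis using assms by (simp add: gmul_galg)
next
  case (Suc m)
  have "u \<star> v \<star> a \<in> Ipow G n" if uv: "u \<in> Ipow G m" "v \<in> augmentation_ideal G" for u v
  proof -
    have "u \<star> v \<star> a = u \<star> (v \<star> a)"
      using uv assms(2) power_galg[OF uv(1)] by (simp add: gmul_assoc augmentation_ideal_iff)
    then show ?thesis
      using uv augmentation_ideal_mult(2)[OF assms(2) uv(2)] unfolding Suc power_Suc_span
      by (auto intro!: pm.span_base)
  qed
  then show ?thesis
    using assms(1) power_Suc_lmap[OF lmap_gmul_right subspace_power] unfolding Suc by blast
qed

lemma power_left:
  assumes "a \<in> galg G" "x \<in> Ipow G n"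
  shows "a \<star> x \<in> Ipow G n"
  using assms
proof (induction n arbitrary: x)
  case (Suc m)
  have "a \<star> (u \<star> v) \<in> Ipow G (Suc m)" if uv: "u \<in> Ipow G m" "v \<in> augmentation_ideal G" for u v
  proof -
    have "a \<star> (u \<star> v) = (a \<star> u) \<star> v"
      using uv assms(1) power_galg[OF uv(1)] by (simp add: gmul_assoc augmentation_ideal_iff)
    moreover have "a \<star> u \<in> Ipow G m" using Suc.IH uv assms(1) by blast
    ultimately show ?thesis
      using uv(2) by (auto simp: power_Suc_span intro!: pm.span_base)
  qed
  then show ?case
    using Suc.prems(2) power_Suc_lmap[OF lmap_gmul_left subspace_power] by blast
qed (simp add: gmul_galg)

lemma galg_ideal_power: "galg_ideal G (Ipow G n)"
  by (auto simp: galg_ideal_def subspace_power power_galg power_left power_right)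

lemma power_Suc_subset: "Ipow G (Suc n) \<subseteq> Ipow G n"
  unfolding power_Suc_span
  by (intro pm.span_minimal subspace_power) (auto intro!: power_right simp: augmentation_ideal_iff)

lemma power_antimono: "m \<le> n \<Longrightarrow> Ipow G n \<subseteq> Ipow G m"
  by (rule lift_Suc_antimono_le[of "Ipow G"]) (use power_Suc_subset in auto)

lemma power_1: "Ipow G (Suc 0) = augmentation_ideal G"
proof (intro equalityI)
  show "Ipow G (Suc 0) \<subseteq> augmentation_ideal G"
    unfolding power_Suc_span
    by (intro pm.span_minimal subspace_augmentation_ideal) (auto simp: augmentation_ideal_mult(1))
  show "augmentation_ideal G \<subseteq> Ipow G (Suc 0)"
  proof
    fix y assume y: "y \<in> augmentation_ideal G"
    then have "y = pt \<one> \<star> y" by (simp add: gmul_one augmentation_ideal_iff)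
    then show "y \<in> Ipow G (Suc 0)"
      using y unfolding power_Suc_span by (auto intro!: pm.span_base pt_galg exI)
  qed
qed

lemma power_mult:
  assumes "x \<in> Ipow G p" "y \<in> Ipow G q"
  shows "x \<star> y \<in> Ipow G (p + q)"
  using assms(2)
proof (induction q arbitrary: y)
  case 0
  then show ?case using assms(1) by (simp add: power_right)
next
  case (Suc q)
  have "x \<star> (u \<star> v) \<in> Ipow G (Suc (p + q))"
    if uv: "u \<in> Ipow G q" "v \<in> augmentation_ideal G" for u v
  proof -
    have "x \<star> (u \<star> v) = (x \<star> u) \<star> v"
      using uv power_galg[OF assms(1)] power_galg[OF uv(1)] by (simp add: gmul_assoc augmentation_ideal_iff)
    then show ?thesis
      using Suc.IH[OF uv(1)] uv(2) unfolding power_Suc_span by (auto intro!: pm.span_base)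
  qed
  then show ?case
    using Suc.prems power_Suc_lmap[OF lmap_gmul_left subspace_power] unfolding add_Suc_right by blast
qed

lemma power_Suc_span_pt:
  "Ipow G (Suc n) =
    pm.span {x \<star> (pt g - pt \<one>) | x g. x \<in> Ipow G n \<and> g \<in> carrier G}" (is "_ = pm.span ?S")
proof (intro equalityI)
  have I: "pt g - pt \<one> \<in> augmentation_ideal G" if "g \<in> carrier G" for g
    using that by (auto simp: augmentation_ideal_iff augmentation_diff intro!: pm.subspace_diff[OF subspace_galg] pt_galg)
  then show "pm.span ?S \<subseteq> Ipow G (Suc n)"
    unfolding power_Suc_span by (intro pm.span_mono) auto
  have "x \<star> y \<in> pm.span ?S" if "x \<in> Ipow G n" "y \<in> augmentation_ideal G" for x y
    by (rule lmap_span[OF lmap_gmul_left pm.subspace_span, of _ "{pt g - pt \<one> | g. g \<in> carrier G}"])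
      (use that in \<open>auto simp flip: augmentation_ideal_span intro!: pm.span_base\<close>)
  then show "Ipow G (Suc n) \<subseteq> pm.span ?S"
    unfolding power_Suc_span by (intro pm.span_minimal) auto
qed

lemma power_Suc_lmap_pt:
  assumes "lmap T" "pm.subspace W" "x \<in> Ipow G (Suc n)"
    and "\<And>u g. u \<in> Ipow G n \<Longrightarrow> g \<in> carrier G \<Longrightarrow> T (u \<star> (pt g - pt \<one>)) \<in> W"
  shows "T x \<in> W"
  by (rule lmap_span[OF assms(1,2) assms(3)[unfolded power_Suc_span_pt]]) (use assms(4) in auto)

lemma pt_diff_power_1: "g \<in> carrier G \<Longrightarrow> pt g - pt \<one> \<in> Ipow G (Suc 0)"
  unfolding power_1
  by (auto simp: augmentation_ideal_iff augmentation_diff intro!: pm.subspace_diff[OF subspace_galg] pt_galg)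

lemma abelian_group_galg: "abelian_group (group_algebra G)"
proof (rule abelian_groupI)
  fix x :: "'a \<Rightarrow>\<^sub>0 'c" assume "x \<in> galg G"
  then show "\<exists>y\<in>galg G. y \<oplus>\<^bsub>group_algebra G\<^esub> x = \<zero>\<^bsub>group_algebra G\<^esub>"
    by (intro bexI[of _ "- x"]) (auto intro!: pm.subspace_neg subspace_galg)
qed (auto simp: algebra_simps intro!: pm.subspace_add pm.subspace_0 subspace_galg)

lemma galg_a_inv: "x \<in> galg G \<Longrightarrow> a_inv (group_algebra G) x = - x"
  using abelian_group.minus_equality[OF abelian_group_galg, of "- x" x]
  by (simp add: pm.subspace_neg subspace_galg)

text \<open>The tensor filtration is defined as a generated additive subgroup. Its generating set is
closed under scalars, so linear algebra applies to it.\<close>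

lemma generate_span:
  fixes S :: "('a \<Rightarrow>\<^sub>0 'k::field) set"
  assumes S: "S \<subseteq> galg G" and sc: "\<And>c x. x \<in> S \<Longrightarrow> scale c x \<in> S" and "0 \<in> S"
  shows "generate (add_monoid (group_algebra G)) S = pm.span S"
proof (intro equalityI subsetI)
  fix x assume "x \<in> generate (add_monoid (group_algebra G)) S"
  then show "x \<in> pm.span S"
  proof induction
    case (inv h)
    then have "inv\<^bsub>add_monoid (group_algebra G)\<^esub> h = - h"
      using galg_a_inv[of h] S by (auto simp: a_inv_def)
    with inv show ?case by (simp add: pm.span_neg pm.span_base)
  qed (auto intro: pm.span_base pm.span_zero pm.span_add)
next
  fix x assume "x \<in> pm.span S"
  then show "x \<in> generate (add_monoid (group_algebra G)) S"
  proof (induction rule: pm.span_induct_alt)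
    case base
    show ?case using generate.incl[OF \<open>0 \<in> S\<close>] .
  next
    case (step c x y)
    from generate.eng[OF generate.incl[OF sc[OF step.hyps]] step.IH]
    show ?case by simp
  qed
qed

lemma group_GG: "group (G \<times>\<times> G)"
  by (rule DirProd_group[OF is_group is_group])

lemma tensor_galg:
  assumes "a \<in> galg G" "b \<in> galg G"
  shows "tensor a b \<in> galg (G \<times>\<times> G)"
  by (rule bilinear_span[OF bilinear_tensor subspace_galg])
    (use assms in \<open>auto simp: galg_span intro!: pm.span_base\<close>)

lemma Tfil_span:
  "Tfil G n =
    pm.span {tensor a b | a b. \<exists>p q. p + q = n \<and> a \<in> Ipow G p \<and> b \<in> Ipow G q}"
  unfolding tensor_filtration_def tensor_square_def
proof (rule group.generate_span[OF group_GG]; (rule subsetI)?)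
  fix c and x :: "('a \<times> 'a) \<Rightarrow>\<^sub>0 'c"
  assume "x \<in> {tensor a b | a b. \<exists>p q. p + q = n \<and> a \<in> Ipow G p \<and> b \<in> Ipow G q}"
  then obtain a b p q where "x = tensor a b" "p + q = n" "a \<in> Ipow G p" "b \<in> Ipow G q"
    by auto
  then have "scale c x = tensor (scale c a) b" "scale c a \<in> Ipow G p"
    by (simp_all add: tensor_bilinear pm.subspace_scale subspace_power)
  with \<open>p + q = n\<close> \<open>b \<in> _\<close>
  show "scale c x \<in> {tensor a b | a b. \<exists>p q. p + q = n \<and> a \<in> Ipow G p \<and> b \<in> Ipow G q}"
    by blast
next
  have "0 = tensor (0 :: 'a \<Rightarrow>\<^sub>0 'c) 0" "0 + n = n" by (simp_all add: tensor_bilinear)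
  then show "0 \<in> {tensor a b | (a :: 'a \<Rightarrow>\<^sub>0 'c) b. \<exists>p q. p + q = n \<and> a \<in> Ipow G p \<and> b \<in> Ipow G q}"
    using pm.subspace_0[OF subspace_power] by blast
qed (auto intro!: tensor_galg power_galg)

lemma Tfil_lmap:
  assumes "lmap T" "pm.subspace W" "x \<in> Tfil G n"
    and "\<And>a b p q. a \<in> Ipow G p \<Longrightarrow> b \<in> Ipow G q \<Longrightarrow> p + q = n
      \<Longrightarrow> T (tensor a b) \<in> W"
  shows "T x \<in> W"
  by (rule lmap_span[OF assms(1,2) assms(3)[unfolded Tfil_span]]) (use assms(4) in auto)

lemma Tfil_base:
  "a \<in> Ipow G p \<Longrightarrow> b \<in> Ipow G q \<Longrightarrow> tensor a b \<in> Tfil G (p + q)"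
  unfolding Tfil_span by (intro pm.span_base) auto

lemma Tfil_mult:
  assumes "x \<in> Tfil G m" "y \<in> Tfil G n"
  shows "gmul (G \<times>\<times> G) x y \<in> Tfil G (m + n)"
proof (rule bilinear_span[OF bilinear_gmul _ assms[unfolded Tfil_span]])
  show "pm.subspace (Tfil G (m + n) :: ('a \<times> 'a \<Rightarrow>\<^sub>0 'c) set)"
    by (simp add: Tfil_span)
  fix x y :: "('a \<times> 'a) \<Rightarrow>\<^sub>0 'c"
  assume "x \<in> {tensor a b | a b. \<exists>p q. p + q = m \<and> a \<in> Ipow G p \<and> b \<in> Ipow G q}"
  then obtain a b p q where 1: "x = tensor a b" "p + q = m" "a \<in> Ipow G p" "b \<in> Ipow G q"
    by auto
  assume "y \<in> {tensor a b | a b. \<exists>p q. p + q = n \<and> a \<in> Ipow G p \<and> b \<in> Ipow G q}"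
  then obtain a' b' p' q' where 2: "y = tensor a' b'" "p' + q' = n" "a' \<in> Ipow G p'" "b' \<in> Ipow G q'"
    by auto
  have "tensor (a \<star> a') (b \<star> b') \<in> Tfil G ((p + p') + (q + q'))"
    using 1 2 by (intro Tfil_base power_mult)
  then show "gmul (G \<times>\<times> G) x y \<in> Tfil G (m + n)"
    using 1(2) 2(2) by (simp add: 1(1) 2(1) gmul_tensor flip: 1(2) 2(2)) (simp add: algebra_simps)
qed

lemma subspace_Tfil: "pm.subspace (Tfil G n)"
  by (simp add: Tfil_span)

lemma Tfil_galg: "Tfil G n \<subseteq> galg (G \<times>\<times> G)"
  unfolding Tfil_span
  by (intro pm.span_minimal subspace_galg) (auto intro!: tensor_galg power_galg)

lemma Tfil_0: "Tfil G 0 = galg (G \<times>\<times> G)"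
proof (intro equalityI Tfil_galg)
  have "pt z \<in> Tfil G 0" if z: "z \<in> carrier (G \<times>\<times> G)" for z :: "'a \<times> 'a"
  proof -
    obtain g h where "z = (g, h)" "g \<in> carrier G" "h \<in> carrier G" using z by auto
    then show ?thesis
      using Tfil_base[of "pt g" 0 "pt h" 0] by (simp add: pt_galg)
  qed
  then show "galg (G \<times>\<times> G) \<subseteq> Tfil G 0"
    unfolding galg_span by (intro pm.span_minimal subspace_Tfil) auto
qed

lemma galg_ideal_Tfil: "galg_ideal (G \<times>\<times> G) (Tfil G n)"
  unfolding galg_ideal_def
  by (intro conjI ballI subspace_Tfil Tfil_galg
        Tfil_mult[of _ 0 _ n, simplified] Tfil_mult[of _ n _ 0, simplified])
    (simp_all add: Tfil_0)

lemma Tfil_Suc_subset: "Tfil G (Suc n) \<subseteq> Tfil G n"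
  unfolding Tfil_span
proof (intro pm.span_mono subsetI)
  fix x :: "('a \<times> 'a) \<Rightarrow>\<^sub>0 'c"
  assume "x \<in> {tensor a b | a b. \<exists>p q. p + q = Suc n \<and> a \<in> Ipow G p \<and> b \<in> Ipow G q}"
  then obtain a b p q where 1: "x = tensor a b" "p + q = Suc n" "a \<in> Ipow G p" "b \<in> Ipow G q"
    by auto
  show "x \<in> {tensor a b | a b. \<exists>p q. p + q = n \<and> a \<in> Ipow G p \<and> b \<in> Ipow G q}"
  proof (cases p)
    case 0
    then have "b \<in> Ipow G n" using 1 power_Suc_subset by auto
    moreover have "0 + n = n" by simp
    ultimately show ?thesis using 1(1,3) 0 by blast
  next
    case (Suc p')
    then have "a \<in> Ipow G p'" using 1 power_Suc_subset by auto
    moreover have "p' + q = n" using 1(2) Suc by simp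
    ultimately show ?thesis using 1(1,4) by blast
  qed
qed

lemma Tfil_antimono: "m \<le> n \<Longrightarrow> Tfil G n \<subseteq> Tfil G m"
  by (rule lift_Suc_antimono_le[of "Tfil G"]) (use Tfil_Suc_subset in auto)

text \<open>By multiplicativity it suffices that
\<open>\<Delta>(g - 1) = (g - 1) \<otimes> g + 1 \<otimes> (g - 1)\<close> has filtration 1.\<close>

lemma comultiplication_filtration:
  "x \<in> Ipow G n \<Longrightarrow> comultiplication x \<in> Tfil G n"
proof (induction n arbitrary: x)
  case 0
  have "comultiplication x \<in> galg (G \<times>\<times> G)"
    by (rule lmap_span[OF lmap_comultiplication subspace_galg, of _ "pt ` carrier G"])
      (use 0 in \<open>auto simp: galg_span intro!: pm.span_base\<close>)
  then show ?case by (simp add: Tfil_0)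
next
  case (Suc n)
  have "comultiplication (x \<star> (pt g - pt \<one>)) \<in> Tfil G (Suc n)"
    if x: "x \<in> Ipow G n" and g: "g \<in> carrier G" for x :: "'a \<Rightarrow>\<^sub>0 'c" and g
  proof -
    have eq: "comultiplication (pt g - pt \<one>) = tensor (pt g - pt \<one>) (pt g) + tensor (pt \<one>) (pt g - pt \<one> :: 'a \<Rightarrow>\<^sub>0 'c)"
      by (simp add: comul_lin tensor_bilinear)
    have "comultiplication (pt g - pt \<one>) \<in> (Tfil G (Suc 0) :: ('a \<times> 'a \<Rightarrow>\<^sub>0 'c) set)"
      unfolding eq
      using Tfil_base[OF pt_diff_power_1[OF g], of "pt g" 0]
        Tfil_base[of "pt \<one>" 0, OF _ pt_diff_power_1[OF g]] g
      by (intro pm.subspace_add[OF subspace_Tfil]) (simp_all add: pt_galg)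
    from Tfil_mult[OF Suc.IH[OF x] this] show ?thesis
      by (simp add: comultiplication_gmul)
  qed
  with Suc.prems show ?case
    using power_Suc_lmap_pt[OF lmap_comultiplication subspace_Tfil] by blast
qed

lemma augmentation_Tfil:
  assumes "x \<in> Tfil G n" "1 \<le> n"
  shows "augmentation x = 0"
proof -
  have aug: "augmentation a = 0" if "a \<in> Ipow G p" "1 \<le> p" for a :: "'a \<Rightarrow>\<^sub>0 'c" and p
    using that power_antimono[of 1 p] by (auto simp: power_1 augmentation_ideal_iff)
  have "Tfil G n \<subseteq> {x :: 'a \<times> 'a \<Rightarrow>\<^sub>0 'c. augmentation x = 0}"
    unfolding Tfil_span
  proof (intro pm.span_minimal subspace_augmentation_kernel, clarsimp simp: augmentation_tensor)
    fix a b :: "'a \<Rightarrow>\<^sub>0 'c" and p q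
    assume "n = p + q" "augmentation b \<noteq> 0" "a \<in> Ipow G p" "b \<in> Ipow G q"
    with aug[of b q] aug[of a p] assms(2) show "augmentation a = 0" by fastforce
  qed
  with assms(1) show ?thesis by auto
qed

end

section \<open>The lower central series\<close>

context group
begin

text \<open>Conjugation by \<open>x\<close> is an automorphism, so the generators of the next term of the series are
permuted by it; this makes every term normal.\<close>

lemma conj_commutator:
  assumes "x \<in> carrier G" "h \<in> carrier G" "g \<in> carrier G"
  shows "x \<otimes> (h \<otimes> g \<otimes> inv h \<otimes> inv g) \<otimes> inv x =
    (x \<otimes> h \<otimes> inv x) \<otimes> (x \<otimes> g \<otimes> inv x) \<otimes> inv (x \<otimes> h \<otimes> inv x) \<otimes> inv (x \<otimes> g \<otimes> inv x)"
proof -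
  define c where "c y = x \<otimes> y \<otimes> inv x" for y
  have cc: "c y \<in> carrier G" if "y \<in> carrier G" for y using that assms(1) by (simp add: c_def)
  have cm: "c (y \<otimes> z) = c y \<otimes> c z" if "y \<in> carrier G" "z \<in> carrier G" for y z
    using that assms(1) by (simp add: c_def m_assoc inv_solve_left)
  have ci: "c (inv y) = inv (c y)" if "y \<in> carrier G" for y
    using that assms(1) by (simp add: c_def m_assoc inv_mult_group)
  show ?thesis
    using assms cm ci cc unfolding c_def[symmetric] by simp
qed

lemma lower_central_normal: "lower_central G n \<lhd> G"
proof (cases n)
  case 0
  then show ?thesis by (simp add: normal_inv_iff subgroup_self)
next
  case (Suc m)
  have "lower_central G (Suc m) \<lhd> G"
  proof (induction m)
    case 0
    show ?case by (simp add: normal_inv_iff subgroup_self)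
  next
    case (Suc m)
    interpret N: normal "lower_central G (Suc m)" G by (rule Suc)
    show ?case
      unfolding lower_central.simps
    proof (rule normal_generateI; clarsimp)
      fix h g x assume *: "h \<in> lower_central G (Suc m)" "g \<in> carrier G" "x \<in> carrier G"
      have "x \<otimes> h \<otimes> inv x \<in> lower_central G (Suc m)" using * by (simp add: N.inv_op_closed2)
      then show "\<exists>h'\<in>lower_central G (Suc m). \<exists>g'\<in>carrier G.
          x \<otimes> (h \<otimes> g \<otimes> inv h \<otimes> inv g) \<otimes> inv x = h' \<otimes> g' \<otimes> inv h' \<otimes> inv g'"
        using * by (intro bexI[of _ "x \<otimes> h \<otimes> inv x"] bexI[of _ "x \<otimes> g \<otimes> inv x"] conj_commutator) auto
    qed
  qed
  then show ?thesis using Suc by blast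
qed

lemma lower_central_subset: "lower_central G n \<subseteq> carrier G"
  using normal_imp_subgroup[OF lower_central_normal] subgroup.subset by blast

lemma commutator_in_lower_central:
  "h \<in> lower_central G (Suc n) \<Longrightarrow> g \<in> carrier G \<Longrightarrow> h \<otimes> g \<otimes> inv h \<otimes> inv g \<in> lower_central G (Suc (Suc n))"
  by (auto intro!: generate.incl)

lemma lower_central_Suc_subset: "lower_central G (Suc n) \<subseteq> lower_central G n"
proof (cases n)
  case (Suc m)
  interpret N: normal "lower_central G (Suc m)" G by (rule lower_central_normal)
  show ?thesis
    unfolding Suc lower_central.simps(3)
  proof (rule generate_subgroup_incl[OF _ N.subgroup_axioms]; clarsimp)
    fix h g assume *: "h \<in> lower_central G (Suc m)" "g \<in> carrier G"
    have "h \<otimes> (g \<otimes> inv h \<otimes> inv g) \<in> lower_central G (Suc m)"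
      using * by (intro N.m_closed N.inv_op_closed2 N.m_inv_closed)
    then show "h \<otimes> g \<otimes> inv h \<otimes> inv g \<in> lower_central G (Suc m)"
      using * N.mem_carrier by (simp add: m_assoc)
  qed
qed simp

lemma lower_central_antimono: "m \<le> n \<Longrightarrow> lower_central G n \<subseteq> lower_central G m"
  by (rule lift_Suc_antimono_le[of "lower_central G"]) (use lower_central_Suc_subset in auto)

lemma pt_diff_mult:
  assumes "x \<in> carrier G" "y \<in> carrier G"
    and "pt x - pt \<one> \<in> (Ipow G n :: ('a \<Rightarrow>\<^sub>0 'k::field) set)" "pt y - pt \<one> \<in> (Ipow G n :: ('a \<Rightarrow>\<^sub>0 'k::field) set)"
  shows "pt (x \<otimes> y) - pt \<one> \<in> (Ipow G n :: ('a \<Rightarrow>\<^sub>0 'k::field) set)"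
proof -
  have eq: "pt (x \<otimes> y) - pt \<one> = (pt x - pt \<one>) \<star> pt y + (pt y - pt \<one> :: 'a \<Rightarrow>\<^sub>0 'k)"
    using assms(1,2) by (simp add: gmul_bilinear)
  show ?thesis
    unfolding eq using assms by (intro pm.subspace_add[OF subspace_power] power_right pt_galg)
qed

lemma pt_diff_inv:
  assumes "x \<in> carrier G" "pt x - pt \<one> \<in> (Ipow G n :: ('a \<Rightarrow>\<^sub>0 'k::field) set)"
  shows "pt (inv x) - pt \<one> \<in> (Ipow G n :: ('a \<Rightarrow>\<^sub>0 'k::field) set)"
proof -
  have eq: "pt (inv x) - pt \<one> = - (pt (inv x) \<star> (pt x - pt \<one> :: 'a \<Rightarrow>\<^sub>0 'k))"
    using assms(1) by (simp add: gmul_bilinear)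
  show ?thesis
    unfolding eq using assms by (intro pm.subspace_neg[OF subspace_power] power_left pt_galg inv_closed)
qed

text \<open>With \<open>u = h - 1\<close> and \<open>v = g - 1\<close> one has \<open>[h, g] - 1 = (u v - v u) h\<^sup>-\<^sup>1 g\<^sup>-\<^sup>1\<close>, so a
commutator with \<open>h \<in> \<Gamma>\<^sub>n\<close> gains one power of the augmentation ideal.\<close>

lemma lower_central_power:
  assumes "g \<in> lower_central G n"
  shows "pt g - pt \<one> \<in> (Ipow G n :: ('a \<Rightarrow>\<^sub>0 'k::field) set)"
proof (cases n)
  case 0
  then show ?thesis using assms by (auto intro!: pm.subspace_diff[OF subspace_galg] pt_galg)
next
  case (Suc m)
  have "pt g - pt \<one> \<in> (Ipow G (Suc m) :: ('a \<Rightarrow>\<^sub>0 'k) set)" if "g \<in> lower_central G (Suc m)" for g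
    using that
  proof (induction m arbitrary: g)
    case 0
    then show ?case by (simp add: pt_diff_power_1)
  next
    case (Suc m)
    have K: "x \<in> carrier G \<and> pt x - pt \<one> \<in> (Ipow G (Suc (Suc m)) :: ('a \<Rightarrow>\<^sub>0 'k) set)"
      if x: "x \<in> (\<Union>h\<in>lower_central G (Suc m). \<Union>g\<in>carrier G. {h \<otimes> g \<otimes> inv h \<otimes> inv g})" for x
    proof -
      obtain h g where h: "h \<in> lower_central G (Suc m)" "g \<in> carrier G" and xe: "x = h \<otimes> g \<otimes> inv h \<otimes> inv g"
        using x by auto
      have hc: "h \<in> carrier G" using h lower_central_subset by auto
      let ?u = "pt h - pt \<one> :: 'a \<Rightarrow>\<^sub>0 'k" and ?v = "pt g - pt \<one> :: 'a \<Rightarrow>\<^sub>0 'k"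
      have c1: "?u \<star> ?v - ?v \<star> ?u = pt (h \<otimes> g) - pt (g \<otimes> h)"
        using hc h(2) by (simp add: gmul_bilinear algebra_simps)
      have e1: "g \<otimes> h \<otimes> (inv h \<otimes> inv g) = \<one>"
        using hc h(2) by (simp add: inv_mult_group[symmetric])
      have e2: "h \<otimes> g \<otimes> (inv h \<otimes> inv g) = x"
        unfolding xe using hc h(2) by (simp add: m_assoc)
      have eq: "pt x - pt \<one> = (?u \<star> ?v - ?v \<star> ?u) \<star> pt (inv h \<otimes> inv g)"
        unfolding c1 by (simp add: gmul_bilinear e1 e2)
      have "?u \<star> ?v - ?v \<star> ?u \<in> Ipow G (Suc (Suc m))"
        using power_mult[OF Suc.IH[OF h(1)] pt_diff_power_1[OF h(2)]] power_mult[OF pt_diff_power_1[OF h(2)] Suc.IH[OF h(1)]]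
        by (intro pm.subspace_diff[OF subspace_power]) simp_all
      then have "pt x - pt \<one> \<in> (Ipow G (Suc (Suc m)) :: ('a \<Rightarrow>\<^sub>0 'k) set)"
        unfolding eq using hc h(2) by (intro power_right pt_galg m_closed inv_closed)
      then show ?thesis
        using hc h(2) by (simp add: xe)
    qed
    from Suc.prems show ?case
      unfolding lower_central.simps
    proof (induction rule: generate.induct)
      case one
      show ?case by (simp add: pm.subspace_0[OF subspace_power])
    next
      case (incl h)
      then show ?case using K by blast
    next
      case (inv h)
      then show ?case using K by (blast intro: pt_diff_inv)
    next
      case (eng h1 h2)
      have "h1 \<in> carrier G" "h2 \<in> carrier G"
        using generate_in_carrier[OF _ eng(1)] generate_in_carrier[OF _ eng(2)] K by blast+
      then show ?case using eng.IH by (rule pt_diff_mult)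
    qed
  qed
  then show ?thesis using assms Suc by blast
qed

end

section \<open>Functoriality\<close>

definition pushforward :: "('g \<Rightarrow> 'h) \<Rightarrow> ('g \<Rightarrow>\<^sub>0 'k::field) \<Rightarrow> ('h \<Rightarrow>\<^sub>0 'k)" where
  "pushforward f = lin_ext (\<lambda>g. pt (f g))"

lemma lmap_pushforward: "lmap (pushforward f)"
  by (simp add: pushforward_def lmap_lin_ext)

lemma pushforward_pt [simp]: "pushforward f (pt g) = pt (f g)"
  by (simp add: pushforward_def)

lemmas pushforward_lin = lmapD[OF lmap_pushforward]

lemma augmentation_pushforward: "augmentation (pushforward f a) = augmentation a"
proof -
  have "pm.subspace {a. augmentation (pushforward f a) = augmentation a}"
    by (auto simp: pm.subspace_def pushforward_lin augmentation_add augmentation_scale)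
  from pm_subspace_induct[OF this, of a UNIV] show ?thesis by simp
qed

lemma pushforward_tensor:
  "pushforward (map_prod f f') (tensor a b) = tensor (pushforward f a) (pushforward f' b)"
proof -
  have 1: "pushforward (map_prod f f') (tensor (pt x) b) = tensor (pushforward f (pt x)) (pushforward f' b)" for x
    by (rule lmap_eq[of _ _ b]) (auto intro!: lmapI simp: pushforward_lin tensor_bilinear)
  show ?thesis
    by (rule lmap_eq[of _ _ a]) (auto intro!: lmapI simp: pushforward_lin tensor_bilinear 1[simplified])
qed

lemma pushforward_comultiplication:
  "pushforward (map_prod f f) (comultiplication a) = comultiplication (pushforward f a)"
  by (rule lmap_eq[of _ _ a]) (auto intro!: lmapI simp: pushforward_lin comul_lin)

text \<open>A point of the completion is primitive precisely when the defect of its representative modulo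
\<open>I\<^sup>n\<close> lies in the term \<open>n\<close> of the tensor filtration, for all \<open>n\<close>
(lemma \<open>primitive_elements_rep\<close>).\<close>

definition primitive_defect :: "('g, 'b) monoid_scheme \<Rightarrow> ('g \<Rightarrow>\<^sub>0 'k::field) \<Rightarrow> ('g \<times> 'g \<Rightarrow>\<^sub>0 'k)" where
  "primitive_defect G a = comultiplication a - tensor a (pt \<one>\<^bsub>G\<^esub>) - tensor (pt \<one>\<^bsub>G\<^esub>) a"

lemma lmap_primitive_defect: "lmap (primitive_defect G)"
  by (rule lmapI) (simp_all add: primitive_defect_def comul_lin tensor_bilinear pm.scale_right_diff_distrib)

lemmas primitive_defect_lin = lmapD[OF lmap_primitive_defect]

context group_hom
begin

lemma pushforward_galg: "a \<in> galg G \<Longrightarrow> pushforward h a \<in> galg H"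
  by (rule lmap_span[OF lmap_pushforward subspace_galg, of _ "pt ` carrier G"])
    (auto simp: galg_span intro!: pm.span_base)

lemma pushforward_gmul:
  assumes "a \<in> galg G" "b \<in> galg G"
  shows "pushforward h (gmul G a b) = gmul H (pushforward h a) (pushforward h b)"
proof -
  have 1: "pushforward h (gmul G (pt x) b) = gmul H (pushforward h (pt x)) (pushforward h b)" if "x \<in> carrier G" for x
    by (rule lmap_eq_on[of _ _ b "carrier G"])
      (use that assms in \<open>auto intro!: lmapI simp: pushforward_lin gmul_bilinear galg_iff\<close>)
  show ?thesis
    by (rule lmap_eq_on[of _ _ a "carrier G"])
      (use assms in \<open>auto intro!: lmapI simp: pushforward_lin gmul_bilinear galg_iff 1[simplified]\<close>)
qed

lemma pushforward_power:
  "a \<in> Ipow G n \<Longrightarrow> pushforward h a \<in> Ipow H n"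
proof (induction n arbitrary: a)
  case 0
  then show ?case by (simp add: pushforward_galg)
next
  case (Suc n)
  have "pushforward h (gmul G u (pt g - pt \<one>)) \<in> Ipow H (Suc n)"
    if u: "u \<in> Ipow G n" and g: "g \<in> carrier G" for g and u :: "'a \<Rightarrow>\<^sub>0 'e"
  proof -
    have "pt g - pt \<one> \<in> (galg G :: ('a \<Rightarrow>\<^sub>0 'e) set)" using g by (auto intro!: pm.subspace_diff[OF subspace_galg] pt_galg)
    then have "pushforward h (gmul G u (pt g - pt \<one>)) = gmul H (pushforward h u) (pt (h g) - pt \<one>\<^bsub>H\<^esub>)"
      using G.power_galg[OF u] by (simp add: pushforward_gmul pushforward_lin)
    then show ?thesis
      using H.power_mult[OF Suc.IH[OF u] H.pt_diff_power_1[of "h g"]] g by simp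
  qed
  then show ?case
    using Suc.prems G.power_Suc_lmap_pt[OF lmap_pushforward H.subspace_power] by blast
qed

lemma pushforward_Tfil:
  assumes "a \<in> Tfil G n"
  shows "pushforward (map_prod h h) a \<in> Tfil H n"
  by (rule G.Tfil_lmap[OF lmap_pushforward H.subspace_Tfil assms])
    (auto simp: pushforward_tensor intro!: H.Tfil_base pushforward_power)

lemma pushforward_primitive_defect:
  "pushforward (map_prod h h) (primitive_defect G a) = primitive_defect H (pushforward h a)"
  by (simp add: primitive_defect_def pushforward_lin pushforward_tensor pushforward_comultiplication)

lemma lower_central_img:
  assumes surj: "h ` carrier G = carrier H"
  shows "lower_central H n \<subseteq> h ` lower_central G n"
proof (cases n)
  case 0
  then show ?thesis using surj by simp
next
  case (Suc m)
  have "lower_central H (Suc m) \<subseteq> h ` lower_central G (Suc m)" for m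
  proof (induction m)
    case 0
    then show ?case using surj by simp
  next
    case (Suc m)
    let ?K = "\<Union>x\<in>lower_central G (Suc m). \<Union>g\<in>carrier G. {x \<otimes> g \<otimes> inv x \<otimes> inv g}"
    have c: "x \<in> carrier G" if "x \<in> lower_central G (Suc m)" for x
      using that G.lower_central_subset by auto
    have K: "?K \<subseteq> carrier G" using c by auto
    have "(\<Union>x\<in>lower_central H (Suc m). \<Union>g\<in>carrier H. {x \<otimes>\<^bsub>H\<^esub> g \<otimes>\<^bsub>H\<^esub> inv\<^bsub>H\<^esub> x \<otimes>\<^bsub>H\<^esub> inv\<^bsub>H\<^esub> g}) \<subseteq> h ` ?K"
    proof clarify
      fix x g assume "x \<in> lower_central H (Suc m)" "g \<in> carrier H"
      then obtain x' g' where *: "x = h x'" "x' \<in> lower_central G (Suc m)" "g = h g'" "g' \<in> carrier G"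
        using Suc.IH surj by blast
      then have "x \<otimes>\<^bsub>H\<^esub> g \<otimes>\<^bsub>H\<^esub> inv\<^bsub>H\<^esub> x \<otimes>\<^bsub>H\<^esub> inv\<^bsub>H\<^esub> g = h (x' \<otimes> g' \<otimes> inv x' \<otimes> inv g')"
        using c by simp
      with * show "x \<otimes>\<^bsub>H\<^esub> g \<otimes>\<^bsub>H\<^esub> inv\<^bsub>H\<^esub> x \<otimes>\<^bsub>H\<^esub> inv\<^bsub>H\<^esub> g \<in> h ` ?K" by blast
    qed
    then have "lower_central H (Suc (Suc m)) \<subseteq> generate H (h ` ?K)"
      unfolding lower_central.simps by (rule H.mono_generate)
    also have "\<dots> = h ` lower_central G (Suc (Suc m))"
      by (simp add: generate_img[OF K])
    finally show ?case .
  qed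
  then show ?thesis using Suc by blast
qed

text \<open>A section \<open>\<sigma>\<close> of \<open>h\<close> induces a linear map backwards. Elements of one fibre of \<open>h\<close> agree modulo
\<open>I\<^sup>i\<close>, so modulo \<open>I\<^sup>i\<close> this linear map is multiplicative and inverts the pushforward. For \<open>n \<le> i\<close>
it therefore maps the power \<open>n\<close> of one augmentation ideal into that of the other.\<close>

lemma pushforward_reflects_power:
  fixes a :: "'a \<Rightarrow>\<^sub>0 'k::field"
  assumes surj: "h ` carrier G = carrier H"
    and ker: "\<And>g. g \<in> carrier G \<Longrightarrow> h g = \<one>\<^bsub>H\<^esub> \<Longrightarrow> pt g - pt \<one> \<in> (Ipow G i :: ('a \<Rightarrow>\<^sub>0 'k) set)"
    and "n \<le> i" and a: "a \<in> galg G" and pa: "pushforward h a \<in> Ipow H n"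
  shows "a \<in> Ipow G n"
proof -
  define \<sigma> where "\<sigma> = inv_into (carrier G) h"
  have \<sigma>: "\<sigma> y \<in> carrier G" "h (\<sigma> y) = y" if "y \<in> carrier H" for y
    using that surj unfolding \<sigma>_def by (auto intro: inv_into_into f_inv_into_f)
  let ?S = "pushforward \<sigma> :: ('c \<Rightarrow>\<^sub>0 'k) \<Rightarrow> _"
  have eq: "pt x - pt y \<in> (Ipow G i :: ('a \<Rightarrow>\<^sub>0 'k) set)" if xy: "x \<in> carrier G" "y \<in> carrier G" "h x = h y" for x y
  proof -
    have eq: "pt x - pt y = gmul G (pt (x \<otimes> inv y) - pt \<one>) (pt y :: 'a \<Rightarrow>\<^sub>0 'k)"
      using xy by (simp add: gmul_bilinear G.m_assoc)
    show ?thesis unfolding eq using xy by (intro G.power_right ker pt_galg) auto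
  qed
  have 1: "?S (pushforward h x) - x \<in> Ipow G i" if x: "x \<in> galg G" for x
  proof (rule lmap_span[OF _ G.subspace_power, of _ x "pt ` carrier G"])
    show "lmap (\<lambda>x. ?S (pushforward h x) - x)"
      by (rule lmapI) (simp_all add: pushforward_lin pm.scale_right_diff_distrib)
    show "x \<in> pm.span (pt ` carrier G)" using x by (simp add: galg_span)
  qed (auto intro!: eq \<sigma>)
  have 2: "?S y \<in> Ipow G n" if "y \<in> Ipow H n" "n \<le> i" for y n
    using that
  proof (induction n arbitrary: y)
    case 0
    have "?S y \<in> galg G"
      by (rule lmap_span[OF lmap_pushforward subspace_galg, of _ "pt ` carrier H"])
        (use 0 in \<open>auto simp: galg_span intro!: pm.span_base \<sigma>\<close>)
    then show ?case by simp
  next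
    case (Suc n)
    have "?S (gmul H u (pt g - pt \<one>\<^bsub>H\<^esub>)) \<in> Ipow G (Suc n)"
      if u: "u \<in> Ipow H n" and g: "g \<in> carrier H" for u g
    proof -
      have "?S (gmul H u (pt g)) - gmul G (?S u) (pt (\<sigma> g)) \<in> Ipow G i"
      proof (rule lmap_span[OF _ G.subspace_power, of _ u "pt ` carrier H"])
        show "lmap (\<lambda>u. ?S (gmul H u (pt g)) - gmul G (?S u) (pt (\<sigma> g)))"
          by (rule lmapI) (simp_all add: pushforward_lin gmul_bilinear pm.scale_right_diff_distrib)
        show "u \<in> pm.span (pt ` carrier H)" using H.power_galg[OF u] by (simp add: galg_span)
      qed (use g in \<open>auto intro!: eq simp: \<sigma>\<close>)
      then have d: "?S (gmul H u (pt g)) - gmul G (?S u) (pt (\<sigma> g)) \<in> Ipow G (Suc n)"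
        using G.power_antimono[OF \<open>Suc n \<le> i\<close>] by blast
      have Su: "?S u \<in> Ipow G n" using Suc.IH[OF u] Suc.prems by simp
      have "?S (gmul H u (pt g - pt \<one>\<^bsub>H\<^esub>)) =
        (?S (gmul H u (pt g)) - gmul G (?S u) (pt (\<sigma> g))) + gmul G (?S u) (pt (\<sigma> g) - pt \<one>)"
        using H.power_galg[OF u] G.power_galg[OF Su]
        by (simp add: gmul_bilinear pushforward_lin H.gmul_one G.gmul_one)
      then show ?thesis
        using d G.power_mult[OF Su G.pt_diff_power_1[OF \<sigma>(1)[OF g]]]
        by (auto intro!: pm.subspace_add[OF G.subspace_power])
    qed
    then show ?case
      using Suc.prems(1) H.power_Suc_lmap_pt[OF lmap_pushforward G.subspace_power] by blast
  qed
  have "?S (pushforward h a) - a \<in> Ipow G n"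
    using 1[OF a] G.power_antimono[OF \<open>n \<le> i\<close>] by blast
  then show ?thesis
    using subspace_diff_cancel[OF G.subspace_power] 2[OF pa \<open>n \<le> i\<close>] by blast
qed

end

section \<open>The Dynkin operator\<close>

context group
begin

lemma antipode_gmul:
  assumes "a \<in> galg G" "b \<in> galg G"
  shows "pushforward (m_inv G) (a \<star> b) = pushforward (m_inv G) b \<star> pushforward (m_inv G) a"
proof -
  have 1: "pushforward (m_inv G) (pt x \<star> b) = pushforward (m_inv G) b \<star> pushforward (m_inv G) (pt x)"
    if "x \<in> carrier G" for x
    by (rule lmap_eq_on[of _ _ b "carrier G"])
      (use that assms in \<open>auto intro!: lmapI simp: pushforward_lin gmul_bilinear galg_iff inv_mult_group\<close>)
  show ?thesis
    by (rule lmap_eq_on[of _ _ a "carrier G"])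
      (use assms in \<open>auto intro!: lmapI simp: pushforward_lin gmul_bilinear galg_iff 1[simplified]\<close>)
qed

lemma antipode_galg: "a \<in> galg G \<Longrightarrow> pushforward (m_inv G) a \<in> galg G"
  by (rule lmap_span[OF lmap_pushforward subspace_galg, of _ "pt ` carrier G"])
    (auto simp: galg_span intro!: pm.span_base)

lemma antipode_power:
  "a \<in> Ipow G n \<Longrightarrow> pushforward (m_inv G) a \<in> Ipow G n"
proof (induction n arbitrary: a)
  case 0
  then show ?case by (simp add: antipode_galg)
next
  case (Suc n)
  have "pushforward (m_inv G) (u \<star> v) \<in> Ipow G (Suc n)"
    if u: "u \<in> Ipow G n" and v: "v \<in> augmentation_ideal G" for u v :: "'a \<Rightarrow>\<^sub>0 'c"
  proof -
    have "pushforward (m_inv G) v \<in> Ipow G (Suc 0)"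
      using v by (simp add: power_1 augmentation_ideal_iff antipode_galg augmentation_pushforward)
    from power_mult[OF this Suc.IH[OF u]] show ?thesis
      using v power_galg[OF u] by (simp add: antipode_gmul augmentation_ideal_iff)
  qed
  then show ?case
    using Suc.prems power_Suc_lmap[OF lmap_pushforward subspace_power] by blast
qed

text \<open>Multiplication by the degree makes sense only on the associated graded algebra. A weight
operator is a linear map of the group algebra itself that induces it in degrees up to \<open>n\<close>; its
convolution with the antipode is then a linear map on the tensor square of the group algebra.\<close>

definition weight_operator :: "nat \<Rightarrow> (('a \<Rightarrow>\<^sub>0 'k::field) \<Rightarrow> ('a \<Rightarrow>\<^sub>0 'k)) \<Rightarrow> bool" where
  "weight_operator n E \<longleftrightarrow> lmap E \<and> (\<forall>x. E x \<in> galg G) \<and>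
     (\<forall>r\<le>n. \<forall>x\<in>Ipow G r. E x - scale (of_nat r) x \<in> Ipow G (Suc r)) \<and>
     (\<forall>x\<in>Ipow G (Suc n). E x \<in> Ipow G (Suc n))"

text \<open>Choose any linear projections \<open>P\<^sub>q\<close> onto \<open>I\<^sup>q\<close>, for \<open>1 \<le> q \<le> n\<close>, and add them. On \<open>I\<^sup>r\<close> the
projections with \<open>q \<le> r\<close> are the identity, and those with \<open>q > r\<close> land in \<open>I\<^sup>r\<^sup>+\<^sup>1\<close>.\<close>

lemma weight_operator_exists: "\<exists>E :: ('a \<Rightarrow>\<^sub>0 'k::field) \<Rightarrow> ('a \<Rightarrow>\<^sub>0 'k). weight_operator n E"
proof -
  have "\<exists>P. lmap P \<and> range P \<subseteq> Ipow G q \<and> (\<forall>x\<in>Ipow G q. P x = (x :: 'a \<Rightarrow>\<^sub>0 'k))" for q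
    using pmp.linear_exists_left_inverse_on[OF lmap_id[where 'a='k and 'b='a] subspace_power[of q]] by (auto simp: inj_on_def)
  then obtain P where P: "\<And>q. lmap (P q)" "\<And>q x. P q x \<in> Ipow G q"
    "\<And>q x. x \<in> Ipow G q \<Longrightarrow> P q x = (x :: 'a \<Rightarrow>\<^sub>0 'k)"
    by (metis rangeI subsetD)
  define E where "E x = (\<Sum>q\<in>{1..n}. P q x)" for x
  have "lmap E"
    unfolding E_def by (rule lmapI) (simp_all add: lmapD[OF P(1)] sum.distrib pm.scale_sum_right)
  moreover have "E x \<in> galg G" for x
    unfolding E_def by (intro pm.subspace_sum[OF subspace_galg] power_galg[OF P(2)])
  moreover have "E x - scale (of_nat r) x \<in> Ipow G (Suc r)"
    if r: "r \<le> n" and x: "x \<in> Ipow G r" for r x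
  proof -
    have "(\<Sum>q\<in>{1..n}. if q \<le> r then x else 0) = (\<Sum>q\<in>{1..r}. x)"
      using r by (intro sum.mono_neutral_cong_right) auto
    also have "\<dots> = scale (of_nat r) x" by (simp add: pm.sum_constant_scale)
    finally have "E x - scale (of_nat r) x = (\<Sum>q\<in>{1..n}. P q x - (if q \<le> r then x else 0))"
      by (simp add: E_def sum_subtractf)
    also have "\<dots> \<in> Ipow G (Suc r)"
    proof (rule pm.subspace_sum[OF subspace_power])
      fix q
      show "P q x - (if q \<le> r then x else 0) \<in> Ipow G (Suc r)"
      proof (cases "q \<le> r")
        case True
        then have "P q x = x" using x power_antimono[of q r] P(3) by blast
        then show ?thesis using True by (simp add: pm.subspace_0[OF subspace_power])
      next
        case False
        then have "P q x \<in> Ipow G (Suc r)" using P(2)[of q x] power_antimono[of "Suc r" q] by auto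
        then show ?thesis using False by simp
      qed
    qed
    finally show ?thesis .
  qed
  moreover have "E x \<in> Ipow G (Suc n)" if x: "x \<in> Ipow G (Suc n)" for x
    unfolding E_def
  proof (rule pm.subspace_sum[OF subspace_power])
    fix q assume "q \<in> {1..n}"
    then have "P q x = x" using x power_antimono[of q "Suc n"] P(3) by auto
    then show "P q x \<in> Ipow G (Suc n)" using x by simp
  qed
  ultimately show ?thesis unfolding weight_operator_def by blast
qed

text \<open>The linear map \<open>a \<otimes> b \<mapsto> S(a) E(b)\<close> with the antipode \<open>S\<close>. Composed with the comultiplication
it is the convolution product of \<open>S\<close> and \<open>E\<close>, which for a weight operator \<open>E\<close> is Dynkin's
operator.\<close>

definition convolve :: "(('a \<Rightarrow>\<^sub>0 'k::field) \<Rightarrow> ('a \<Rightarrow>\<^sub>0 'k)) \<Rightarrow> ('a \<times> 'a \<Rightarrow>\<^sub>0 'k) \<Rightarrow> ('a \<Rightarrow>\<^sub>0 'k)" where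
  "convolve E = lin_ext (\<lambda>(g, h). pt (inv g) \<star> E (pt h))"

lemma lmap_convolve: "lmap (convolve E)"
  by (simp add: convolve_def lmap_lin_ext)

lemmas convolve_lin = lmapD[OF lmap_convolve]

lemma convolve_pt: "convolve E (pt (g, h)) = pt (inv g) \<star> E (pt h)"
  by (simp add: convolve_def)

lemma convolve_tensor:
  assumes "lmap E"
  shows "convolve E (tensor a b) = pushforward (m_inv G) a \<star> E b"
proof -
  have 1: "convolve E (tensor (pt x) b) = pushforward (m_inv G) (pt x) \<star> E b" for x
    by (rule lmap_eq[of _ _ b]) (auto intro!: lmapI simp: convolve_lin tensor_bilinear gmul_bilinear lmapD[OF assms] convolve_pt)
  show ?thesis
    by (rule lmap_eq[of _ _ a]) (auto intro!: lmapI simp: convolve_lin tensor_bilinear gmul_bilinear pushforward_lin 1[simplified])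
qed

text \<open>The defining property of the antipode.\<close>

lemma convolve_id_comultiplication:
  assumes "y \<in> galg G"
  shows "convolve (\<lambda>x. x) (comultiplication y) = scale (augmentation y) (pt \<one>)"
  by (rule lmap_eq_on[of _ _ y "carrier G"])
    (use assms in \<open>auto intro!: lmapI simp: convolve_lin comul_lin augmentation_add augmentation_scale
      pm.scale_left_distrib galg_iff convolve_pt\<close>)

lemma weight_operator_preserves:
  assumes E: "weight_operator n E" and "r \<le> Suc n" and x: "x \<in> Ipow G r"
  shows "E x \<in> Ipow G r"
proof (cases "r = Suc n")
  case True
  then show ?thesis using E x unfolding weight_operator_def by blast
next
  case False
  then have "E x - scale (of_nat r) x \<in> Ipow G r"
    using E x \<open>r \<le> Suc n\<close> power_Suc_subset[of r] unfolding weight_operator_def by fastforce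
  then show ?thesis
    using subspace_diff_cancel[OF subspace_power] pm.subspace_scale[OF subspace_power x] by blast
qed

lemma convolve_filtration:
  assumes E: "weight_operator n E" and m: "m \<le> Suc n" and z: "z \<in> Tfil G m"
  shows "convolve E z \<in> Ipow G m"
proof (rule Tfil_lmap[OF lmap_convolve subspace_power z])
  fix a b :: "'a \<Rightarrow>\<^sub>0 'c" and p q
  assume a: "a \<in> Ipow G p" and b: "b \<in> Ipow G q" and pq: "p + q = m"
  have "pushforward (m_inv G) a \<star> E b \<in> Ipow G (p + q)"
    using pq m by (intro power_mult antipode_power a weight_operator_preserves[OF E] b) auto
  then show "convolve E (tensor a b) \<in> Ipow G m"
    using E pq by (simp add: convolve_tensor weight_operator_def)
qed

text \<open>To leading order \<open>E\<close> is a derivation, and \<open>g - 1\<close> has weight 1.\<close>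

lemma weight_operator_step:
  fixes b :: "'a \<Rightarrow>\<^sub>0 'k::field"
  assumes E: "weight_operator n E" and q: "Suc q \<le> n" and b: "b \<in> Ipow G q" and g: "g \<in> carrier G"
  shows "E (b \<star> pt g) - E b \<star> pt g - b \<star> (pt g - pt \<one>) \<in> Ipow G (Suc (Suc q))"
proof -
  let ?v = "pt g - pt \<one> :: 'a \<Rightarrow>\<^sub>0 'k"
  have bv: "b \<star> ?v \<in> Ipow G (Suc q)"
    using power_mult[OF b pt_diff_power_1[OF g]] by simp
  have Eb: "E b - scale (of_nat q) b \<in> Ipow G (Suc q)"
    using E b q unfolding weight_operator_def by simp
  have 1: "E (b \<star> ?v) - scale (of_nat (Suc q)) (b \<star> ?v) \<in> Ipow G (Suc (Suc q))"
    using E bv q unfolding weight_operator_def by blast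
  have 2: "(E b - scale (of_nat q) b) \<star> ?v \<in> Ipow G (Suc (Suc q))"
    using power_mult[OF Eb pt_diff_power_1[OF g]] by simp
  have lE: "lmap E" and gE: "E b \<in> galg G" using E unfolding weight_operator_def by auto
  have "E (b \<star> pt g) - E b \<star> pt g - b \<star> ?v =
      (E (b \<star> ?v) - scale (of_nat (Suc q)) (b \<star> ?v)) - (E b - scale (of_nat q) b) \<star> ?v"
    using power_galg[OF b] gE
    by (simp add: gmul_bilinear gmul_one lmapD[OF lE] pm.scale_left_distrib pm.scale_right_diff_distrib)
  then show ?thesis using 1 2 by (simp add: pm.subspace_diff[OF subspace_power])
qed

text \<open>For \<open>z = \<Delta> y\<close> with \<open>y \<in> I\<^sup>m\<close> of augmentation 0 the last term vanishes, and the claim about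
Dynkin's operator \<open>D\<close> is that \<open>D(y g)\<close> agrees with \<open>g\<^sup>-\<^sup>1 D(y) g\<close> modulo \<open>I\<^sup>m\<^sup>+\<^sup>2\<close>. Hence
\<open>D(y (g - 1))\<close> is the commutator \<open>g\<^sup>-\<^sup>1 D(y) g - D(y)\<close> to leading order.\<close>

lemma convolve_step:
  fixes z :: "'a \<times> 'a \<Rightarrow>\<^sub>0 'k::field"
  assumes E: "weight_operator n E" and m: "Suc m \<le> n" and z: "z \<in> Tfil G m" and g: "g \<in> carrier G"
  shows "convolve E (gmul (G \<times>\<times> G) z (pt (g, g))) - pt (inv g) \<star> (convolve E z \<star> pt g)
    - pt (inv g) \<star> (convolve (\<lambda>x. x) z \<star> (pt g - pt \<one>)) \<in> Ipow G (Suc (Suc m))"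
proof (rule Tfil_lmap[OF _ subspace_power z])
  show "lmap (\<lambda>z :: 'a \<times> 'a \<Rightarrow>\<^sub>0 'k. convolve E (gmul (G \<times>\<times> G) z (pt (g, g))) - pt (inv g) \<star> (convolve E z \<star> pt g)
    - pt (inv g) \<star> (convolve (\<lambda>x. x) z \<star> (pt g - pt \<one>)))"
    by (rule lmapI) (simp_all add: gmul_bilinear convolve_lin pm.scale_right_diff_distrib)
next
  fix a b :: "'a \<Rightarrow>\<^sub>0 'k" and p q
  assume a: "a \<in> Ipow G p" and b: "b \<in> Ipow G q" and pq: "p + q = m"
  have lE: "lmap E" and gE: "E x \<in> galg G" for x using E unfolding weight_operator_def by auto
  let ?a = "pushforward (m_inv G) a" and ?v = "pt g - pt \<one> :: 'a \<Rightarrow>\<^sub>0 'k"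
  let ?w = "E (b \<star> pt g) - E b \<star> pt g - b \<star> ?v"
  have c: "a \<in> galg G" "b \<in> galg G" "?a \<in> galg G" "pt g \<in> (galg G :: ('a \<Rightarrow>\<^sub>0 'k) set)"
    "pt (inv g) \<in> (galg G :: ('a \<Rightarrow>\<^sub>0 'k) set)" "?v \<in> galg G"
    using power_galg[OF a] power_galg[OF b] g
    by (auto intro!: pt_galg antipode_galg pm.subspace_diff[OF subspace_galg])
  have eq: "gmul (G \<times>\<times> G) (tensor a b) (pt (g, g)) = tensor (a \<star> pt g) (b \<star> pt g)"
    using gmul_tensor[of G G a b "pt g" "pt g"] by simp
  have "convolve E (gmul (G \<times>\<times> G) (tensor a b) (pt (g, g))) - pt (inv g) \<star> (convolve E (tensor a b) \<star> pt g)
    - pt (inv g) \<star> (convolve (\<lambda>x. x) (tensor a b) \<star> ?v)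
    = (pt (inv g) \<star> ?a) \<star> E (b \<star> pt g) - pt (inv g) \<star> ((?a \<star> E b) \<star> pt g) - pt (inv g) \<star> ((?a \<star> b) \<star> ?v)"
    unfolding eq convolve_tensor[OF lE] convolve_tensor[OF lmap_id]
    using c by (simp add: antipode_gmul)
  also have "\<dots> = pt (inv g) \<star> (?a \<star> E (b \<star> pt g)) - pt (inv g) \<star> (?a \<star> (E b \<star> pt g)) - pt (inv g) \<star> (?a \<star> (b \<star> ?v))"
    using c gE by (simp only: gmul_assoc gmul_galg)
  also have "\<dots> = pt (inv g) \<star> (?a \<star> ?w)"
    by (simp only: gmul_bilinear)
  also have "\<dots> \<in> Ipow G (Suc (Suc m))"
  proof (rule power_left[OF c(5)])
    have "Suc q \<le> n" using pq m by simp
    from power_mult[OF antipode_power[OF a] weight_operator_step[OF E this b g]]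
    show "?a \<star> ?w \<in> Ipow G (Suc (Suc m))"
      using pq by simp
  qed
  finally show "convolve E (gmul (G \<times>\<times> G) (tensor a b) (pt (g, g))) - pt (inv g) \<star> (convolve E (tensor a b) \<star> pt g)
    - pt (inv g) \<star> (convolve (\<lambda>x. x) (tensor a b) \<star> ?v) \<in> Ipow G (Suc (Suc m))" .
qed

text \<open>For \<open>m \<ge> 1\<close> these elements are, modulo \<open>I\<^sup>m\<^sup>+\<^sup>1\<close>, the part of degree \<open>m\<close> of the Lie algebra generated
in degree 1: iterated brackets of classes of \<open>g - 1\<close> are realised by iterated group commutators.\<close>

definition bracket_part :: "nat \<Rightarrow> ('a \<Rightarrow>\<^sub>0 'k::field) set" where
  "bracket_part m = pm.span ((\<lambda>g. pt g - pt \<one>) ` lower_central G m \<union> Ipow G (Suc m))"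

text \<open>If \<open>h \<in> \<Gamma>\<^sub>m\<close>, then \<open>g\<^sup>-\<^sup>1 h g = h c\<close> with \<open>c \<in> \<Gamma>\<^sub>m\<^sub>+\<^sub>1\<close>, and \<open>h c - h\<close> agrees with \<open>c - 1\<close> modulo
higher terms. On \<open>I\<^sup>m\<^sup>+\<^sup>1\<close> conjugation by \<open>g\<close> is the identity modulo \<open>I\<^sup>m\<^sup>+\<^sup>2\<close>.\<close>

lemma bracket_part_conj:
  fixes z :: "'a \<Rightarrow>\<^sub>0 'k::field"
  assumes z: "z \<in> bracket_part m" and "1 \<le> m" and g: "g \<in> carrier G"
  shows "pt (inv g) \<star> (z \<star> pt g) - z \<in> bracket_part (Suc m)"
proof -
  have sub: "Ipow G (Suc (Suc m)) \<subseteq> (bracket_part (Suc m) :: ('a \<Rightarrow>\<^sub>0 'k) set)"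
    unfolding bracket_part_def by (auto intro: pm.span_base)
  have l: "lmap (\<lambda>z :: 'a \<Rightarrow>\<^sub>0 'k. pt (inv g) \<star> (z \<star> pt g) - z)"
    by (rule lmapI) (simp_all add: gmul_bilinear pm.scale_right_diff_distrib)
  have W: "pm.subspace (bracket_part (Suc m) :: ('a \<Rightarrow>\<^sub>0 'k) set)" by (simp add: bracket_part_def)
  show ?thesis
  proof (rule lmap_span[OF l W z[unfolded bracket_part_def]])
    fix x :: "'a \<Rightarrow>\<^sub>0 'k"
    assume "x \<in> (\<lambda>g. pt g - pt \<one>) ` lower_central G m \<union> Ipow G (Suc m)"
    then show "pt (inv g) \<star> (x \<star> pt g) - x \<in> bracket_part (Suc m)"
    proof
      assume "x \<in> (\<lambda>g. pt g - pt \<one>) ` lower_central G m"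
      then obtain h where h: "h \<in> lower_central G m" and x: "x = pt h - pt \<one>" by auto
      have hc: "h \<in> carrier G" using h lower_central_subset by auto
      define c where "c = inv h \<otimes> inv g \<otimes> h \<otimes> g"
      have "inv h \<in> lower_central G m"
        by (rule subgroup.m_inv_closed[OF normal_imp_subgroup[OF lower_central_normal] h])
      then have c: "c \<in> lower_central G (Suc m)"
        using commutator_in_lower_central[of "inv h" "m - 1" "inv g"] \<open>1 \<le> m\<close> hc g by (simp add: c_def)
      have cc: "c \<in> carrier G" using hc g by (simp add: c_def)
      have hcg: "h \<otimes> c = inv g \<otimes> h \<otimes> g" "inv g \<otimes> (h \<otimes> g) = inv g \<otimes> h \<otimes> g"
        using hc g by (simp_all add: c_def m_assoc[symmetric])
      have "pt (inv g) \<star> (x \<star> pt g) - x = (pt c - pt \<one>) + (pt h - pt \<one>) \<star> (pt c - pt \<one>)"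
        unfolding x using hc g cc by (simp add: gmul_bilinear hcg)
      moreover have "pt c - pt \<one> \<in> (bracket_part (Suc m) :: ('a \<Rightarrow>\<^sub>0 'k) set)"
        using c unfolding bracket_part_def by (auto intro: pm.span_base)
      moreover have "(pt h - pt \<one>) \<star> (pt c - pt \<one>) \<in> (Ipow G (Suc (Suc m)) :: ('a \<Rightarrow>\<^sub>0 'k) set)"
      proof -
        have "(pt h - pt \<one>) \<star> (pt c - pt \<one>) \<in> (Ipow G (1 + Suc m) :: ('a \<Rightarrow>\<^sub>0 'k) set)"
          using pt_diff_power_1[OF hc] lower_central_power[OF c] by (intro power_mult) simp_all
        then show ?thesis by simp
      qed
      ultimately show ?thesis using sub by (auto intro!: pm.subspace_add[OF W])
    next
      assume x: "x \<in> Ipow G (Suc m)"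
      let ?v = "pt g - pt \<one> :: 'a \<Rightarrow>\<^sub>0 'k"
      have xc: "x \<in> galg G" using power_galg[OF x] .
      have gc: "pt g \<in> (galg G :: ('a \<Rightarrow>\<^sub>0 'k) set)" "pt (inv g) \<in> (galg G :: ('a \<Rightarrow>\<^sub>0 'k) set)" using g by (auto intro: pt_galg)
      have "x = pt (inv g) \<star> (pt g \<star> x)"
        using gmul_assoc[OF gc(2,1) xc] g xc by (simp add: gmul_one)
      then have "pt (inv g) \<star> (x \<star> pt g) - x = pt (inv g) \<star> (x \<star> ?v - ?v \<star> x)"
        using xc by (simp add: gmul_bilinear gmul_one)
      moreover have "x \<star> ?v - ?v \<star> x \<in> Ipow G (Suc (Suc m))"
        using power_mult[OF x pt_diff_power_1[OF g]] power_mult[OF pt_diff_power_1[OF g] x]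
        by (intro pm.subspace_diff[OF subspace_power]) simp_all
      ultimately have "pt (inv g) \<star> (x \<star> pt g) - x \<in> Ipow G (Suc (Suc m))"
        using power_left[OF gc(2)] by metis
      then show ?thesis using sub by blast
    qed
  qed
qed

text \<open>In degree 1 every element is a combination of \<open>g - 1\<close>. Each further factor \<open>g - 1\<close> turns the
value of Dynkin's operator into its commutator with \<open>g\<close>, up to higher terms.\<close>

lemma dynkin_operator_image:
  fixes x :: "'a \<Rightarrow>\<^sub>0 'k::field"
  assumes E: "weight_operator n E" and x: "x \<in> Ipow G (Suc m)" and m: "Suc m \<le> n"
  shows "convolve E (comultiplication x) \<in> bracket_part (Suc m)"
  using x m
proof (induction m arbitrary: x)
  case 0
  have "convolve E (comultiplication x) \<in> Ipow G (Suc 0)"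
    using convolve_filtration[OF E _ comultiplication_filtration[OF 0(1)]] 0(2) by simp
  also have "Ipow G (Suc 0) \<subseteq> (bracket_part (Suc 0) :: ('a \<Rightarrow>\<^sub>0 'k) set)"
    unfolding power_1 augmentation_ideal_span[OF one_closed] bracket_part_def
    by (rule pm.span_mono) auto
  finally show ?case .
next
  case (Suc m)
  have W: "pm.subspace (bracket_part (Suc (Suc m)) :: ('a \<Rightarrow>\<^sub>0 'k) set)" by (simp add: bracket_part_def)
  have l: "lmap (\<lambda>x. convolve E (comultiplication x))"
    by (rule lmapI) (simp_all add: convolve_lin comul_lin)
  have "convolve E (comultiplication (y \<star> (pt g - pt \<one>))) \<in> bracket_part (Suc (Suc m))"
    if y: "y \<in> Ipow G (Suc m)" and g: "g \<in> carrier G" for y :: "'a \<Rightarrow>\<^sub>0 'k" and g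
  proof -
    let ?D = "convolve E (comultiplication y)"
    have yc: "y \<in> galg G" using power_galg[OF y] .
    have "augmentation y = 0"
      using y power_antimono[of "Suc 0" "Suc m"] by (auto simp: power_1 augmentation_ideal_iff)
    then have "convolve (\<lambda>x. x) (comultiplication y) = 0"
      using convolve_id_comultiplication[OF yc] by simp
    then have "convolve E (gmul (G \<times>\<times> G) (comultiplication y) (pt (g, g))) - pt (inv g) \<star> (?D \<star> pt g)
        \<in> Ipow G (Suc (Suc (Suc m)))"
      using convolve_step[OF E Suc.prems(2) comultiplication_filtration[OF y] g] by (simp add: gmul_bilinear)
    then have 1: "convolve E (gmul (G \<times>\<times> G) (comultiplication y) (pt (g, g))) - pt (inv g) \<star> (?D \<star> pt g)
        \<in> bracket_part (Suc (Suc m))"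
      unfolding bracket_part_def by (intro pm.span_base) simp
    have 2: "pt (inv g) \<star> (?D \<star> pt g) - ?D \<in> bracket_part (Suc (Suc m))"
      using Suc.IH[OF y] Suc.prems(2) by (intro bracket_part_conj g) auto
    have "convolve E (comultiplication (y \<star> (pt g - pt \<one>)))
        = convolve E (gmul (G \<times>\<times> G) (comultiplication y) (pt (g, g))) - ?D"
      using yc by (simp add: gmul_bilinear gmul_one comul_lin comultiplication_gmul convolve_lin)
    then show ?thesis
      using pm.subspace_add[OF W 1 2] by simp
  qed
  then show ?case
    using Suc.prems(1) power_Suc_lmap_pt[OF l W] by blast
qed

text \<open>On \<open>x\<close> Dynkin's operator takes the value
\<open>S(x) E(1) + E(x)\<close> up to a term of filtration \<open>n + 1\<close>. Here \<open>E(1)\<close> has filtration 1 because 1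
has weight 0, and \<open>E(x)\<close> is \<open>n x\<close> to leading order; so the value is \<open>n x\<close> modulo \<open>I\<^sup>n\<^sup>+\<^sup>1\<close>.\<close>

theorem approx_primitive_in_bracket_part:
  fixes x :: "'a \<Rightarrow>\<^sub>0 'k::field_char_0"
  assumes x: "x \<in> Ipow G n" and n: "1 \<le> n"
    and d: "primitive_defect G x \<in> Tfil G (Suc n)"
  shows "x \<in> bracket_part n"
proof -
  obtain E where E: "weight_operator n (E :: ('a \<Rightarrow>\<^sub>0 'k) \<Rightarrow> _)" using weight_operator_exists by blast
  have lE: "lmap E" using E unfolding weight_operator_def by auto
  have W: "pm.subspace (bracket_part n :: ('a \<Rightarrow>\<^sub>0 'k) set)" by (simp add: bracket_part_def)
  have sub: "Ipow G (Suc n) \<subseteq> (bracket_part n :: ('a \<Rightarrow>\<^sub>0 'k) set)"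
    unfolding bracket_part_def by (auto intro: pm.span_base)
  have xc: "x \<in> galg G" using power_galg[OF x] .
  have "convolve E (comultiplication x) =
    pushforward (m_inv G) x \<star> E (pt \<one>) + pt \<one> \<star> E x + convolve E (primitive_defect G x)"
    by (simp add: primitive_defect_def convolve_lin convolve_tensor[OF lE])
  moreover have "pt \<one> \<star> E x = E x"
    using E by (intro gmul_one) (simp add: weight_operator_def)
  ultimately have eq: "scale (of_nat n) x = convolve E (comultiplication x) - pushforward (m_inv G) x \<star> E (pt \<one>)
      - (E x - scale (of_nat n) x) - convolve E (primitive_defect G x)"
    by simp
  have a: "convolve E (comultiplication x) \<in> bracket_part n"
    using dynkin_operator_image[OF E, of x "n - 1"] x n by simp
  have b: "pushforward (m_inv G) x \<star> E (pt \<one>) \<in> Ipow G (Suc n)"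
  proof -
    have "pt \<one> \<in> (Ipow G 0 :: ('a \<Rightarrow>\<^sub>0 'k) set)" by (simp add: pt_galg)
    then have "E (pt \<one>) \<in> Ipow G (Suc 0)"
      using E unfolding weight_operator_def by fastforce
    from power_mult[OF antipode_power[OF x] this] show ?thesis by simp
  qed
  have c: "E x - scale (of_nat n) x \<in> Ipow G (Suc n)"
    using E x unfolding weight_operator_def by blast
  have e: "convolve E (primitive_defect G x) \<in> Ipow G (Suc n)"
    by (rule convolve_filtration[OF E order_refl d])
  have "scale (of_nat n) x \<in> bracket_part n"
    by (subst eq)
      (rule pm.subspace_diff[OF W pm.subspace_diff[OF W pm.subspace_diff[OF W a subsetD[OF sub b]]
          subsetD[OF sub c]] subsetD[OF sub e]])
  from pm.subspace_scale[OF W this, of "inverse (of_nat n)"] show ?thesis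
    using n by simp
qed

end

section \<open>Logarithms of group elements\<close>

text \<open>By Lagrange interpolation every linear functional on polynomials of degree at most \<open>M\<close> is a
combination of the evaluations at \<open>0, \<dots>, M\<close>. The functional needed here is the derivative
at 0.\<close>

lemma derivative_weights_exist:
  "\<exists>W :: nat \<Rightarrow> 'k::field_char_0. \<forall>p. degree p \<le> M \<longrightarrow> (\<Sum>m\<le>M. W m * poly p (of_nat m)) = coeff p 1"
proof -
  define N :: "nat \<Rightarrow> 'k poly" where "N m = (\<Prod>j\<in>{..M} - {m}. [:- of_nat j, 1:])" for m
  define L where "L m = Polynomial.smult (inverse (poly (N m) (of_nat m))) (N m)" for m
  have N0: "poly (N m) (of_nat i) = 0" if "i \<le> M" "i \<noteq> m" for i m
    unfolding N_def poly_prod using that by (intro prod_zero) auto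
  have N1: "poly (N m) (of_nat m) \<noteq> 0" for m
    unfolding N_def poly_prod by (auto simp: prod_zero_iff)
  have L: "poly (L m) (of_nat i) = (if i = m then 1 else 0)" if "i \<le> M" for i m
    using N0[OF that] N1[of m] by (simp add: L_def)
  have degL: "degree (L m) \<le> M" if "m \<le> M" for m
  proof -
    have "degree (N m) \<le> (\<Sum>j\<in>{..M} - {m}. degree [:- of_nat j, 1 :: 'k:])"
      unfolding N_def by (rule order_trans[OF degree_prod_sum_le]) (simp_all add: o_def)
    also have "\<dots> = M" using that by simp
    finally show ?thesis unfolding L_def using degree_smult_le[of _ "N m"] order_trans by blast
  qed
  have "(\<Sum>m\<le>M. coeff (L m) 1 * poly p (of_nat m)) = coeff p 1" if p: "degree p \<le> M" for p
  proof -
    define q where "q = p - (\<Sum>m\<le>M. Polynomial.smult (poly p (of_nat m)) (L m))"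
    have "degree q \<le> M"
      unfolding q_def using p degL degree_smult_le order_trans
      by (intro degree_diff_le degree_sum_le) blast+
    moreover have "poly q (of_nat i) = 0" if "i \<le> M" for i
    proof -
      have "(\<Sum>m\<le>M. poly p (of_nat m) * poly (L m) (of_nat i)) = (\<Sum>m\<le>M. if m = i then poly p (of_nat i) else 0)"
        by (rule sum.cong) (auto simp: L that)
      then show ?thesis using that by (simp add: q_def poly_sum)
    qed
    ultimately have "q = 0"
    proof (intro poly_eqI_degree[of "(of_nat :: nat \<Rightarrow> 'k) ` {..M}"])
      show "degree q < card ((of_nat :: nat \<Rightarrow> 'k) ` {..M})" "degree 0 < card ((of_nat :: nat \<Rightarrow> 'k) ` {..M})"
        using \<open>degree q \<le> M\<close> by (simp_all add: card_image inj_on_def)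
    qed auto
    then have "p = (\<Sum>m\<le>M. Polynomial.smult (poly p (of_nat m)) (L m))" by (simp add: q_def)
    from arg_cong[OF this, of "\<lambda>p. coeff p 1"] show ?thesis
      by (simp add: coeff_sum mult.commute)
  qed
  then show ?thesis by (intro exI[of _ "\<lambda>m. coeff (L m) 1"]) auto
qed

definition binomial_poly :: "nat \<Rightarrow> 'k::field_char_0 poly" where
  "binomial_poly j = Polynomial.smult (inverse (fact j)) (\<Prod>i=0..<j. [:- of_nat i, 1:])"

lemma poly_binomial_poly: "poly (binomial_poly j) (of_nat m) = of_nat (m choose j)"
  by (simp add: binomial_poly_def poly_prod binomial_gbinomial gbinomial_prod_rev field_simps)

lemma degree_binomial_poly: "degree (binomial_poly j) \<le> j"
proof -
  have "degree (\<Prod>i=0..<j. [:- of_nat i, 1 :: 'a:]) \<le> (\<Sum>i=0..<j. degree [:- of_nat i, 1 :: 'a:])"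
    by (rule order_trans[OF degree_prod_sum_le]) (simp_all add: o_def)
  then show ?thesis unfolding binomial_poly_def using degree_smult_le order_trans by fastforce
qed

text \<open>These are the coefficients of the power series of \<open>ln (1 + x)\<close>, written as derivatives at 0 of
the binomial polynomials: \<open>log g\<close> is the derivative at \<open>m = 0\<close> of
\<open>g\<^sup>m = (\<Sum>j. (m choose j) (g - 1)\<^sup>j)\<close>.\<close>

definition log_coeff :: "nat \<Rightarrow> 'k::field_char_0" where
  "log_coeff j = coeff (binomial_poly j) 1"

lemma log_coeff_0 [simp]: "log_coeff 0 = 0"
  by (simp add: log_coeff_def binomial_poly_def)

lemma log_coeff_1 [simp]: "log_coeff (Suc 0) = 1"
  by (simp add: log_coeff_def binomial_poly_def)

text \<open>Both factors vanish at 0, so the product has a double zero there.\<close>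

lemma coeff_binomial_poly_mult:
  assumes "1 \<le> i" "1 \<le> j"
  shows "coeff (binomial_poly i * binomial_poly j :: 'k::field_char_0 poly) 1 = 0"
proof -
  have "coeff (binomial_poly j :: 'k poly) 0 = 0" if "1 \<le> j" for j
    using poly_binomial_poly[of j 0, where 'a='k] that by (simp add: poly_0_coeff_0 binomial_eq_0)
  then show ?thesis using assms by (simp add: coeff_mult)
qed

context group
begin

primrec diff_pow :: "'a \<Rightarrow> nat \<Rightarrow> ('a \<Rightarrow>\<^sub>0 'k::field)" where
  "diff_pow g 0 = pt \<one>"
| "diff_pow g (Suc j) = diff_pow g j \<star> (pt g - pt \<one>)"

lemma diff_pow_power:
  assumes "pt g - pt \<one> \<in> (Ipow G r :: ('a \<Rightarrow>\<^sub>0 'k::field) set)"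
  shows "diff_pow g j \<in> (Ipow G (j * r) :: ('a \<Rightarrow>\<^sub>0 'k) set)"
proof (induction j)
  case 0
  show ?case by (simp add: pt_galg)
next
  case (Suc j)
  from power_mult[OF Suc assms] show ?case by (simp add: add.commute)
qed

lemma diff_pow_in_power:
  assumes "g \<in> carrier G"
  shows "diff_pow g j \<in> Ipow G j"
  using diff_pow_power[OF pt_diff_power_1[OF assms]] by simp

lemma pt_pow_expansion:
  assumes g: "g \<in> carrier G" and "m \<le> M"
  shows "pt (g [^] m) = (\<Sum>j\<le>M. scale (of_nat (m choose j)) (diff_pow g j :: 'a \<Rightarrow>\<^sub>0 'k::field))"
  using \<open>m \<le> M\<close>
proof (induction m)
  case 0
  have "(\<Sum>j\<le>M. scale (of_nat (0 choose j)) (diff_pow g j :: 'a \<Rightarrow>\<^sub>0 'k)) = (\<Sum>j\<in>{0}. diff_pow g j)"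
    by (intro sum.mono_neutral_cong_right) (auto simp: binomial_eq_0)
  then show ?case by simp
next
  case (Suc m)
  let ?d = "diff_pow g :: nat \<Rightarrow> 'a \<Rightarrow>\<^sub>0 'k"
  obtain M' where M: "M = Suc M'" using Suc.prems by (cases M) auto
  have IH: "pt (g [^] m) = (\<Sum>j\<le>M. scale (of_nat (m choose j)) (?d j))"
    using Suc by simp
  have "pt (g [^] Suc m) = pt (g [^] m) \<star> (pt g - pt \<one> :: 'a \<Rightarrow>\<^sub>0 'k) + pt (g [^] m)"
    using g by (simp add: gmul_bilinear)
  also have "\<dots> = (\<Sum>j\<le>M. scale (of_nat (m choose j)) (?d (Suc j))) + (\<Sum>j\<le>M. scale (of_nat (m choose j)) (?d j))"
    by (subst (1 2) IH) (simp only: gmul_bilinear(7,11) diff_pow.simps)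
  also have "(\<Sum>j\<le>M. scale (of_nat (m choose j)) (?d (Suc j))) = (\<Sum>j\<le>M'. scale (of_nat (m choose j)) (?d (Suc j)))"
    using Suc.prems M by (simp add: binomial_eq_0 del: diff_pow.simps)
  also have "(\<Sum>j\<le>M. scale (of_nat (m choose j)) (?d j)) = ?d 0 + (\<Sum>j\<le>M'. scale (of_nat (m choose Suc j)) (?d (Suc j)))"
    unfolding M by (simp add: sum.atMost_Suc_shift del: diff_pow.simps sum.atMost_Suc)
  also have "(\<Sum>j\<le>M'. scale (of_nat (m choose j)) (?d (Suc j))) + (?d 0 + (\<Sum>j\<le>M'. scale (of_nat (m choose Suc j)) (?d (Suc j))))
      = ?d 0 + (\<Sum>j\<le>M'. scale (of_nat (Suc m choose Suc j)) (?d (Suc j)))"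
    by (simp add: sum.distrib pm.scale_left_distrib del: diff_pow.simps)
  also have "\<dots> = (\<Sum>j\<le>M. scale (of_nat (Suc m choose j)) (?d j))"
    unfolding M by (simp add: sum.atMost_Suc_shift del: diff_pow.simps sum.atMost_Suc binomial_Suc_Suc)
  finally show ?case .
qed

definition log_trunc :: "nat \<Rightarrow> 'a \<Rightarrow> ('a \<Rightarrow>\<^sub>0 'k::field_char_0)" where
  "log_trunc n g = (\<Sum>j<n. scale (log_coeff j) (diff_pow g j))"

lemma log_trunc_galg:
  assumes "g \<in> carrier G"
  shows "log_trunc n g \<in> galg G"
  unfolding log_trunc_def
  using power_galg[OF diff_pow_in_power[OF assms]]
  by (intro pm.subspace_sum[OF subspace_galg] pm.subspace_scale[OF subspace_galg])

lemma log_trunc_Suc: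
  assumes "g \<in> carrier G"
  shows "log_trunc (Suc n) g - log_trunc n g \<in> Ipow G n"
  by (simp add: log_trunc_def pm.subspace_scale[OF subspace_power] diff_pow_in_power[OF assms])

lemma primitive_defect_filtration:
  assumes "a \<in> Ipow G n"
  shows "primitive_defect G a \<in> Tfil G n"
proof -
  have "tensor a (pt \<one>) \<in> Tfil G (n + 0)" "tensor (pt \<one>) a \<in> Tfil G (0 + n)"
    using assms by (intro Tfil_base; simp add: pt_galg)+
  then show ?thesis
    unfolding primitive_defect_def using assms
    by (intro pm.subspace_diff[OF subspace_Tfil] comultiplication_filtration) simp_all
qed

text \<open>Up to terms in \<open>I\<^sup>n\<close> the truncated logarithm is \<open>\<Sum>m. W m g\<^sup>m\<close>, where the weights \<open>W\<close> compute
derivatives at 0. Since \<open>g\<^sup>m\<close> is group-like and the weights add up to 0, the defect of this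
combination is \<open>\<Sum>m. W m (g\<^sup>m - 1) \<otimes> (g\<^sup>m - 1)\<close>. In its expansion the coefficient of
\<open>(g - 1)\<^sup>i \<otimes> (g - 1)\<^sup>j\<close> is the derivative at 0 of a product of two binomial polynomials that vanish
there, as long as \<open>i + j \<le> n\<close>; the other terms lie in the term \<open>n\<close> of the filtration.\<close>

lemma primitive_defect_log_trunc:
  assumes g: "g \<in> carrier G"
  shows "primitive_defect G (log_trunc n g :: 'a \<Rightarrow>\<^sub>0 'k::field_char_0) \<in> Tfil G n"
proof -
  obtain W :: "nat \<Rightarrow> 'k" where W: "\<And>p. degree p \<le> n \<Longrightarrow> (\<Sum>m\<le>n. W m * poly p (of_nat m)) = coeff p 1"
    using derivative_weights_exist[of n] by blast
  let ?d = "diff_pow g :: nat \<Rightarrow> 'a \<Rightarrow>\<^sub>0 'k"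
  define x where "x = (\<Sum>m\<le>n. scale (W m) (pt (g [^] m)))"
  have Wlog: "(\<Sum>m\<le>n. W m * of_nat (m choose j)) = log_coeff j" if "j \<le> n" for j
    using W[of "binomial_poly j"] degree_binomial_poly[of j, where 'a='k] that
    by (simp add: poly_binomial_poly log_coeff_def)
  have "x = (\<Sum>m\<le>n. \<Sum>j\<le>n. scale (W m * of_nat (m choose j)) (?d j))"
    unfolding x_def
    by (intro sum.cong refl) (simp add: pt_pow_expansion[OF g, of _ n] pm.scale_sum_right)
  also have "\<dots> = (\<Sum>j\<le>n. \<Sum>m\<le>n. scale (W m * of_nat (m choose j)) (?d j))"
    by (rule sum.swap)
  also have "\<dots> = (\<Sum>j\<le>n. scale (log_coeff j) (?d j))"
    by (intro sum.cong refl) (simp add: pm.scale_sum_left[symmetric] Wlog)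
  finally have x: "x = (\<Sum>j\<le>n. scale (log_coeff j) (?d j))" .
  have "x = log_trunc n g + scale (log_coeff n) (?d n)"
    unfolding x log_trunc_def by (simp flip: lessThan_Suc_atMost)
  moreover have "scale (log_coeff n) (?d n) \<in> Ipow G n"
    by (intro pm.subspace_scale[OF subspace_power] diff_pow_in_power[OF g])
  ultimately have 1: "log_trunc n g - x \<in> Ipow G n"
    using pm.subspace_neg[OF subspace_power] by auto
  let ?c = "\<lambda>i j. \<Sum>m\<le>n. W m * (of_nat (m choose i) * of_nat (m choose j))"
  have "primitive_defect G x \<in> Tfil G n"
  proof -
    have u: "pt (g [^] m) - pt \<one> = (\<Sum>j\<in>{1..n}. scale (of_nat (m choose j)) (?d j))" if "m \<le> n" for m
    proof -
      have "{..n} = insert 0 {1..n}" by auto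
      then show ?thesis using pt_pow_expansion[OF g that, where 'k='k] by simp
    qed
    have "primitive_defect G x =
        (\<Sum>m\<le>n. scale (W m) (tensor (pt (g [^] m) - pt \<one>) (pt (g [^] m) - pt \<one>))) - scale (\<Sum>m\<le>n. W m) (pt (\<one>, \<one>))"
      unfolding x_def
      by (simp add: primitive_defect_lin primitive_defect_def[of G "pt _"] tensor_bilinear pm.scale_right_diff_distrib
          pm.scale_sum_left sum_subtractf)
    also have "(\<Sum>m\<le>n. W m) = 0" using W[of 1] by simp
    also have "(\<Sum>m\<le>n. scale (W m) (tensor (pt (g [^] m) - pt \<one>) (pt (g [^] m) - pt \<one>)))
        = (\<Sum>m\<le>n. \<Sum>i\<in>{1..n}. \<Sum>j\<in>{1..n}. scale (W m * (of_nat (m choose i) * of_nat (m choose j))) (tensor (?d i) (?d j)))"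
      by (intro sum.cong refl, simp only: u atMost_iff, subst tensor_bilinear(11))
        (simp add: tensor_bilinear(7,8,12) pm.scale_sum_right mult_ac)
    also have "\<dots> = (\<Sum>i\<in>{1..n}. \<Sum>j\<in>{1..n}. scale (?c i j) (tensor (?d i) (?d j)))"
      by (subst sum.swap, rule sum.cong[OF refl], subst sum.swap) (simp add: pm.scale_sum_left)
    finally have "primitive_defect G x = (\<Sum>i\<in>{1..n}. \<Sum>j\<in>{1..n}. scale (?c i j) (tensor (?d i) (?d j)))"
      by simp
    also have "\<dots> \<in> Tfil G n"
    proof (intro pm.subspace_sum[OF subspace_Tfil])
      fix i j assume i: "i \<in> {1..n}" and j: "j \<in> {1..n}"
      show "scale (?c i j) (tensor (?d i) (?d j)) \<in> Tfil G n"
      proof (cases "i + j \<le> n")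
        case True
        have "degree (binomial_poly i * binomial_poly j :: 'k poly) \<le> n"
          using degree_mult_le[of "binomial_poly i" "binomial_poly j :: 'k poly"] True
            degree_binomial_poly[of i, where 'a='k] degree_binomial_poly[of j, where 'a='k] by linarith
        then have "?c i j = 0"
          using W[of "binomial_poly i * binomial_poly j"] coeff_binomial_poly_mult[of i j, where 'k='k] i j
          by (simp add: poly_binomial_poly)
        then show ?thesis by (simp add: pm.subspace_0[OF subspace_Tfil])
      next
        case False
        then have "tensor (?d i) (?d j) \<in> Tfil G n"
          using Tfil_base[OF diff_pow_in_power[OF g] diff_pow_in_power[OF g]] Tfil_antimono[of n "i + j"]
          by auto
        then show ?thesis by (rule pm.subspace_scale[OF subspace_Tfil])
      qed
    qed
    finally show ?thesis .
  qed
  moreover have "primitive_defect G (log_trunc n g) - primitive_defect G x \<in> Tfil G n"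
    using primitive_defect_filtration[OF 1] by (simp add: primitive_defect_lin)
  ultimately show ?thesis
    using subspace_diff_cancel[OF subspace_Tfil] by blast
qed

text \<open>The powers \<open>(g - 1)\<^sup>j\<close> with \<open>j \<ge> 2\<close> lie in \<open>I\<^sup>2\<^sup>r\<close>, hence in \<open>I\<^sup>r\<^sup>+\<^sup>1\<close>.\<close>

lemma log_trunc_leading_term:
  assumes g: "pt g - pt \<one> \<in> (Ipow G r :: ('a \<Rightarrow>\<^sub>0 'k::field_char_0) set)" and gc: "g \<in> carrier G" and r: "1 \<le> r"
  shows "log_trunc (Suc r) g - (pt g - pt \<one>) \<in> (Ipow G (Suc r) :: ('a \<Rightarrow>\<^sub>0 'k) set)"
proof -
  let ?d = "diff_pow g :: nat \<Rightarrow> 'a \<Rightarrow>\<^sub>0 'k"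
  have "{..<Suc r} = {0, 1} \<union> {2..r}" using r by auto
  then have "log_trunc (Suc r) g = ?d 1 + (\<Sum>j\<in>{2..r}. scale (log_coeff j) (?d j))"
    by (simp add: log_trunc_def)
  moreover have "?d 1 = pt g - pt \<one>"
    using gc by (simp add: gmul_bilinear)
  moreover have "(\<Sum>j\<in>{2..r}. scale (log_coeff j) (?d j)) \<in> Ipow G (Suc r)"
  proof (intro pm.subspace_sum[OF subspace_power] pm.subspace_scale[OF subspace_power])
    fix j assume "j \<in> {2..r}"
    then have "2 * r \<le> j * r" by simp
    then have "Suc r \<le> j * r" using r by linarith
    then show "?d j \<in> Ipow G (Suc r)"
      using diff_pow_power[OF g, of j] power_antimono by blast
  qed
  ultimately show ?thesis by simp
qed

end

context group_hom
begin

lemma pushforward_diff_pow: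
  assumes g: "g \<in> carrier G"
  shows "pushforward h (G.diff_pow g j :: 'a \<Rightarrow>\<^sub>0 'k::field) = H.diff_pow (h g) j"
proof (induction j)
  case (Suc j)
  have "G.diff_pow g j \<in> (galg G :: ('a \<Rightarrow>\<^sub>0 'k) set)" "pt g - pt \<one> \<in> (galg G :: ('a \<Rightarrow>\<^sub>0 'k) set)"
    using G.power_galg[OF G.diff_pow_in_power[OF g]] g
    by (auto intro!: pm.subspace_diff[OF subspace_galg] pt_galg)
  then show ?case using Suc by (simp add: pushforward_gmul pushforward_lin)
qed simp

lemma pushforward_log_trunc:
  assumes g: "g \<in> carrier G"
  shows "pushforward h (G.log_trunc n g) = H.log_trunc n (h g)"
  by (simp add: G.log_trunc_def H.log_trunc_def pushforward_lin pushforward_diff_pow[OF g])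

end

section \<open>Completions described by representatives\<close>

text \<open>Addition in the group algebra is that of the type of finitely supported functions, so cosets
can be handled without reference to the group.\<close>

definition coset :: "('g \<Rightarrow>\<^sub>0 'k::field) set \<Rightarrow> ('g \<Rightarrow>\<^sub>0 'k) \<Rightarrow> ('g \<Rightarrow>\<^sub>0 'k) set" where
  "coset J a = {x. x - a \<in> J}"

lemma a_r_coset_galg: "J +>\<^bsub>group_algebra K\<^esub> a = coset J a"
proof -
  have "x - a \<in> J \<Longrightarrow> \<exists>h\<in>J. x = h + a" for x by (rule bexI[of _ "x - a"]) auto
  then show ?thesis by (auto simp: a_r_coset_def' coset_def)
qed

lemma coset_eq_iff:
  assumes "pm.subspace J"
  shows "coset J a = coset J b \<longleftrightarrow> a - b \<in> J"
proof
  assume "coset J a = coset J b"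
  moreover have "a \<in> coset J a" by (simp add: coset_def pm.subspace_0[OF assms])
  ultimately show "a - b \<in> J" by (simp add: coset_def)
next
  assume ab: "a - b \<in> J"
  have "x - a \<in> J \<longleftrightarrow> x - b \<in> J" for x
    using subspace_diff_cancel[OF assms, of "x - b" "x - a"] ab by simp
  then show "coset J a = coset J b" by (auto simp: coset_def)
qed

lemma coset_self: "pm.subspace J \<Longrightarrow> a \<in> coset J a"
  by (simp add: coset_def pm.subspace_0)

lemma coset_subset_iff:
  assumes "pm.subspace J" "pm.subspace L" "J \<subseteq> L"
  shows "coset J a \<subseteq> coset L b \<longleftrightarrow> a - b \<in> L"
proof
  assume "coset J a \<subseteq> coset L b"
  with coset_self[OF assms(1), of a] have "a \<in> coset L b" by blast
  then show "a - b \<in> L" by (simp add: coset_def)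
next
  assume ab: "a - b \<in> L"
  show "coset J a \<subseteq> coset L b"
  proof
    fix x assume "x \<in> coset J a"
    then have "x - a \<in> L" using assms(3) by (auto simp: coset_def)
    from pm.subspace_add[OF assms(2) this ab] show "x \<in> coset L b" by (simp add: coset_def)
  qed
qed

lemma coset_0: "coset J 0 = J"
  by (simp add: coset_def)

lemma set_add_coset:
  assumes "pm.subspace J"
  shows "coset J a <+>\<^bsub>group_algebra K\<^esub> coset J b = coset J (a + b)"
proof -
  have "x + y - (a + b) \<in> J" if "x - a \<in> J" "y - b \<in> J" for x y
    using pm.subspace_add[OF assms that] by (simp add: algebra_simps)
  moreover have "\<exists>u v. u - a \<in> J \<and> v - b \<in> J \<and> x = u + v" if "x - (a + b) \<in> J" for x
    using that pm.subspace_0[OF assms] by (intro exI[of _ "x - b"] exI[of _ b]) (simp add: algebra_simps)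
  ultimately show ?thesis by (fastforce simp: set_add_def' coset_def)
qed

lemma rcoset_mult_coset:
  assumes J: "galg_ideal K J" and a: "a \<in> galg K" and b: "b \<in> galg K"
  shows "rcoset_mult (group_algebra K) J (coset J a) (coset J b) = coset J (gmul K a b)"
proof -
  note Js = galg_idealD(1)[OF J]
  have "coset J (gmul K x y) = coset J (gmul K a b)" if "x \<in> coset J a" "y \<in> coset J b" for x y
  proof -
    have x: "x - a \<in> J" and y: "y - b \<in> J" using that by (auto simp: coset_def)
    have "x = a + (x - a)" by simp
    then have "x \<in> galg K"
      using galg_idealD(3)[OF J x] a pm.subspace_add[OF subspace_galg] by metis
    have "gmul K x y - gmul K a b = gmul K x (y - b) + gmul K (x - a) b"
      by (simp add: gmul_bilinear)
    also have "\<dots> \<in> J"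
      using galg_idealD(4)[OF J \<open>x \<in> galg K\<close> y] galg_idealD(5)[OF J b x] by (rule pm.subspace_add[OF Js])
    finally show ?thesis by (simp add: coset_eq_iff[OF Js])
  qed
  then show ?thesis
    using coset_self[OF Js] unfolding rcoset_mult_def a_r_coset_galg by blast
qed

text \<open>The point of a completion that is represented by a sequence in the algebra; it lies in the
completion when the sequence is coherent in the sense below.\<close>

definition cls :: "(nat \<Rightarrow> ('g \<Rightarrow>\<^sub>0 'k::field) set) \<Rightarrow> (nat \<Rightarrow> ('g \<Rightarrow>\<^sub>0 'k)) \<Rightarrow> nat \<Rightarrow> ('g \<Rightarrow>\<^sub>0 'k) set" where
  "cls J a = (\<lambda>n. coset (J n) (a n))"

text \<open>On points given by representatives, the union of cosets in the definition of an induced map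
collapses to a single coset, provided that \<open>f\<close> respects the filtrations.\<close>

lemma induced_cls:
  assumes J: "\<And>n. pm.subspace (J n)" and L: "\<And>n. pm.subspace (L n)"
    and f: "\<And>n x. x - a n \<in> J n \<Longrightarrow> f x - f (a n) \<in> L n"
  shows "induced (group_algebra K) L f (cls J a) = cls L (\<lambda>n. f (a n))"
proof
  fix n
  have "coset (L n) (f x) = coset (L n) (f (a n))" if "x \<in> coset (J n) (a n)" for x
    using f[of x n] that by (simp add: coset_eq_iff[OF L]) (simp add: coset_def)
  then show "induced (group_algebra K) L f (cls J a) n = cls L (\<lambda>n. f (a n)) n"
    using coset_self[OF J] unfolding induced_def a_r_coset_galg cls_def by blast
qed

lemma induced2_cls:
  assumes J: "\<And>n. pm.subspace (J n)" and J': "\<And>n. pm.subspace (J' n)" and L: "\<And>n. pm.subspace (L n)"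
    and f: "\<And>n x y. x - a n \<in> J n \<Longrightarrow> y - b n \<in> J' n \<Longrightarrow> f x y - f (a n) (b n) \<in> L n"
  shows "induced2 (group_algebra K) L f (cls J a) (cls J' b) = cls L (\<lambda>n. f (a n) (b n))"
proof
  fix n
  have "coset (L n) (f x y) = coset (L n) (f (a n) (b n))" if "x \<in> coset (J n) (a n)" "y \<in> coset (J' n) (b n)" for x y
    using f[of x n y] that by (simp add: coset_eq_iff[OF L]) (simp add: coset_def)
  then show "induced2 (group_algebra K) L f (cls J a) (cls J' b) n = cls L (\<lambda>n. f (a n) (b n)) n"
    using coset_self[OF J, of "a n" n] coset_self[OF J', of "b n" n]
    unfolding induced2_def a_r_coset_galg cls_def by blast
qed

locale filtered_group_algebra = group K for K (structure) +
  fixes J :: "nat \<Rightarrow> ('a \<Rightarrow>\<^sub>0 'k::field) set"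
  assumes ideal_J: "galg_ideal K (J n)"
    and J_Suc: "J (Suc n) \<subseteq> J n"
begin

lemma subspace_J: "pm.subspace (J n)"
  by (rule galg_idealD(1)[OF ideal_J])

lemma J_antimono: "m \<le> n \<Longrightarrow> J n \<subseteq> J m"
  by (rule lift_Suc_antimono_le[of J]) (use J_Suc in auto)

abbreviation C :: "('k, nat \<Rightarrow> ('a \<Rightarrow>\<^sub>0 'k) set) module" where
  "C \<equiv> completion (group_algebra K) J"

definition coherent :: "(nat \<Rightarrow> ('a \<Rightarrow>\<^sub>0 'k)) \<Rightarrow> bool" where
  "coherent a \<longleftrightarrow> (\<forall>n. a n \<in> galg K \<and> a (Suc n) - a n \<in> J n)"

lemma cls_eq_iff: "cls J a = cls J b \<longleftrightarrow> (\<forall>n. a n - b n \<in> J n)"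
  by (simp add: cls_def fun_eq_iff coset_eq_iff[OF subspace_J])

lemma coherentD: "coherent a \<Longrightarrow> a n \<in> galg K"
  by (simp add: coherent_def)

lemma coherent_diff:
  assumes "coherent a" "m \<le> n"
  shows "a n - a m \<in> J m"
  using \<open>m \<le> n\<close>
proof (induction n rule: dec_induct)
  case base
  show ?case by (simp add: pm.subspace_0[OF subspace_J])
next
  case (step n)
  have "a (Suc n) - a n \<in> J m"
    using assms(1) J_antimono[OF step(1)] by (auto simp: coherent_def)
  from pm.subspace_add[OF subspace_J this step.IH] show ?case by simp
qed

lemma coherent_add: "coherent a \<Longrightarrow> coherent b \<Longrightarrow> coherent (\<lambda>n. a n + b n)"
  using pm.subspace_add[OF subspace_J]
  by (fastforce simp: coherent_def algebra_simps intro: pm.subspace_add[OF subspace_galg])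

lemma coherent_scale: "coherent a \<Longrightarrow> coherent (\<lambda>n. scale c (a n))"
  using pm.subspace_scale[OF subspace_J]
  by (auto simp: coherent_def pm.subspace_scale[OF subspace_galg] simp flip: pm.scale_right_diff_distrib)

lemma coherent_neg: "coherent a \<Longrightarrow> coherent (\<lambda>n. - a n)"
  using coherent_scale[of a "-1"] by (simp add: pm.scale_minus_left)

lemma coherent_diff_seq: "coherent a \<Longrightarrow> coherent b \<Longrightarrow> coherent (\<lambda>n. a n - b n)"
  using coherent_add[OF _ coherent_neg, of a b] by simp

lemma coherent_const: "x \<in> galg K \<Longrightarrow> coherent (\<lambda>n. x)"
  by (simp add: coherent_def pm.subspace_0[OF subspace_J])

lemma coherent_mult:
  assumes "coherent a" "coherent b"
  shows "coherent (\<lambda>n. gmul K (a n) (b n))"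
  unfolding coherent_def
proof (intro allI conjI)
  fix n
  show "gmul K (a n) (b n) \<in> galg K" using assms by (simp add: coherentD gmul_galg)
  have "gmul K (a (Suc n)) (b (Suc n)) - gmul K (a n) (b n)
      = gmul K (a (Suc n)) (b (Suc n) - b n) + gmul K (a (Suc n) - a n) (b n)"
    by (simp add: gmul_bilinear)
  also have "\<dots> \<in> J n"
    using assms
    by (intro pm.subspace_add[OF subspace_J] galg_idealD(4,5)[OF ideal_J]) (auto simp: coherent_def)
  finally show "gmul K (a (Suc n)) (b (Suc n)) - gmul K (a n) (b n) \<in> J n" .
qed

lemma carrier_C: "carrier C = {cls J a | a. coherent a}"
proof (intro equalityI subsetI)
  fix x assume "x \<in> carrier C"
  then have x: "\<And>n. x n \<in> a_rcosets\<^bsub>group_algebra K\<^esub> (J n)" "\<And>n. x (Suc n) \<subseteq> x n"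
    by (auto simp: completion_def FactRing_def)
  have "\<forall>n. \<exists>a. a \<in> galg K \<and> x n = coset (J n) a"
    using x(1) by (auto simp: A_RCOSETS_def' a_r_coset_galg)
  then obtain a where a: "\<And>n. a n \<in> galg K" "\<And>n. x n = coset (J n) (a n)"
    by metis
  have "coherent a"
    using x(2) unfolding coherent_def a(2) by (simp add: a(1) coset_subset_iff[OF subspace_J subspace_J J_Suc])
  moreover have "x = cls J a" using a(2) by (auto simp: cls_def)
  ultimately show "x \<in> {cls J a | a. coherent a}" by blast
next
  fix x assume "x \<in> {cls J a | a. coherent a}"
  then obtain a where "x = cls J a" "coherent a" by blast
  then show "x \<in> carrier C"
    by (auto simp: completion_def FactRing_def A_RCOSETS_def' a_r_coset_galg cls_def coherent_def
        coset_subset_iff[OF subspace_J subspace_J J_Suc])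
qed

lemma add_C: "cls J a \<oplus>\<^bsub>C\<^esub> cls J b = cls J (\<lambda>n. a n + b n)"
  by (simp add: completion_def FactRing_def cls_def set_add_coset[OF subspace_J])

lemma zero_C: "\<zero>\<^bsub>C\<^esub> = cls J (\<lambda>n. 0)"
  by (simp add: completion_def FactRing_def cls_def coset_0)

lemma one_C: "\<one>\<^bsub>C\<^esub> = cls J (\<lambda>n. pt \<one>)"
  by (simp add: completion_def FactRing_def cls_def a_r_coset_galg)

lemma smult_C: "c \<odot>\<^bsub>C\<^esub> cls J a = cls J (\<lambda>n. scale c (a n))"
  using induced_cls[of J J a "scale c" K] pm.subspace_scale[OF subspace_J]
  by (simp add: completion_def subspace_J flip: pm.scale_right_diff_distrib)

lemma mult_C:
  assumes "coherent a" "coherent b"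
  shows "cls J a \<otimes>\<^bsub>C\<^esub> cls J b = cls J (\<lambda>n. gmul K (a n) (b n))"
  using assms
  by (simp add: completion_def FactRing_def cls_def rcoset_mult_coset[OF ideal_J] coherentD)

lemma abelian_group_C: "abelian_group C"
proof (rule abelian_groupI; unfold carrier_C)
  fix x assume "x \<in> {cls J a | a. coherent a}"
  then obtain a where a: "x = cls J a" "coherent a" by blast
  have "cls J (\<lambda>n. - a n) \<oplus>\<^bsub>C\<^esub> x = \<zero>\<^bsub>C\<^esub>" by (simp add: a add_C zero_C)
  then show "\<exists>y\<in>{cls J a | a. coherent a}. y \<oplus>\<^bsub>C\<^esub> x = \<zero>\<^bsub>C\<^esub>" using coherent_neg[OF a(2)] by blast
next
  show "\<zero>\<^bsub>C\<^esub> \<in> {cls J a | a. coherent a}"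
    unfolding zero_C using coherent_const[OF pm.subspace_0[OF subspace_galg]] by blast
next
  fix x y assume "x \<in> {cls J a | a. coherent a}" "y \<in> {cls J a | a. coherent a}"
  then show "x \<oplus>\<^bsub>C\<^esub> y \<in> {cls J a | a. coherent a}" "x \<oplus>\<^bsub>C\<^esub> y = y \<oplus>\<^bsub>C\<^esub> x"
    using coherent_add by (auto simp: add_C add.commute)
qed (auto simp: add_C zero_C add.assoc)

lemma minus_C:
  assumes "coherent a" "coherent b"
  shows "cls J a \<ominus>\<^bsub>C\<^esub> cls J b = cls J (\<lambda>n. a n - b n)"
proof -
  have "\<ominus>\<^bsub>C\<^esub> cls J b = cls J (\<lambda>n. - b n)"
    using assms(2) coherent_neg[OF assms(2)]
    by (intro abelian_group.minus_equality[OF abelian_group_C]) (auto simp: add_C zero_C carrier_C)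
  then show ?thesis by (simp add: a_minus_def add_C)
qed

end

section \<open>The Malcev Lie algebra in terms of representatives\<close>

context group
begin

lemma filtered_power: "filtered_group_algebra G (Ipow G)"
  by unfold_locales (rule galg_ideal_power, rule power_Suc_subset)

abbreviation alg_coherent :: "(nat \<Rightarrow> ('a \<Rightarrow>\<^sub>0 'k::field)) \<Rightarrow> bool" where
  "alg_coherent \<equiv> filtered_group_algebra.coherent G (Ipow G)"

abbreviation alg_cls :: "(nat \<Rightarrow> ('a \<Rightarrow>\<^sub>0 'k::field)) \<Rightarrow> nat \<Rightarrow> ('a \<Rightarrow>\<^sub>0 'k) set" where
  "alg_cls \<equiv> cls (Ipow G)"

definition lie_rep :: "(nat \<Rightarrow> ('a \<Rightarrow>\<^sub>0 'k::field)) \<Rightarrow> bool" where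
  "lie_rep a \<longleftrightarrow> alg_coherent a \<and> (\<forall>n. primitive_defect G (a n) \<in> Tfil G n)"

lemma primitive_elements_rep:
  "primitive_elements G = {alg_cls a | a :: nat \<Rightarrow> ('a \<Rightarrow>\<^sub>0 'k::field). lie_rep a}"
proof -
  interpret A: filtered_group_algebra G "Ipow G :: nat \<Rightarrow> ('a \<Rightarrow>\<^sub>0 'k) set"
    by (rule filtered_power)
  let ?F = "Tfil G :: nat \<Rightarrow> ('a \<times> 'a \<Rightarrow>\<^sub>0 'k) set"
  have "completed_comultiplication G (alg_cls a) =
      completed_tensor G (alg_cls a) \<one>\<^bsub>A.C\<^esub> \<oplus>\<^bsub>completed_tensor_square G\<^esub> completed_tensor G \<one>\<^bsub>A.C\<^esub> (alg_cls a)
      \<longleftrightarrow> (\<forall>n. primitive_defect G (a n) \<in> ?F n)" if a: "alg_coherent a" for a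
  proof -
    have ac: "a n \<in> Ipow G 0" for n using A.coherentD[OF a] by simp
    have 1: "completed_comultiplication G (alg_cls a) = cls ?F (\<lambda>n. comultiplication (a n))"
      unfolding tensor_square_def
      by (rule induced_cls[OF subspace_power subspace_Tfil])
        (simp flip: comul_lin add: comultiplication_filtration)
    have one: "pt \<one> \<in> (Ipow G 0 :: ('a \<Rightarrow>\<^sub>0 'k) set)" by (simp add: pt_galg)
    have 2: "completed_tensor G (alg_cls a) \<one>\<^bsub>A.C\<^esub> = cls ?F (\<lambda>n. tensor (a n) (pt \<one>))"
      unfolding tensor_square_def A.one_C
    proof (rule induced2_cls[OF subspace_power subspace_power subspace_Tfil])
      fix n and x y :: "'a \<Rightarrow>\<^sub>0 'k" assume x: "x - a n \<in> Ipow G n" and y: "y - pt \<one> \<in> Ipow G n"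
      have "y - pt \<one> \<in> Ipow G 0" using y power_antimono[of 0 n] by blast
      then have "y \<in> Ipow G 0" using subspace_diff_cancel[OF subspace_power] one by blast
      from pm.subspace_add[OF subspace_Tfil
          Tfil_base[OF x this, simplified] Tfil_base[OF ac[of n] y, simplified]]
      show "tensor x y - tensor (a n) (pt \<one>) \<in> ?F n"
        by (simp add: tensor_bilinear)
    qed
    have 3: "completed_tensor G \<one>\<^bsub>A.C\<^esub> (alg_cls a) = cls ?F (\<lambda>n. tensor (pt \<one>) (a n))"
      unfolding tensor_square_def A.one_C
    proof (rule induced2_cls[OF subspace_power subspace_power subspace_Tfil])
      fix n and x y :: "'a \<Rightarrow>\<^sub>0 'k" assume x: "x - pt \<one> \<in> Ipow G n" and y: "y - a n \<in> Ipow G n"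
      have "x - pt \<one> \<in> Ipow G 0" using x power_antimono[of 0 n] by blast
      then have "x \<in> Ipow G 0" using subspace_diff_cancel[OF subspace_power] one by blast
      from pm.subspace_add[OF subspace_Tfil
          Tfil_base[OF this y, simplified] Tfil_base[OF x ac[of n], simplified]]
      show "tensor x y - tensor (pt \<one>) (a n) \<in> ?F n"
        by (simp add: tensor_bilinear)
    qed
    interpret T: filtered_group_algebra "G \<times>\<times> G" ?F
      by (intro filtered_group_algebra.intro filtered_group_algebra_axioms.intro group_GG
          galg_ideal_Tfil Tfil_Suc_subset)
    show ?thesis
      unfolding 1 2 3 unfolding tensor_square_def T.add_C T.cls_eq_iff
      by (simp add: primitive_defect_def diff_diff_eq)
  qed
  then show ?thesis
    unfolding primitive_elements_def A.carrier_C lie_rep_def by blast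
qed

lemma lie_repD:
  assumes "lie_rep a"
  shows "alg_coherent a" "a n \<in> galg G" "primitive_defect G (a n) \<in> Tfil G n"
    "m \<le> n \<Longrightarrow> a n - a m \<in> Ipow G m"
  using assms filtered_group_algebra.coherentD[OF filtered_power, of a n]
    filtered_group_algebra.coherent_diff[OF filtered_power, of a m n]
  by (auto simp: lie_rep_def)

lemma lie_rep_add: "lie_rep a \<Longrightarrow> lie_rep b \<Longrightarrow> lie_rep (\<lambda>n. a n + b n)"
  unfolding lie_rep_def
  by (simp add: primitive_defect_lin pm.subspace_add[OF subspace_Tfil]
      filtered_group_algebra.coherent_add[OF filtered_power])

lemma lie_rep_scale: "lie_rep a \<Longrightarrow> lie_rep (\<lambda>n. scale c (a n))"
  unfolding lie_rep_def
  by (simp add: primitive_defect_lin pm.subspace_scale[OF subspace_Tfil]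
      filtered_group_algebra.coherent_scale[OF filtered_power])

lemma lie_rep_zero: "lie_rep (\<lambda>n. 0)"
  unfolding lie_rep_def
  by (simp add: primitive_defect_lin pm.subspace_0[OF subspace_Tfil]
      filtered_group_algebra.coherent_const[OF filtered_power] pm.subspace_0[OF subspace_galg])

lemma lie_rep_diff: "lie_rep a \<Longrightarrow> lie_rep b \<Longrightarrow> lie_rep (\<lambda>n. a n - b n)"
  using lie_rep_add[OF _ lie_rep_scale[of b "-1"], of a] by (simp add: pm.scale_minus_left)

text \<open>Write \<open>\<Delta> x = p x + r x\<close> with \<open>p x = x \<otimes> 1 + 1 \<otimes> x\<close> and \<open>r x\<close> the defect. Modulo the ideal
containing the defects of \<open>a\<close> and \<open>b\<close>, the commutator of \<open>\<Delta> a\<close> and \<open>\<Delta> b\<close> is that of \<open>p a\<close> and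
\<open>p b\<close>, in which the mixed terms \<open>a \<otimes> b\<close> and \<open>b \<otimes> a\<close> cancel.\<close>

lemma primitive_defect_commutator:
  assumes a: "a \<in> galg G" and b: "b \<in> galg G"
    and da: "primitive_defect G a \<in> Tfil G n" and db: "primitive_defect G b \<in> Tfil G n"
  shows "primitive_defect G (a \<star> b - b \<star> a) \<in> Tfil G n"
proof -
  let ?m = "gmul (G \<times>\<times> G)"
  note J = galg_ideal_Tfil[of n]
  have o: "pt \<one> \<in> galg G" by (simp add: pt_galg)
  define p where "p x = tensor x (pt \<one>) + tensor (pt \<one>) x" for x :: "'a \<Rightarrow>\<^sub>0 'c"
  have p: "p x \<in> galg (G \<times>\<times> G)" if "x \<in> galg G" for x
    unfolding p_def using that by (intro pm.subspace_add[OF subspace_galg] tensor_galg pt_galg one_closed)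
  have D: "comultiplication x = p x + primitive_defect G x" for x
    by (simp add: p_def primitive_defect_def)
  have cg: "comultiplication x \<in> galg (G \<times>\<times> G)" if "x \<in> galg G" for x
    using comultiplication_filtration[of x 0] that by (simp add: Tfil_0)
  have prod: "?m (p x) (p y) = tensor (x \<star> y) (pt \<one>) + tensor (pt \<one>) (x \<star> y) + tensor x y + tensor y x"
    if "x \<in> galg G" "y \<in> galg G" for x y
    using that by (simp add: p_def gmul_bilinear gmul_tensor gmul_one[OF that(1)] gmul_one[OF that(2)])
  have mix: "?m (comultiplication x) (comultiplication y) - ?m (p x) (p y) \<in> Tfil G n"
    if x: "x \<in> galg G" "primitive_defect G x \<in> Tfil G n"
      and y: "y \<in> galg G" "primitive_defect G y \<in> Tfil G n" for x y
  proof -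
    have "?m (comultiplication x) (comultiplication y) - ?m (p x) (p y) =
        ?m (comultiplication x) (primitive_defect G y) + ?m (primitive_defect G x) (p y)"
      unfolding D by (simp add: gmul_bilinear)
    then show ?thesis
      using galg_idealD(4)[OF J cg[OF x(1)] y(2)] galg_idealD(5)[OF J p[OF y(1)] x(2)]
      by (simp add: pm.subspace_add[OF subspace_Tfil])
  qed
  have "primitive_defect G (a \<star> b - b \<star> a) =
      (?m (comultiplication a) (comultiplication b) - ?m (p a) (p b)) -
      (?m (comultiplication b) (comultiplication a) - ?m (p b) (p a))"
    by (simp add: primitive_defect_def comul_lin comultiplication_gmul tensor_bilinear prod[OF a b] prod[OF b a])
  then show ?thesis
    using pm.subspace_diff[OF subspace_Tfil mix[OF a da b db] mix[OF b db a da]] by simp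
qed

lemma lie_rep_commutator:
  assumes "lie_rep a" "lie_rep b"
  shows "lie_rep (\<lambda>n. a n \<star> b n - b n \<star> a n)"
  unfolding lie_rep_def
  by (intro conjI allI primitive_defect_commutator lie_repD assms
      filtered_group_algebra.coherent_diff_seq[OF filtered_power]
      filtered_group_algebra.coherent_mult[OF filtered_power])

text \<open>Apply the augmentation of the tensor square to the defect: it gives \<open>\<epsilon>(a) - 2 \<epsilon>(a)\<close>, and it
vanishes in positive filtration. Hence every primitive element has filtration 1.\<close>

lemma lie_rep_augmentation:
  fixes a :: "nat \<Rightarrow> ('a \<Rightarrow>\<^sub>0 'k::field)"
  assumes a: "lie_rep a" and "1 \<le> n"
  shows "a n \<in> Ipow G 1"
proof -
  have "augmentation (primitive_defect G (a n)) = 0"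
    using augmentation_Tfil[OF lie_repD(3)[OF a] \<open>1 \<le> n\<close>] .
  then have "augmentation (a n) = 0"
    by (simp add: primitive_defect_def augmentation_diff augmentation_tensor augmentation_comultiplication)
  then show ?thesis
    using lie_repD(2)[OF a] by (simp add: power_1 augmentation_ideal_iff)
qed

lemma carrier_malcev: "carrier (malcev_lie G) = {alg_cls a | a. lie_rep a}"
  by (simp add: malcev_lie_def Let_def primitive_elements_rep)

lemma add_malcev: "alg_cls a \<oplus>\<^bsub>malcev_lie G\<^esub> alg_cls b = alg_cls (\<lambda>n. a n + b n)"
  by (simp add: malcev_lie_def Let_def filtered_group_algebra.add_C[OF filtered_power])

lemma zero_malcev: "\<zero>\<^bsub>malcev_lie G\<^esub> = alg_cls (\<lambda>n. 0)"
  by (simp add: malcev_lie_def Let_def filtered_group_algebra.zero_C[OF filtered_power])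

lemma smult_malcev: "c \<odot>\<^bsub>malcev_lie G\<^esub> alg_cls a = alg_cls (\<lambda>n. scale c (a n))"
  by (simp add: malcev_lie_def Let_def filtered_group_algebra.smult_C[OF filtered_power])

lemma bracket_malcev:
  assumes "lie_rep a" "lie_rep b"
  shows "bracket (malcev_lie G) (alg_cls a) (alg_cls b) = alg_cls (\<lambda>n. a n \<star> b n - b n \<star> a n)"
  using lie_repD(1)[OF assms(1)] lie_repD(1)[OF assms(2)]
  by (simp add: malcev_lie_def Let_def filtered_group_algebra.mult_C[OF filtered_power]
      filtered_group_algebra.minus_C[OF filtered_power]
      filtered_group_algebra.coherent_mult[OF filtered_power])

text \<open>For a coherent sequence the condition on all components of index at least \<open>k\<close> reduces to the
component of index \<open>k\<close>.\<close>

lemma filt_malcev: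
  "filt (malcev_lie G) k = {alg_cls a | a. lie_rep a \<and> a k \<in> Ipow G k}"
proof -
  have "alg_cls a \<in> completion_filtration (group_algebra G) (Ipow G) k \<longleftrightarrow> a k \<in> Ipow G k"
    if a: "lie_rep a" for a :: "nat \<Rightarrow> ('a \<Rightarrow>\<^sub>0 'c)"
  proof -
    have "alg_cls a j \<subseteq> Ipow G k \<longleftrightarrow> a k \<in> Ipow G k" if "k \<le> j" for j
    proof -
      have "alg_cls a j \<subseteq> Ipow G k \<longleftrightarrow> a j - 0 \<in> Ipow G k"
        using coset_subset_iff[OF subspace_power subspace_power power_antimono[OF that], of "a j" 0]
        by (simp add: cls_def coset_0)
      also have "\<dots> \<longleftrightarrow> a k \<in> Ipow G k"
        using subspace_diff_cancel[OF subspace_power lie_repD(4)[OF a that]] by simp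
      finally show ?thesis .
    qed
    moreover have "alg_cls a \<in> carrier (completed_group_algebra G)"
      using lie_repD(1)[OF a] filtered_group_algebra.carrier_C[OF filtered_power] by blast
    ultimately show ?thesis by (auto simp: completion_filtration_def)
  qed
  then show ?thesis
    by (auto simp: malcev_lie_def Let_def primitive_elements_rep)
qed

end

section \<open>Filtered formality descends to quotients\<close>

text \<open>The properties of a filtered Lie algebra that make the brackets and scalar multiplications of
its graded pieces well defined.\<close>

locale filtered_lie_algebra = abelian_group M
  for M :: "('k, 'm) filtered_lie" (structure) +
  assumes filt_subgroup: "1 \<le> k \<Longrightarrow> additive_subgroup (filt M k) M"
    and filt_1: "filt M 1 = carrier M"
    and filt_Suc: "1 \<le> k \<Longrightarrow> filt M (Suc k) \<subseteq> filt M k"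
    and smult_filt: "1 \<le> k \<Longrightarrow> x \<in> filt M k \<Longrightarrow> c \<odot> x \<in> filt M k"
    and smult_add: "x \<in> carrier M \<Longrightarrow> y \<in> carrier M \<Longrightarrow> c \<odot> (x \<oplus> y) = c \<odot> x \<oplus> c \<odot> y"
    and bracket_filt: "1 \<le> p \<Longrightarrow> 1 \<le> q \<Longrightarrow> x \<in> filt M p \<Longrightarrow> y \<in> filt M q \<Longrightarrow> x \<otimes> y \<in> filt M (p + q)"
    and bracket_add_left: "x \<in> carrier M \<Longrightarrow> y \<in> carrier M \<Longrightarrow> z \<in> carrier M \<Longrightarrow>
      (x \<oplus> y) \<otimes> z = x \<otimes> z \<oplus> y \<otimes> z"
    and bracket_add_right: "x \<in> carrier M \<Longrightarrow> y \<in> carrier M \<Longrightarrow> z \<in> carrier M \<Longrightarrow>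
      z \<otimes> (x \<oplus> y) = z \<otimes> x \<oplus> z \<otimes> y"
begin

lemma filt_antimono:
  assumes "1 \<le> k" "k \<le> l"
  shows "filt M l \<subseteq> filt M k"
  using assms(2) by (induction l rule: dec_induct) (use assms(1) filt_Suc in \<open>auto dest: order_trans\<close>)

lemma filt_carrier: "1 \<le> k \<Longrightarrow> x \<in> filt M k \<Longrightarrow> x \<in> carrier M"
  using filt_antimono[of 1 k] by (auto simp: filt_1[simplified])

lemma filt_abelian_subgroup: "1 \<le> k \<Longrightarrow> abelian_subgroup (filt M k) M"
  by (rule abelian_subgroupI3[OF filt_subgroup abelian_group_axioms])

lemma filt_zero: "1 \<le> k \<Longrightarrow> \<zero> \<in> filt M k"
  and filt_add: "1 \<le> k \<Longrightarrow> x \<in> filt M k \<Longrightarrow> y \<in> filt M k \<Longrightarrow> x \<oplus> y \<in> filt M k"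
  and filt_inv: "1 \<le> k \<Longrightarrow> x \<in> filt M k \<Longrightarrow> \<ominus> x \<in> filt M k"
  using additive_subgroup.zero_closed[OF filt_subgroup] additive_subgroup.a_closed[OF filt_subgroup]
    additive_subgroup.a_inv_closed[OF filt_subgroup]
  by auto

lemma diff_zero_iff:
  assumes "x \<in> carrier M" "y \<in> carrier M"
  shows "x \<ominus> y = \<zero> \<longleftrightarrow> x = y"
proof
  assume "x \<ominus> y = \<zero>"
  moreover have "x = (x \<ominus> y) \<oplus> y" using assms by (simp add: a_minus_def a_assoc l_neg)
  ultimately show "x = y" using assms by simp
qed (use assms in \<open>simp add: a_minus_def r_neg\<close>)

definition gcls :: "nat \<Rightarrow> 'm \<Rightarrow> 'm set" where
  "gcls i u = filt M (Suc i) +> u"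

lemma gcls_eq_iff:
  assumes "u \<in> carrier M" "v \<in> carrier M"
  shows "gcls i u = gcls i v \<longleftrightarrow> u \<ominus> v \<in> filt M (Suc i)"
proof -
  interpret S: abelian_subgroup "filt M (Suc i)" M by (rule filt_abelian_subgroup) simp
  have m: "u \<in> gcls i v \<longleftrightarrow> u \<ominus> v \<in> filt M (Suc i)"
    using S.a_rcos_module[OF assms(2,1)] by (simp add: gcls_def a_minus_def)
  have "gcls i v = gcls i u" if "u \<in> gcls i v"
    using that a_repr_independence[of u "filt M (Suc i)" v] assms(2) S.a_subgroup by (simp add: gcls_def)
  moreover have "u \<in> gcls i u" using S.a_rcos_self[OF assms(1)] by (simp add: gcls_def)
  ultimately show ?thesis using m by auto
qed

lemma gcls_eq_zero_iff: "gcls i u = filt M (Suc i) \<longleftrightarrow> u \<in> filt M (Suc i)" if u: "u \<in> carrier M"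
proof -
  interpret S: abelian_subgroup "filt M (Suc i)" M by (rule filt_abelian_subgroup) simp
  have "gcls i \<zero> = filt M (Suc i)"
    unfolding gcls_def by (rule a_coset_add_zero[OF S.a_subset])
  moreover have m: "\<ominus> \<zero> = \<zero>" using minus_equality[of \<zero> \<zero>] by simp
  have "u \<ominus> \<zero> = u" unfolding a_minus_def m using u by (rule r_zero)
  ultimately show ?thesis using gcls_eq_iff[OF u zero_closed, of i] by simp
qed

lemma gcls_zero: "gcls i \<zero> = filt M (Suc i)"
  using gcls_eq_zero_iff[OF zero_closed] filt_zero[of "Suc i"] by simp

lemma carrier_gr: "carrier (gr_piece M i) = gcls i ` filt M i"
  by (auto simp: A_FactGroup_def' A_RCOSETS_def' a_r_coset_def' gcls_def)

lemma one_gr: "\<one>\<^bsub>gr_piece M i\<^esub> = filt M (Suc i)"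
  by (simp add: A_FactGroup_def')

lemma mult_gr:
  assumes "u \<in> carrier M" "v \<in> carrier M"
  shows "gcls i u \<otimes>\<^bsub>gr_piece M i\<^esub> gcls i v = gcls i (u \<oplus> v)"
proof -
  interpret S: abelian_subgroup "filt M (Suc i)" M by (rule filt_abelian_subgroup) simp
  show ?thesis
    using S.a_rcos_sum[OF assms] by (simp add: A_FactGroup_def' set_add_def' gcls_def)
qed

lemma comm_group_gr:
  assumes i: "1 \<le> i"
  shows "comm_group (gr_piece M i)"
proof (rule comm_groupI; unfold carrier_gr)
  show "\<one>\<^bsub>gr_piece M i\<^esub> \<in> gcls i ` filt M i"
    unfolding one_gr using gcls_zero[of i] filt_zero[OF i] by blast
next
  fix x assume "x \<in> gcls i ` filt M i"
  then obtain u where u: "u \<in> filt M i" "x = gcls i u" by auto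
  have uc: "u \<in> carrier M" using filt_carrier[OF i u(1)] .
  show "\<one>\<^bsub>gr_piece M i\<^esub> \<otimes>\<^bsub>gr_piece M i\<^esub> x = x"
    using mult_gr[OF zero_closed uc, of i] uc by (simp add: one_gr u(2) gcls_zero)
  have "gcls i (\<ominus> u) \<otimes>\<^bsub>gr_piece M i\<^esub> x = \<one>\<^bsub>gr_piece M i\<^esub>"
    using mult_gr[of "\<ominus> u" u i] uc by (simp add: one_gr u(2) gcls_zero l_neg)
  then show "\<exists>y\<in>gcls i ` filt M i. y \<otimes>\<^bsub>gr_piece M i\<^esub> x = \<one>\<^bsub>gr_piece M i\<^esub>"
    using filt_inv[OF i u(1)] by blast
next
  fix x y z assume "x \<in> gcls i ` filt M i" "y \<in> gcls i ` filt M i" "z \<in> gcls i ` filt M i"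
  then obtain u v w where "x = gcls i u" "y = gcls i v" "z = gcls i w"
    "u \<in> carrier M" "v \<in> carrier M" "w \<in> carrier M"
    using filt_carrier[OF i] by blast
  then show "x \<otimes>\<^bsub>gr_piece M i\<^esub> y \<otimes>\<^bsub>gr_piece M i\<^esub> z = x \<otimes>\<^bsub>gr_piece M i\<^esub> (y \<otimes>\<^bsub>gr_piece M i\<^esub> z)"
    by (simp only: mult_gr a_assoc a_closed)
next
  fix x y assume "x \<in> gcls i ` filt M i" "y \<in> gcls i ` filt M i"
  then obtain u v where *: "x = gcls i u" "y = gcls i v" "u \<in> filt M i" "v \<in> filt M i"
    by blast
  then have m: "x \<otimes>\<^bsub>gr_piece M i\<^esub> y = gcls i (u \<oplus> v)" "y \<otimes>\<^bsub>gr_piece M i\<^esub> x = gcls i (v \<oplus> u)"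
    using filt_carrier[OF i] by (simp_all only: mult_gr)
  show "x \<otimes>\<^bsub>gr_piece M i\<^esub> y \<in> gcls i ` filt M i"
    unfolding m using filt_add[OF i *(3,4)] by blast
  show "x \<otimes>\<^bsub>gr_piece M i\<^esub> y = y \<otimes>\<^bsub>gr_piece M i\<^esub> x"
    unfolding m using filt_carrier[OF i] *(3,4) by (simp add: a_comm)
qed

text \<open>With \<open>u' = a + u\<close> and \<open>v' = b + v\<close> the difference of the brackets is \<open>[a, v'] + [u, b]\<close>, of
filtration \<open>p + q + 1\<close>.\<close>

lemma gcls_bracket_cong:
  assumes "1 \<le> p" "1 \<le> q" "u \<in> filt M p" "v \<in> filt M q" "u' \<in> gcls p u" "v' \<in> gcls q v"
  shows "gcls (p + q) (u' \<otimes> v') = gcls (p + q) (u \<otimes> v)"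
proof -
  obtain a b where a: "a \<in> filt M (Suc p)" "u' = a \<oplus> u" and b: "b \<in> filt M (Suc q)" "v' = b \<oplus> v"
    using assms(5,6) by (auto simp: gcls_def a_r_coset_def')
  note c = filt_carrier[OF assms(1,3)] filt_carrier[OF assms(2,4)] filt_carrier[OF _ a(1)] filt_carrier[OF _ b(1)]
  have br: "x \<otimes> y \<in> carrier M" if "x \<in> carrier M" "y \<in> carrier M" for x y
    using bracket_filt[of 1 1 x y] filt_carrier[of 2 "x \<otimes> y"] that filt_1 by (simp add: numeral_2_eq_2)
  have "a \<oplus> u \<in> carrier M" using c by simp
  have vq: "b \<oplus> v \<in> filt M q"
    using filt_add[OF assms(2) _ assms(4)] b(1) filt_Suc[OF assms(2)] by blast
  have 1: "a \<otimes> (b \<oplus> v) \<in> filt M (Suc (p + q))"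
    using bracket_filt[of "Suc p" q a "b \<oplus> v"] assms a(1) vq by simp
  have 2: "u \<otimes> b \<in> filt M (Suc (p + q))"
    using bracket_filt[of p "Suc q" u b] assms b(1) by simp
  have "u' \<otimes> v' = (a \<otimes> (b \<oplus> v) \<oplus> u \<otimes> b) \<oplus> u \<otimes> v"
    unfolding a(2) b(2) using c br by (simp add: bracket_add_left bracket_add_right a_ac)
  then have "u' \<otimes> v' \<ominus> u \<otimes> v = a \<otimes> (b \<oplus> v) \<oplus> u \<otimes> b"
    using c br by (simp add: a_minus_def a_assoc r_neg)
  moreover have "u' \<in> carrier M" "v' \<in> carrier M" using a b c by auto
  ultimately show ?thesis
    using filt_add[OF _ 1 2] c br by (simp add: gcls_eq_iff)
qed

lemma gr_bracket_gcls:
  assumes "1 \<le> p" "1 \<le> q" "u \<in> filt M p" "v \<in> filt M q"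
  shows "gr_bracket M p q (gcls p u) (gcls q v) = gcls (p + q) (u \<otimes> v)"
proof -
  have "u \<in> gcls p u" "v \<in> gcls q v"
    using abelian_subgroup.a_rcos_self[OF filt_abelian_subgroup filt_carrier] assms by (auto simp: gcls_def)
  then show ?thesis
    using gcls_bracket_cong[OF assms] unfolding gr_bracket_def gcls_def by blast
qed

lemma gr_smult_gcls:
  assumes i: "1 \<le> i" and u: "u \<in> filt M i"
  shows "gr_smult M i c (gcls i u) = gcls i (c \<odot> u)"
proof -
  note uc = filt_carrier[OF i u]
  have self: "u \<in> gcls i u"
    using abelian_subgroup.a_rcos_self[OF filt_abelian_subgroup uc] by (auto simp: gcls_def)
  have "gcls i (c \<odot> u') = gcls i (c \<odot> u)" if u': "u' \<in> gcls i u" for u'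
  proof -
    obtain a where a: "a \<in> filt M (Suc i)" "u' = a \<oplus> u" using u' by (auto simp: gcls_def a_r_coset_def')
    have ac: "a \<in> carrier M" "c \<odot> a \<in> carrier M" "c \<odot> u \<in> carrier M"
      using filt_carrier[OF _ a(1)] filt_carrier[OF _ smult_filt[OF _ a(1)]] filt_carrier[OF i smult_filt[OF i u]] by auto
    have "c \<odot> u' \<ominus> c \<odot> u = c \<odot> a"
      using ac uc by (simp add: a(2) smult_add a_minus_def a_assoc r_neg)
    moreover have "c \<odot> u' \<in> carrier M" using ac uc by (simp add: a(2) smult_add)
    ultimately show ?thesis
      using smult_filt[OF _ a(1), of c] ac by (simp add: gcls_eq_iff)
  qed
  then show ?thesis using self unfolding gr_smult_def gcls_def by blast
qed

lemma gr_bracket_closed: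
  assumes "1 \<le> p" "1 \<le> q" "X \<in> carrier (gr_piece M p)" "Y \<in> carrier (gr_piece M q)"
  shows "gr_bracket M p q X Y \<in> carrier (gr_piece M (p + q))"
proof -
  obtain u v where "u \<in> filt M p" "X = gcls p u" "v \<in> filt M q" "Y = gcls q v"
    using assms(3,4) by (auto simp: carrier_gr)
  then show ?thesis
    using gr_bracket_gcls[OF assms(1,2)] bracket_filt[OF assms(1,2)] by (simp add: carrier_gr)
qed

end

lemma hom_finprod_comm_group:
  assumes "comm_group A" "comm_group B" "h \<in> hom A B" "finite S" "\<And>s. s \<in> S \<Longrightarrow> f s \<in> carrier A"
  shows "h (finprod A f S) = finprod B (\<lambda>s. h (f s)) S"
  using assms(4,5)
proof (induction S rule: finite_induct)
  interpret A: comm_group A by fact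
  interpret B: comm_group B by fact
  case empty
  show ?case using hom_one[OF assms(3) A.is_group B.is_group] by simp
next
  interpret A: comm_group A by fact
  interpret B: comm_group B by fact
  case (insert s S)
  have "h (f s) \<in> carrier B" "\<And>t. t \<in> S \<Longrightarrow> h (f t) \<in> carrier B"
    using assms(3) insert.prems by (auto simp: hom_def)
  then show ?case
    using insert assms(3) by (simp add: A.finprod_insert B.finprod_insert hom_mult Pi_iff)
qed

text \<open>The map \<open>\<pi>\<close> presents \<open>L\<close> as the quotient of \<open>M\<close> by the term \<open>d\<close> of its filtration, with the
quotient filtration.\<close>

locale filtered_lie_quotient = A: filtered_lie_algebra M + B: filtered_lie_algebra L
  for M :: "('k, 'm) filtered_lie" and L :: "('k, 'n) filtered_lie" +
  fixes \<pi> :: "'m \<Rightarrow> 'n" and d :: nat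
  assumes pi_add: "x \<in> carrier M \<Longrightarrow> y \<in> carrier M \<Longrightarrow> \<pi> (x \<oplus>\<^bsub>M\<^esub> y) = \<pi> x \<oplus>\<^bsub>L\<^esub> \<pi> y"
    and pi_smult: "x \<in> carrier M \<Longrightarrow> \<pi> (c \<odot>\<^bsub>M\<^esub> x) = c \<odot>\<^bsub>L\<^esub> \<pi> x"
    and pi_bracket: "x \<in> carrier M \<Longrightarrow> y \<in> carrier M \<Longrightarrow> \<pi> (x \<otimes>\<^bsub>M\<^esub> y) = \<pi> x \<otimes>\<^bsub>L\<^esub> \<pi> y"
    and pi_filt: "1 \<le> k \<Longrightarrow> \<pi> ` filt M k = filt L k"
    and d: "1 \<le> d"
    and pi_kernel: "x \<in> carrier M \<Longrightarrow> \<pi> x = \<zero>\<^bsub>L\<^esub> \<longleftrightarrow> x \<in> filt M d"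
begin

lemma pi_carrier: "\<pi> ` carrier M = carrier L"
  using pi_filt[of 1] A.filt_1 B.filt_1 by simp

lemma pi_closed: "x \<in> carrier M \<Longrightarrow> \<pi> x \<in> carrier L"
  using pi_carrier by blast

lemma pi_filtD: "1 \<le> k \<Longrightarrow> x \<in> filt M k \<Longrightarrow> \<pi> x \<in> filt L k"
  using pi_filt by blast

lemma pi_filtE:
  assumes "1 \<le> k" "y \<in> filt L k"
  obtains x where "x \<in> filt M k" "y = \<pi> x"
  using assms(2) unfolding pi_filt[OF assms(1), symmetric] by (rule imageE) simp

lemma pi_diff:
  assumes "x \<in> carrier M" "y \<in> carrier M"
  shows "\<pi> (x \<ominus>\<^bsub>M\<^esub> y) = \<pi> x \<ominus>\<^bsub>L\<^esub> \<pi> y"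
proof -
  have "\<pi> (x \<ominus>\<^bsub>M\<^esub> y) \<oplus>\<^bsub>L\<^esub> \<pi> y = \<pi> x"
    using assms pi_add[of "x \<ominus>\<^bsub>M\<^esub> y" y] by (simp add: a_minus_def A.a_assoc A.l_neg)
  then have "\<pi> x \<ominus>\<^bsub>L\<^esub> \<pi> y = \<pi> (x \<ominus>\<^bsub>M\<^esub> y) \<oplus>\<^bsub>L\<^esub> (\<pi> y \<oplus>\<^bsub>L\<^esub> \<ominus>\<^bsub>L\<^esub> \<pi> y)"
    using assms pi_closed[of "x \<ominus>\<^bsub>M\<^esub> y"] pi_closed[of y] by (simp add: a_minus_def B.a_assoc[symmetric])
  then show ?thesis using assms pi_closed[of "x \<ominus>\<^bsub>M\<^esub> y"] pi_closed[of y] by (simp add: B.r_neg)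
qed

lemma filt_L_trivial:
  assumes "d \<le> k"
  shows "filt L k = {\<zero>\<^bsub>L\<^esub>}"
proof -
  have "\<pi> x = \<zero>\<^bsub>L\<^esub>" if "x \<in> filt M k" for x
    using that A.filt_antimono[OF d assms] pi_kernel A.filt_carrier[of k] d assms by auto
  then have "filt L k \<subseteq> {\<zero>\<^bsub>L\<^esub>}" using pi_filt[of k] d assms by force
  then show ?thesis using B.filt_zero[of k] d assms by auto
qed

lemma pi_gcls:
  assumes "u \<in> carrier M"
  shows "\<pi> ` A.gcls i u = B.gcls i (\<pi> u)"
proof -
  have "\<pi> ` A.gcls i u = (\<lambda>x. \<pi> (x \<oplus>\<^bsub>M\<^esub> u)) ` filt M (Suc i)"
    by (auto simp: A.gcls_def a_r_coset_def')
  also have "\<dots> = (\<lambda>x. \<pi> x \<oplus>\<^bsub>L\<^esub> \<pi> u) ` filt M (Suc i)"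
    using A.filt_carrier[of "Suc i"] assms by (intro image_cong refl pi_add) auto
  also have "\<dots> = (\<lambda>y. y \<oplus>\<^bsub>L\<^esub> \<pi> u) ` (\<pi> ` filt M (Suc i))"
    by (simp add: image_image)
  also have "\<dots> = B.gcls i (\<pi> u)"
    by (subst pi_filt) (auto simp: B.gcls_def a_r_coset_def')
  finally show ?thesis .
qed

lemma pi_gcls_inj:
  assumes "u \<in> carrier M" "v \<in> carrier M" "i < d" "B.gcls i (\<pi> u) = B.gcls i (\<pi> v)"
  shows "A.gcls i u = A.gcls i v"
proof -
  have "\<pi> (u \<ominus>\<^bsub>M\<^esub> v) \<in> filt L (Suc i)"
    using assms pi_closed B.gcls_eq_iff by (simp add: pi_diff)
  then obtain w where w: "w \<in> filt M (Suc i)" "\<pi> (u \<ominus>\<^bsub>M\<^esub> v) = \<pi> w"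
    using pi_filt[of "Suc i"] by auto
  have wc: "w \<in> carrier M" using A.filt_carrier[OF _ w(1)] by simp
  have "\<pi> ((u \<ominus>\<^bsub>M\<^esub> v) \<ominus>\<^bsub>M\<^esub> w) = \<zero>\<^bsub>L\<^esub>"
    using pi_diff[OF A.minus_closed[OF assms(1,2)] wc] w(2) pi_closed[OF wc]
    by (simp add: B.diff_zero_iff)
  then have "(u \<ominus>\<^bsub>M\<^esub> v) \<ominus>\<^bsub>M\<^esub> w \<in> filt M (Suc i)"
    using pi_kernel[of "(u \<ominus>\<^bsub>M\<^esub> v) \<ominus>\<^bsub>M\<^esub> w"] A.filt_antimono[of "Suc i" d] assms wc by auto
  from A.filt_add[OF _ this w(1)] have "u \<ominus>\<^bsub>M\<^esub> v \<in> filt M (Suc i)"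
    using assms wc by (simp add: a_minus_def A.a_assoc A.l_neg)
  then show ?thesis using assms by (simp add: A.gcls_eq_iff)
qed

lemma pi_hom_gr:
  assumes i: "1 \<le> i"
  shows "(`) \<pi> \<in> hom (gr_piece M i) (gr_piece L i)"
  unfolding hom_def
proof (intro CollectI conjI ballI funcsetI)
  fix X assume "X \<in> carrier (gr_piece M i)"
  then show "\<pi> ` X \<in> carrier (gr_piece L i)"
    using A.filt_carrier[OF i] pi_filtD[OF i] by (auto simp: A.carrier_gr B.carrier_gr pi_gcls)
next
  fix X Y assume "X \<in> carrier (gr_piece M i)" "Y \<in> carrier (gr_piece M i)"
  then obtain u v where "u \<in> carrier M" "v \<in> carrier M" "X = A.gcls i u" "Y = A.gcls i v"
    using A.filt_carrier[OF i] by (auto simp: A.carrier_gr)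
  then show "\<pi> ` (X \<otimes>\<^bsub>gr_piece M i\<^esub> Y) = \<pi> ` X \<otimes>\<^bsub>gr_piece L i\<^esub> \<pi> ` Y"
    by (simp only: A.mult_gr B.mult_gr pi_gcls pi_closed pi_add A.a_closed)
qed

lemma pi_gr_one: "1 \<le> i \<Longrightarrow> \<pi> ` \<one>\<^bsub>gr_piece M i\<^esub> = \<one>\<^bsub>gr_piece L i\<^esub>"
  using pi_filt[of "Suc i"] by (simp add: A.one_gr B.one_gr)

lemma pi_gr_bracket:
  assumes "1 \<le> p" "1 \<le> q" "X \<in> carrier (gr_piece M p)" "Y \<in> carrier (gr_piece M q)"
  shows "\<pi> ` gr_bracket M p q X Y = gr_bracket L p q (\<pi> ` X) (\<pi> ` Y)"
proof -
  obtain u v where u: "u \<in> filt M p" "X = A.gcls p u" and v: "v \<in> filt M q" "Y = A.gcls q v"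
    using assms(3,4) by (auto simp: A.carrier_gr)
  note c = A.filt_carrier[OF assms(1) u(1)] A.filt_carrier[OF assms(2) v(1)]
  have "u \<otimes>\<^bsub>M\<^esub> v \<in> carrier M"
    using A.filt_carrier[OF _ A.bracket_filt[OF assms(1,2) u(1) v(1)]] assms(1) by simp
  moreover have "\<pi> u \<in> filt L p" "\<pi> v \<in> filt L q"
    using pi_filtD[OF assms(1) u(1)] pi_filtD[OF assms(2) v(1)] .
  ultimately show ?thesis
    using assms(1,2) u v c
    by (simp add: A.gr_bracket_gcls B.gr_bracket_gcls pi_gcls pi_bracket)
qed

lemma pi_gr_smult:
  assumes "1 \<le> i" "X \<in> carrier (gr_piece M i)"
  shows "\<pi> ` gr_smult M i c X = gr_smult L i c (\<pi> ` X)"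
proof -
  obtain u where u: "u \<in> filt M i" "X = A.gcls i u" using assms(2) by (auto simp: A.carrier_gr)
  have "\<pi> u \<in> filt L i" using pi_filtD[OF assms(1) u(1)] .
  then show ?thesis
    using A.filt_carrier[OF assms(1) u(1)] A.filt_carrier[OF assms(1) A.smult_filt[OF assms(1) u(1)]] assms(1) u
    by (simp add: A.gr_smult_gcls B.gr_smult_gcls pi_gcls pi_smult)
qed

lemma pi_gr_trivial:
  assumes "d \<le> i" "X \<in> carrier (gr_piece M i)"
  shows "\<pi> ` X = \<one>\<^bsub>gr_piece L i\<^esub>"
proof -
  have i: "1 \<le> i" using assms(1) d by simp
  obtain u where u: "u \<in> filt M i" "X = A.gcls i u" using assms(2) by (auto simp: A.carrier_gr)
  have "\<pi> u = \<zero>\<^bsub>L\<^esub>" using filt_L_trivial[OF assms(1)] pi_filtD[OF i u(1)] by simp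
  then show ?thesis using A.filt_carrier[OF i u(1)] u by (simp add: pi_gcls B.gcls_zero B.one_gr)
qed

lemma pi_gr_inj:
  assumes "1 \<le> i" "i < d" "X \<in> carrier (gr_piece M i)" "Y \<in> carrier (gr_piece M i)" "\<pi> ` X = \<pi> ` Y"
  shows "X = Y"
proof -
  obtain u v where u: "u \<in> filt M i" "X = A.gcls i u" and v: "v \<in> filt M i" "Y = A.gcls i v"
    using assms(3,4) by (auto simp: A.carrier_gr)
  then show ?thesis
    using assms(5) A.filt_carrier[OF assms(1)] pi_gcls_inj[OF _ _ assms(2), of u v] by (simp add: pi_gcls)
qed

lemma pi_gr_surj:
  assumes "1 \<le> i" "Z \<in> carrier (gr_piece L i)"
  shows "\<exists>X\<in>carrier (gr_piece M i). \<pi> ` X = Z"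
proof -
  obtain y where "y \<in> filt L i" and Z: "Z = B.gcls i y" using assms(2) by (auto simp: B.carrier_gr)
  then obtain u where "u \<in> filt M i" "y = \<pi> u" using pi_filtE[OF assms(1)] by metis
  then show ?thesis
    using A.filt_carrier[OF assms(1)] Z by (intro bexI[of _ "A.gcls i u"]) (auto simp: A.carrier_gr pi_gcls)
qed

text \<open>Elements of graded pieces are cosets, and the image of a coset under \<open>\<pi>\<close> is again a coset, so
the map induced on completed graded algebras just takes images. It is bijective in degrees below
\<open>d\<close> and zero from degree \<open>d\<close> on.\<close>

definition gr_map :: "(nat \<Rightarrow> 'm set) \<Rightarrow> (nat \<Rightarrow> 'n set)" where
  "gr_map z = (\<lambda>k\<in>{1..}. \<pi> ` z k)"

text \<open>An isomorphism \<open>\<phi>\<close> for \<open>M\<close> descends to \<open>L\<close>: the composition of \<open>\<phi>\<close> with the map of graded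
algebras identifies two elements exactly when their difference lies in the term \<open>d\<close> of the
filtration, that is, exactly when \<open>\<pi>\<close> identifies them.\<close>

theorem filtered_formal_quotient:
  assumes "filtered_formal_lie M"
  shows "filtered_formal_lie L"
proof -
  let ?GM = "completed_gr M" and ?GL = "completed_gr L"
  obtain \<phi> where \<phi>: "\<phi> \<in> filtered_lie_iso M ?GM"
    and \<phi>id: "\<And>k x. 1 \<le> k \<Longrightarrow> x \<in> filt M k \<Longrightarrow> \<phi> x k = A.gcls k x"
    using assms unfolding filtered_formal_lie_def A.gcls_def by auto
  have bij: "bij_betw \<phi> (carrier M) (carrier ?GM)"
    and \<phi>add: "\<And>x y. x \<in> carrier M \<Longrightarrow> y \<in> carrier M \<Longrightarrow> \<phi> (x \<oplus>\<^bsub>M\<^esub> y) = \<phi> x \<oplus>\<^bsub>?GM\<^esub> \<phi> y"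
    and \<phi>smult: "\<And>c x. x \<in> carrier M \<Longrightarrow> \<phi> (c \<odot>\<^bsub>M\<^esub> x) = c \<odot>\<^bsub>?GM\<^esub> \<phi> x"
    and \<phi>bracket: "\<And>x y. x \<in> carrier M \<Longrightarrow> y \<in> carrier M \<Longrightarrow> \<phi> (x \<otimes>\<^bsub>M\<^esub> y) = \<phi> x \<otimes>\<^bsub>?GM\<^esub> \<phi> y"
    and \<phi>filt: "\<And>k. 1 \<le> k \<Longrightarrow> \<phi> ` filt M k = filt ?GM k"
    using \<phi> unfolding filtered_lie_iso_def by auto
  have comp: "\<phi> x k \<in> carrier (gr_piece M k)" if "x \<in> carrier M" "1 \<le> k" for x k
    using bij_betw_apply[OF bij that(1)] that(2) by (auto simp: completed_gr_def)
  have addk: "\<phi> (x \<oplus>\<^bsub>M\<^esub> y) k = \<phi> x k \<otimes>\<^bsub>gr_piece M k\<^esub> \<phi> y k" if "x \<in> carrier M" "y \<in> carrier M" "1 \<le> k" for x y k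
    using that by (simp add: \<phi>add) (simp add: completed_gr_def)
  have filtk: "x \<in> filt M k \<longleftrightarrow> (\<forall>j\<in>{1..<k}. \<phi> x j = \<one>\<^bsub>gr_piece M j\<^esub>)" if x: "x \<in> carrier M" and k: "1 \<le> k" for x k
  proof -
    have "x \<in> filt M k \<longleftrightarrow> \<phi> x \<in> \<phi> ` filt M k"
      using inj_on_image_mem_iff[OF bij_betw_imp_inj_on[OF bij] x, of "filt M k"] A.filt_carrier[OF k] by auto
    also have "\<dots> \<longleftrightarrow> (\<forall>j\<in>{1..<k}. \<phi> x j = \<one>\<^bsub>gr_piece M j\<^esub>)"
      unfolding \<phi>filt[OF k] using bij_betw_apply[OF bij x] by (auto simp: completed_gr_def)
    finally show ?thesis .
  qed
  \<comment> \<open>The maps \<open>gr_map \<circ> \<phi>\<close> and \<open>\<pi>\<close> have the same fibres, because \<open>\<phi>\<close> matches the filtrations.\<close>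
  have fibre: "gr_map (\<phi> x) = gr_map (\<phi> y) \<longleftrightarrow> \<pi> x = \<pi> y" if x: "x \<in> carrier M" and y: "y \<in> carrier M" for x y
  proof -
    let ?e = "x \<ominus>\<^bsub>M\<^esub> y"
    have e: "?e \<in> carrier M" "x = y \<oplus>\<^bsub>M\<^esub> ?e"
      using x y by (simp_all add: a_minus_def A.a_lcomm A.r_neg)
    have "\<pi> x = \<pi> y \<longleftrightarrow> \<pi> ?e = \<zero>\<^bsub>L\<^esub>"
      using x y pi_closed by (simp add: pi_diff B.diff_zero_iff)
    also have "\<dots> \<longleftrightarrow> ?e \<in> filt M d" by (rule pi_kernel[OF e(1)])
    also have "\<dots> \<longleftrightarrow> (\<forall>j\<in>{1..<d}. \<phi> ?e j = \<one>\<^bsub>gr_piece M j\<^esub>)" by (rule filtk[OF e(1) d])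
    also have "\<dots> \<longleftrightarrow> (\<forall>j\<in>{1..<d}. \<phi> x j = \<phi> y j)"
    proof (rule ball_cong[OF refl])
      fix j assume "j \<in> {1..<d}"
      then have j: "1 \<le> j" by simp
      interpret g: comm_group "gr_piece M j" by (rule A.comm_group_gr[OF j])
      have eq: "\<phi> x j = \<phi> y j \<otimes>\<^bsub>gr_piece M j\<^esub> \<phi> ?e j" using addk[OF y e(1) j] e(2) by simp
      show "\<phi> ?e j = \<one>\<^bsub>gr_piece M j\<^esub> \<longleftrightarrow> \<phi> x j = \<phi> y j"
        unfolding eq using g.l_cancel_one[OF comp[OF y j] comp[OF e(1) j]] by (rule sym)
    qed
    also have "\<dots> \<longleftrightarrow> (\<forall>j\<ge>1. \<pi> ` \<phi> x j = \<pi> ` \<phi> y j)"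
    proof (intro iffI allI impI ballI)
      fix j :: nat assume *: "\<forall>j\<in>{1..<d}. \<phi> x j = \<phi> y j" and j: "1 \<le> j"
      show "\<pi> ` \<phi> x j = \<pi> ` \<phi> y j"
        using * j pi_gr_trivial[of j] comp[OF x j] comp[OF y j] by (cases "j < d") auto
    next
      fix j :: nat assume "\<forall>j\<ge>1. \<pi> ` \<phi> x j = \<pi> ` \<phi> y j" "j \<in> {1..<d}"
      then show "\<phi> x j = \<phi> y j" using comp[OF x] comp[OF y] by (intro pi_gr_inj[of j]) auto
    qed
    also have "\<dots> \<longleftrightarrow> gr_map (\<phi> x) = gr_map (\<phi> y)"
      by (auto simp: gr_map_def fun_eq_iff)
    finally show ?thesis by simp
  qed
  define s where "s = inv_into (carrier M) \<pi>"
  have s: "s y \<in> carrier M" "\<pi> (s y) = y" if "y \<in> carrier L" for y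
    using that pi_carrier unfolding s_def by (auto intro: inv_into_into f_inv_into_f)
  define \<psi> where "\<psi> y = gr_map (\<phi> (s y))" for y
  have \<psi>: "\<psi> (\<pi> x) = gr_map (\<phi> x)" if "x \<in> carrier M" for x
    unfolding \<psi>_def using fibre[OF s(1) that] s(2) pi_closed[OF that] by simp
  have gr_map_carrier: "gr_map (\<phi> x) \<in> carrier ?GL" if "x \<in> carrier M" for x
    using comp[OF that] hom_in_carrier[OF pi_hom_gr] by (auto simp: completed_gr_def gr_map_def)
  have \<psi>filt: "\<psi> ` filt L k = filt ?GL k" if k: "1 \<le> k" for k
  proof (intro equalityI subsetI)
    fix z assume "z \<in> \<psi> ` filt L k"
    then obtain x where x: "x \<in> filt M k" "z = \<psi> (\<pi> x)" by (metis imageE pi_filtE[OF k])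
    have xc: "x \<in> carrier M" using A.filt_carrier[OF k x(1)] .
    have "z = gr_map (\<phi> x)" using x \<psi>[OF xc] by simp
    then show "z \<in> filt ?GL k"
      using gr_map_carrier[OF xc] x(1)[unfolded filtk[OF xc k]] pi_gr_one
      by (auto simp: completed_gr_def gr_map_def)
  next
    fix z assume "z \<in> filt ?GL k"
    then have z: "\<And>j. 1 \<le> j \<Longrightarrow> z j \<in> carrier (gr_piece L j)" "\<And>j. 1 \<le> j \<Longrightarrow> j < k \<Longrightarrow> z j = \<one>\<^bsub>gr_piece L j\<^esub>"
      "z \<in> extensional {1..}"
      by (auto simp: completed_gr_def PiE_def)
    have "\<forall>j\<in>{1..}. \<exists>X. X \<in> carrier (gr_piece M j) \<and> \<pi> ` X = z j \<and> (j < k \<longrightarrow> X = \<one>\<^bsub>gr_piece M j\<^esub>)"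
    proof
      fix j :: nat assume "j \<in> {1..}"
      then have j: "1 \<le> j" by simp
      interpret g: comm_group "gr_piece M j" by (rule A.comm_group_gr[OF j])
      show "\<exists>X. X \<in> carrier (gr_piece M j) \<and> \<pi> ` X = z j \<and> (j < k \<longrightarrow> X = \<one>\<^bsub>gr_piece M j\<^esub>)"
        using pi_gr_surj[OF j z(1)[OF j]] z(2)[OF j] pi_gr_one[OF j] g.one_closed by (cases "j < k") auto
    qed
    from bchoice[OF this] obtain X where
      X0: "\<forall>j\<in>{1..}. X j \<in> carrier (gr_piece M j) \<and> \<pi> ` X j = z j \<and> (j < k \<longrightarrow> X j = \<one>\<^bsub>gr_piece M j\<^esub>)" ..
    have X: "X j \<in> carrier (gr_piece M j)" "\<pi> ` X j = z j" "j < k \<Longrightarrow> X j = \<one>\<^bsub>gr_piece M j\<^esub>" if "1 \<le> j" for j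
      using X0 that by (auto simp del: One_nat_def)
    have "(\<lambda>j\<in>{1..}. X j) \<in> filt ?GM k" using X by (auto simp: completed_gr_def)
    then obtain x where x: "x \<in> filt M k" "\<phi> x = (\<lambda>j\<in>{1..}. X j)" using \<phi>filt[OF k] by (metis imageE)
    have "\<psi> (\<pi> x) = z"
      using \<psi>[OF A.filt_carrier[OF k x(1)]] X(2) z(3) by (auto simp: x(2) gr_map_def extensional_def fun_eq_iff)
    then show "z \<in> \<psi> ` filt L k" using x(1) pi_filt[OF k] by blast
  qed
  have "bij_betw \<psi> (carrier L) (carrier ?GL)"
    unfolding bij_betw_def
  proof
    show "inj_on \<psi> (carrier L)"
      unfolding inj_on_def using fibre s \<psi>_def by metis
    have "filt ?GL 1 = carrier ?GL" by (auto simp: completed_gr_def)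
    then show "\<psi> ` carrier L = carrier ?GL" using \<psi>filt[of 1] B.filt_1 by simp
  qed
  moreover have "\<psi> (y \<oplus>\<^bsub>L\<^esub> y') = \<psi> y \<oplus>\<^bsub>?GL\<^esub> \<psi> y'" if yy: "y \<in> carrier L" "y' \<in> carrier L" for y y'
  proof -
    obtain x x' where x: "x \<in> carrier M" "y = \<pi> x" "x' \<in> carrier M" "y' = \<pi> x'" using yy pi_carrier by blast
    have "gr_map (\<phi> (x \<oplus>\<^bsub>M\<^esub> x')) = gr_map (\<phi> x) \<oplus>\<^bsub>?GL\<^esub> gr_map (\<phi> x')"
      using comp[OF x(1)] comp[OF x(3)] addk[OF x(1,3)] hom_mult[OF pi_hom_gr]
      by (auto simp: gr_map_def completed_gr_def fun_eq_iff)
    then show ?thesis using x \<psi> by (simp flip: pi_add)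
  qed
  moreover have "\<psi> (c \<odot>\<^bsub>L\<^esub> y) = c \<odot>\<^bsub>?GL\<^esub> \<psi> y" if yy: "y \<in> carrier L" for c y
  proof -
    obtain x where x: "x \<in> carrier M" "y = \<pi> x" using yy pi_carrier by blast
    have "c \<odot>\<^bsub>M\<^esub> x \<in> carrier M" using A.smult_filt[of 1 x c] x(1) A.filt_1 by simp
    moreover have "gr_map (\<phi> (c \<odot>\<^bsub>M\<^esub> x)) = c \<odot>\<^bsub>?GL\<^esub> gr_map (\<phi> x)"
      using comp[OF x(1)] pi_gr_smult unfolding \<phi>smult[OF x(1)]
      by (auto simp: gr_map_def completed_gr_def fun_eq_iff)
    ultimately show ?thesis using x \<psi> by (simp flip: pi_smult)
  qed
  moreover have "\<psi> (y \<otimes>\<^bsub>L\<^esub> y') = \<psi> y \<otimes>\<^bsub>?GL\<^esub> \<psi> y'" if yy: "y \<in> carrier L" "y' \<in> carrier L" for y y'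
  proof -
    obtain x x' where x: "x \<in> carrier M" "y = \<pi> x" "x' \<in> carrier M" "y' = \<pi> x'" using yy pi_carrier by blast
    have br: "x \<otimes>\<^bsub>M\<^esub> x' \<in> carrier M"
      using A.bracket_filt[of 1 1 x x'] A.filt_carrier[of 2 "x \<otimes>\<^bsub>M\<^esub> x'"] x A.filt_1 by (simp add: numeral_2_eq_2)
    have "\<pi> ` (\<Otimes>\<^bsub>gr_piece M n\<^esub>p\<in>{1..<n}. gr_bracket M p (n - p) (\<phi> x p) (\<phi> x' (n - p)))
        = (\<Otimes>\<^bsub>gr_piece L n\<^esub>p\<in>{1..<n}. gr_bracket L p (n - p) (gr_map (\<phi> x) p) (gr_map (\<phi> x') (n - p)))" if n: "1 \<le> n" for n
    proof -
      interpret g: comm_group "gr_piece L n" by (rule B.comm_group_gr[OF n])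
      have pn: "1 \<le> p" "1 \<le> n - p" "p + (n - p) = n" if "p \<in> {1..<n}" for p
        using that by auto
      have c: "gr_bracket M p (n - p) (\<phi> x p) (\<phi> x' (n - p)) \<in> carrier (gr_piece M n)" if "p \<in> {1..<n}" for p
        using A.gr_bracket_closed[OF pn(1,2)[OF that] comp[OF x(1) pn(1)[OF that]] comp[OF x(3) pn(2)[OF that]]]
        unfolding pn(3)[OF that] .
      have "\<pi> ` (\<Otimes>\<^bsub>gr_piece M n\<^esub>p\<in>{1..<n}. gr_bracket M p (n - p) (\<phi> x p) (\<phi> x' (n - p)))
        = (\<Otimes>\<^bsub>gr_piece L n\<^esub>p\<in>{1..<n}. \<pi> ` gr_bracket M p (n - p) (\<phi> x p) (\<phi> x' (n - p)))"
        by (rule hom_finprod_comm_group[OF A.comm_group_gr[OF n] B.comm_group_gr[OF n] pi_hom_gr[OF n]])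
          (use c in auto)
      also have "\<dots> = (\<Otimes>\<^bsub>gr_piece L n\<^esub>p\<in>{1..<n}. gr_bracket L p (n - p) (gr_map (\<phi> x) p) (gr_map (\<phi> x') (n - p)))"
      proof (rule g.finprod_cong'[OF refl])
        fix p assume p: "p \<in> {1..<n}"
        show "\<pi> ` gr_bracket M p (n - p) (\<phi> x p) (\<phi> x' (n - p)) = gr_bracket L p (n - p) (gr_map (\<phi> x) p) (gr_map (\<phi> x') (n - p))"
          using pi_gr_bracket[OF pn(1,2)[OF p] comp[OF x(1) pn(1)[OF p]] comp[OF x(3) pn(2)[OF p]]] pn[OF p]
          by (simp add: gr_map_def)
      next
        show "(\<lambda>p. gr_bracket L p (n - p) (gr_map (\<phi> x) p) (gr_map (\<phi> x') (n - p))) \<in> {1..<n} \<rightarrow> carrier (gr_piece L n)"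
        proof
          fix p assume p: "p \<in> {1..<n}"
          then show "gr_bracket L p (n - p) (gr_map (\<phi> x) p) (gr_map (\<phi> x') (n - p)) \<in> carrier (gr_piece L n)"
            using B.gr_bracket_closed[OF pn(1,2)[OF p] hom_in_carrier[OF pi_hom_gr comp[OF x(1) pn(1)[OF p]]]
                hom_in_carrier[OF pi_hom_gr comp[OF x(3) pn(2)[OF p]]]] pn[OF p]
            by (simp add: gr_map_def)
        qed
      qed
      finally show ?thesis .
    qed
    then have "gr_map (\<phi> (x \<otimes>\<^bsub>M\<^esub> x')) n = (gr_map (\<phi> x) \<otimes>\<^bsub>?GL\<^esub> gr_map (\<phi> x')) n" for n
      unfolding \<phi>bracket[OF x(1,3)]
      by (cases "1 \<le> n") (simp_all add: completed_gr_def gr_map_def[of "restrict _ _"])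
    then have "gr_map (\<phi> (x \<otimes>\<^bsub>M\<^esub> x')) = gr_map (\<phi> x) \<otimes>\<^bsub>?GL\<^esub> gr_map (\<phi> x')" by blast
    then show ?thesis using x br \<psi> by (simp flip: pi_bracket)
  qed
  ultimately have "\<psi> \<in> filtered_lie_iso L ?GL"
    using \<psi>filt unfolding filtered_lie_iso_def by blast
  moreover have "\<psi> y k = B.gcls k y" if k: "1 \<le> k" and y: "y \<in> filt L k" for y k
  proof -
    obtain x where x: "x \<in> filt M k" "y = \<pi> x" by (rule pi_filtE[OF k y])
    have "x \<in> carrier M" using A.filt_carrier[OF k x(1)] .
    then show ?thesis
      using k by (simp add: x(2) \<psi> gr_map_def \<phi>id[OF k x(1)] pi_gcls)
  qed
  ultimately show ?thesis
    unfolding filtered_formal_lie_def B.gcls_def by blast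
qed

end

section \<open>The Malcev Lie algebra of a nilpotent quotient\<close>

context group
begin

lemma alg_cls_eq_iff: "alg_cls a = alg_cls b \<longleftrightarrow> (\<forall>n. a n - b n \<in> Ipow G n)"
  by (rule filtered_group_algebra.cls_eq_iff[OF filtered_power])

lemma filt_malcevI:
  "lie_rep a \<Longrightarrow> a k \<in> Ipow G k \<Longrightarrow> alg_cls a \<in> filt (malcev_lie G) k"
  unfolding filt_malcev by blast

lemma abelian_group_malcev: "abelian_group (malcev_lie G)"
proof (rule abelian_groupI; unfold carrier_malcev)
  fix x :: "nat \<Rightarrow> ('a \<Rightarrow>\<^sub>0 'c) set" assume "x \<in> {alg_cls a | a. lie_rep a}"
  then obtain a where a: "x = alg_cls a" "lie_rep a" by blast
  have "alg_cls (\<lambda>n. - a n) \<oplus>\<^bsub>malcev_lie G\<^esub> x = \<zero>\<^bsub>malcev_lie G\<^esub>" by (simp add: a add_malcev zero_malcev)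
  moreover have "lie_rep (\<lambda>n. - a n)" using lie_rep_diff[OF lie_rep_zero a(2)] by simp
  ultimately show "\<exists>y\<in>{alg_cls a | a. lie_rep a}. y \<oplus>\<^bsub>malcev_lie G\<^esub> x = \<zero>\<^bsub>malcev_lie G\<^esub>" by blast
next
  fix x y :: "nat \<Rightarrow> ('a \<Rightarrow>\<^sub>0 'c) set"
  assume "x \<in> {alg_cls a | a. lie_rep a}" "y \<in> {alg_cls a | a. lie_rep a}"
  then obtain a b where "x = alg_cls a" "lie_rep a" "y = alg_cls b" "lie_rep b" by blast
  then show "x \<oplus>\<^bsub>malcev_lie G\<^esub> y \<in> {alg_cls a | a. lie_rep a}" "x \<oplus>\<^bsub>malcev_lie G\<^esub> y = y \<oplus>\<^bsub>malcev_lie G\<^esub> x"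
    using lie_rep_add by (auto simp: add_malcev add.commute)
next
  show "\<zero>\<^bsub>malcev_lie G\<^esub> \<in> {alg_cls a | a. lie_rep a}" using lie_rep_zero by (auto simp: zero_malcev)
qed (auto simp: add_malcev zero_malcev add.assoc)

lemma a_inv_malcev:
  assumes "lie_rep a"
  shows "\<ominus>\<^bsub>malcev_lie G\<^esub> alg_cls a = alg_cls (\<lambda>n. - a n)"
  using lie_rep_diff[OF lie_rep_zero assms] assms
  by (intro abelian_group.minus_equality[OF abelian_group_malcev])
    (auto simp: add_malcev zero_malcev carrier_malcev)

lemma filtered_lie_algebra_malcev: "filtered_lie_algebra (malcev_lie G :: ('k::field, _) filtered_lie)"
proof (intro filtered_lie_algebra.intro abelian_group_malcev filtered_lie_algebra_axioms.intro)
  let ?M = "malcev_lie G :: ('k, _) filtered_lie"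
  fix k :: nat assume "1 \<le> k"
  show "additive_subgroup (filt ?M k) ?M"
  proof (rule additive_subgroup.intro, rule group.subgroupI[OF abelian_group.a_group[OF abelian_group_malcev]])
    show "filt ?M k \<subseteq> carrier (add_monoid ?M)" by (auto simp: filt_malcev carrier_malcev)
    show "filt ?M k \<noteq> {}"
      unfolding filt_malcev using lie_rep_zero pm.subspace_0[OF subspace_power] by blast
  next
    fix x assume "x \<in> filt ?M k"
    then obtain a where a: "x = alg_cls a" "lie_rep a" "a k \<in> Ipow G k" by (auto simp: filt_malcev)
    have "lie_rep (\<lambda>n. - a n)" "- a k \<in> Ipow G k"
      using lie_rep_diff[OF lie_rep_zero a(2)] pm.subspace_neg[OF subspace_power a(3)] by simp_all
    then show "inv\<^bsub>add_monoid ?M\<^esub> x \<in> filt ?M k"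
      using a_inv_malcev[OF a(2)] unfolding a_inv_def a(1) by (simp add: filt_malcevI)
  next
    fix x y assume "x \<in> filt ?M k" "y \<in> filt ?M k"
    then obtain a b where "x = alg_cls a" "lie_rep a" "a k \<in> Ipow G k"
      "y = alg_cls b" "lie_rep b" "b k \<in> Ipow G k" by (auto simp: filt_malcev)
    then show "x \<otimes>\<^bsub>add_monoid ?M\<^esub> y \<in> filt ?M k"
      by (simp add: add_malcev filt_malcevI lie_rep_add pm.subspace_add[OF subspace_power])
  qed
next
  let ?M = "malcev_lie G :: ('k, _) filtered_lie"
  show "filt ?M 1 = carrier ?M"
    using lie_rep_augmentation[of _ 1] by (auto simp: filt_malcev carrier_malcev)
next
  let ?M = "malcev_lie G :: ('k, _) filtered_lie"
  fix k :: nat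
  show "filt ?M (Suc k) \<subseteq> filt ?M k"
  proof
    fix x assume "x \<in> filt ?M (Suc k)"
    then obtain a where a: "x = alg_cls a" "lie_rep a" "a (Suc k) \<in> Ipow G (Suc k)"
      by (auto simp: filt_malcev)
    then have "a k \<in> Ipow G k"
      using subspace_diff_cancel[OF subspace_power lie_repD(4)[OF a(2)], of k "Suc k"] power_Suc_subset[of k] by auto
    then show "x \<in> filt ?M k" using a by (simp add: filt_malcevI)
  qed
next
  let ?M = "malcev_lie G :: ('k, _) filtered_lie"
  fix k :: nat and x c assume "x \<in> filt ?M k"
  then obtain a where "x = alg_cls a" "lie_rep a" "a k \<in> Ipow G k" by (auto simp: filt_malcev)
  then show "c \<odot>\<^bsub>?M\<^esub> x \<in> filt ?M k"
    by (simp add: smult_malcev filt_malcevI lie_rep_scale pm.subspace_scale[OF subspace_power])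
next
  let ?M = "malcev_lie G :: ('k, _) filtered_lie"
  fix x y c assume "x \<in> carrier ?M" "y \<in> carrier ?M"
  then show "c \<odot>\<^bsub>?M\<^esub> (x \<oplus>\<^bsub>?M\<^esub> y) = c \<odot>\<^bsub>?M\<^esub> x \<oplus>\<^bsub>?M\<^esub> c \<odot>\<^bsub>?M\<^esub> y"
    by (auto simp: carrier_malcev smult_malcev add_malcev pm.scale_right_distrib)
next
  let ?M = "malcev_lie G :: ('k, _) filtered_lie"
  fix p q :: nat and x y assume "x \<in> filt ?M p" "y \<in> filt ?M q"
  then obtain a b where a: "x = alg_cls a" "lie_rep a" "a p \<in> Ipow G p"
      and b: "y = alg_cls b" "lie_rep b" "b q \<in> Ipow G q" by (auto simp: filt_malcev)
  have "a (p + q) \<in> Ipow G p" "b (p + q) \<in> Ipow G q"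
    using subspace_diff_cancel[OF subspace_power lie_repD(4)[OF a(2)], of p "p + q"] a(3)
      subspace_diff_cancel[OF subspace_power lie_repD(4)[OF b(2)], of q "p + q"] b(3) by simp_all
  from power_mult[OF this] power_mult[OF this(2,1)]
  have "a (p + q) \<star> b (p + q) - b (p + q) \<star> a (p + q) \<in> Ipow G (p + q)"
    by (intro pm.subspace_diff[OF subspace_power]) (simp_all add: add.commute)
  then show "x \<otimes>\<^bsub>?M\<^esub> y \<in> filt ?M (p + q)"
    using lie_rep_commutator[OF a(2) b(2)] by (simp add: a(1) b(1) filt_malcevI bracket_malcev[OF a(2) b(2)])
next
  let ?M = "malcev_lie G :: ('k, _) filtered_lie"
  fix x y z assume "x \<in> carrier ?M" "y \<in> carrier ?M" "z \<in> carrier ?M"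
  then obtain a b c where "x = alg_cls a" "lie_rep a" "y = alg_cls b" "lie_rep b" "z = alg_cls c" "lie_rep c"
    by (auto simp: carrier_malcev)
  then show "(x \<oplus>\<^bsub>?M\<^esub> y) \<otimes>\<^bsub>?M\<^esub> z = x \<otimes>\<^bsub>?M\<^esub> z \<oplus>\<^bsub>?M\<^esub> y \<otimes>\<^bsub>?M\<^esub> z"
    "z \<otimes>\<^bsub>?M\<^esub> (x \<oplus>\<^bsub>?M\<^esub> y) = z \<otimes>\<^bsub>?M\<^esub> x \<oplus>\<^bsub>?M\<^esub> z \<otimes>\<^bsub>?M\<^esub> y"
    by (simp_all add: add_malcev bracket_malcev lie_rep_add gmul_bilinear algebra_simps)
qed

lemma bracket_part_nilpotent:
  assumes "lower_central G n \<subseteq> {\<one>}"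
  shows "bracket_part n \<subseteq> (Ipow G (Suc n) :: ('a \<Rightarrow>\<^sub>0 'k::field) set)"
  unfolding bracket_part_def
proof (intro pm.span_minimal subspace_power Un_least order_refl subsetI)
  fix x :: "'a \<Rightarrow>\<^sub>0 'k"
  assume "x \<in> (\<lambda>g. pt g - pt \<one>) ` lower_central G n"
  then have "x = 0" using assms by auto
  then show "x \<in> Ipow G (Suc n)" using pm.subspace_0[OF subspace_power] by metis
qed

text \<open>In a nilpotent group the filtration of the Malcev Lie algebra terminates: for \<open>n \<ge> i\<close> an element
of filtration \<open>n\<close> is congruent to a combination of \<open>g - 1\<close> with \<open>g\<close> in a trivial group, so it has
filtration \<open>n + 1\<close>. The conclusion says that the point represented by \<open>b\<close> is zero.\<close>

lemma lie_rep_nilpotent: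
  fixes b :: "nat \<Rightarrow> ('a \<Rightarrow>\<^sub>0 'k::field_char_0)"
  assumes nil: "lower_central G i \<subseteq> {\<one>}" and i: "1 \<le> i"
    and b: "lie_rep b" and bi: "b i \<in> Ipow G i"
  shows "b n \<in> Ipow G n"
proof (cases "i \<le> n")
  case True
  then show ?thesis
  proof (induction n rule: dec_induct)
    case base
    show ?case by (rule bi)
  next
    case (step n)
    have "b (Suc n) \<in> Ipow G n"
      using subspace_diff_cancel[OF subspace_power lie_repD(4)[OF b], of n "Suc n"] step.IH by simp
    then have "b (Suc n) \<in> bracket_part n"
      using i step(1) lie_repD(3)[OF b] by (intro approx_primitive_in_bracket_part) auto
    moreover have "lower_central G n \<subseteq> {\<one>}"
      using lower_central_antimono[OF step(1)] nil by blast
    ultimately show ?case using bracket_part_nilpotent by blast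
  qed
next
  case False
  then have "b i \<in> Ipow G n" using bi power_antimono[of n i] by auto
  then show ?thesis
    using subspace_diff_cancel[OF subspace_power lie_repD(4)[OF b], of n i] False by simp
qed

lemma lie_rep_log:
  assumes "g \<in> carrier G"
  shows "lie_rep (\<lambda>n. log_trunc n g)"
  unfolding lie_rep_def filtered_group_algebra.coherent_def[OF filtered_power]
  using assms log_trunc_galg log_trunc_Suc primitive_defect_log_trunc by blast

end

context group_hom
begin

abbreviation malcev_map :: "(nat \<Rightarrow> ('a \<Rightarrow>\<^sub>0 'k::field) set) \<Rightarrow> (nat \<Rightarrow> ('c \<Rightarrow>\<^sub>0 'k) set)" where
  "malcev_map \<equiv> induced (group_algebra H) (Ipow H) (pushforward h)"

lemma malcev_map_cls: "malcev_map (G.alg_cls a) = H.alg_cls (\<lambda>n. pushforward h (a n))"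
  by (rule induced_cls[OF G.subspace_power H.subspace_power])
    (simp add: pushforward_power flip: pushforward_lin)

lemma lie_rep_pushforward:
  assumes "G.lie_rep a"
  shows "H.lie_rep (\<lambda>n. pushforward h (a n))"
  unfolding H.lie_rep_def filtered_group_algebra.coherent_def[OF H.filtered_power]
proof (intro conjI allI)
  fix n
  show "pushforward h (a n) \<in> galg H" using G.lie_repD(2)[OF assms] by (rule pushforward_galg)
  show "pushforward h (a (Suc n)) - pushforward h (a n) \<in> Ipow H n"
    using pushforward_power[OF G.lie_repD(4)[OF assms, of n "Suc n"]] by (simp add: pushforward_lin)
  show "primitive_defect H (pushforward h (a n)) \<in> Tfil H n"
    using pushforward_Tfil[OF G.lie_repD(3)[OF assms]] by (simp add: pushforward_primitive_defect)
qed

text \<open>The leading term \<open>g - 1\<close> is realised by \<open>log g\<close>, and \<open>log g\<close> is the image of the logarithm of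
any preimage of \<open>g\<close>.\<close>

lemma bracket_part_lift:
  fixes z :: "'c \<Rightarrow>\<^sub>0 'k::field_char_0"
  assumes surj: "h ` carrier G = carrier H" and n: "1 \<le> n" and z: "z \<in> H.bracket_part n"
  shows "\<exists>w. G.lie_rep w \<and> pushforward h (w (Suc n)) - z \<in> Ipow H (Suc n)"
proof -
  let ?I = "Ipow H (Suc n) :: ('c \<Rightarrow>\<^sub>0 'k) set"
  let ?W = "{z :: 'c \<Rightarrow>\<^sub>0 'k. \<exists>w. G.lie_rep w \<and> pushforward h (w (Suc n)) - z \<in> ?I}"
  have "pm.subspace ?W"
  proof (rule pm.subspaceI)
    show "0 \<in> ?W"
      using G.lie_rep_zero
      by (auto intro!: exI[of _ "\<lambda>n. 0"] simp: pushforward_lin pm.subspace_0[OF H.subspace_power])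
  next
    fix x y assume "x \<in> ?W" "y \<in> ?W"
    then obtain v w where v: "G.lie_rep v" "pushforward h (v (Suc n)) - x \<in> ?I"
      and w: "G.lie_rep w" "pushforward h (w (Suc n)) - y \<in> ?I" by blast
    have "pushforward h (v (Suc n) + w (Suc n)) - (x + y) \<in> ?I"
      using pm.subspace_add[OF H.subspace_power v(2) w(2)] by (simp add: pushforward_lin algebra_simps)
    then show "x + y \<in> ?W" using G.lie_rep_add[OF v(1) w(1)] by blast
  next
    fix c x assume "x \<in> ?W"
    then obtain v where v: "G.lie_rep v" "pushforward h (v (Suc n)) - x \<in> ?I" by blast
    have "pushforward h (scale c (v (Suc n))) - scale c x \<in> ?I"
      using pm.subspace_scale[OF H.subspace_power v(2), of c] by (simp add: pushforward_lin pm.scale_right_diff_distrib)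
    then show "scale c x \<in> ?W" using G.lie_rep_scale[OF v(1)] by blast
  qed
  moreover have "(\<lambda>g. pt g - pt \<one>\<^bsub>H\<^esub>) ` lower_central H n \<union> ?I \<subseteq> ?W"
  proof
    fix x assume "x \<in> (\<lambda>g. pt g - pt \<one>\<^bsub>H\<^esub>) ` lower_central H n \<union> ?I"
    then show "x \<in> ?W"
    proof
      assume "x \<in> ?I"
      then show ?thesis
        using G.lie_rep_zero
        by (auto intro!: exI[of _ "\<lambda>n. 0"] simp: pushforward_lin pm.subspace_neg[OF H.subspace_power])
    next
      assume "x \<in> (\<lambda>g. pt g - pt \<one>\<^bsub>H\<^esub>) ` lower_central H n"
      then obtain g where g: "g \<in> lower_central H n" "x = pt g - pt \<one>\<^bsub>H\<^esub>" by blast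
      have gc: "g \<in> carrier H" using g(1) H.lower_central_subset by blast
      then obtain g' where g': "g' \<in> carrier G" "g = h g'" using surj by blast
      have "pushforward h (G.log_trunc (Suc n) g') - x \<in> ?I"
        using H.log_trunc_leading_term[OF H.lower_central_power[OF g(1)] gc n]
        unfolding pushforward_log_trunc[OF g'(1)] g(2) g'(2) .
      then show ?thesis using G.lie_rep_log[OF g'(1)] by blast
    qed
  qed
  ultimately have "H.bracket_part n \<subseteq> ?W"
    unfolding H.bracket_part_def by (intro pm.span_minimal)
  with z show ?thesis by blast
qed

text \<open>Surjectivity, by successive approximation: subtracting the image of a primitive element raises
the filtration by one, and in filtration \<open>i\<close> only zero is left.\<close>

lemma lie_rep_lift:
  fixes y :: "nat \<Rightarrow> ('c \<Rightarrow>\<^sub>0 'k::field_char_0)"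
  assumes surj: "h ` carrier G = carrier H"
    and nil: "lower_central H i \<subseteq> {\<one>\<^bsub>H\<^esub>}" and i: "1 \<le> i"
    and "H.lie_rep y" "1 \<le> n" "y n \<in> Ipow H n"
  shows "\<exists>x. G.lie_rep x \<and> (\<forall>m. pushforward h (x m) - y m \<in> Ipow H m)"
  using assms(4-6)
proof (induction "i - n" arbitrary: n y rule: less_induct)
  case less
  note y = \<open>H.lie_rep y\<close> and n = \<open>1 \<le> n\<close> and yn = \<open>y n \<in> Ipow H n\<close>
  show ?case
  proof (cases "i \<le> n")
    case True
    have "y i \<in> Ipow H i"
      using subspace_diff_cancel[OF H.subspace_power H.lie_repD(4)[OF y True]] yn H.power_antimono[OF True] by blast
    then have "y m \<in> Ipow H m" for m by (rule H.lie_rep_nilpotent[OF nil i y])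
    then show ?thesis
      using G.lie_rep_zero
      by (auto intro!: exI[of _ "\<lambda>n. 0"] simp: pushforward_lin pm.subspace_neg[OF H.subspace_power])
  next
    case False
    have "y (Suc n) \<in> Ipow H n"
      using subspace_diff_cancel[OF H.subspace_power H.lie_repD(4)[OF y], of n "Suc n"] yn by simp
    then have "y (Suc n) \<in> H.bracket_part n"
      using H.lie_repD(3)[OF y] n by (intro H.approx_primitive_in_bracket_part)
    from bracket_part_lift[OF surj n this] obtain w
      where w: "G.lie_rep w" "pushforward h (w (Suc n)) - y (Suc n) \<in> Ipow H (Suc n)" by blast
    define y' where "y' m = y m - pushforward h (w m)" for m
    have "H.lie_rep y'"
      unfolding y'_def by (rule H.lie_rep_diff[OF y lie_rep_pushforward[OF w(1)]])
    moreover have "y' (Suc n) \<in> Ipow H (Suc n)"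
      using pm.subspace_neg[OF H.subspace_power w(2)] by (simp add: y'_def)
    ultimately obtain x' where x': "G.lie_rep x'" "\<And>m. pushforward h (x' m) - y' m \<in> Ipow H m"
      using less.hyps[of "Suc n" y'] False diff_less_mono2[of n "Suc n" i] by auto
    have "pushforward h (x' m + w m) - y m \<in> Ipow H m" for m
      using x'(2)[of m] by (simp add: y'_def pushforward_lin algebra_simps)
    then show ?thesis using G.lie_rep_add[OF x'(1) w(1)] by blast
  qed
qed

text \<open>Below \<open>i\<close> the map of group algebras reflects the filtration; from \<open>i\<close> on the target is zero.\<close>

theorem malcev_quotient:
  assumes surj: "h ` carrier G = carrier H" and i: "1 \<le> i"
    and ker: "\<And>g. g \<in> carrier G \<Longrightarrow> h g = \<one>\<^bsub>H\<^esub> \<Longrightarrow> g \<in> lower_central G i"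
    and nil: "lower_central H i \<subseteq> {\<one>\<^bsub>H\<^esub>}"
  shows "filtered_lie_quotient (malcev_lie G :: ('k::field_char_0, _) filtered_lie) (malcev_lie H) malcev_map i"
proof (intro filtered_lie_quotient.intro filtered_lie_quotient_axioms.intro
    G.filtered_lie_algebra_malcev H.filtered_lie_algebra_malcev i)
  let ?M = "malcev_lie G :: ('k, _) filtered_lie" and ?L = "malcev_lie H :: ('k, _) filtered_lie"
  have reflect: "a \<in> Ipow G n"
    if "n \<le> i" "a \<in> galg G" "pushforward h a \<in> Ipow H n" for a :: "'a \<Rightarrow>\<^sub>0 'k" and n
    using that by (intro pushforward_reflects_power[OF surj _ that] G.lower_central_power ker)
  fix x y :: "nat \<Rightarrow> ('a \<Rightarrow>\<^sub>0 'k) set"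
  assume "x \<in> carrier ?M"
  then obtain a where a: "x = G.alg_cls a" "G.lie_rep a" by (auto simp: G.carrier_malcev)
  show "malcev_map (c \<odot>\<^bsub>?M\<^esub> x) = c \<odot>\<^bsub>?L\<^esub> malcev_map x" for c
    by (simp add: a G.smult_malcev H.smult_malcev malcev_map_cls pushforward_lin)
  show "malcev_map x = \<zero>\<^bsub>?L\<^esub> \<longleftrightarrow> x \<in> filt ?M i"
  proof -
    have "malcev_map x = \<zero>\<^bsub>?L\<^esub> \<longleftrightarrow> (\<forall>n. pushforward h (a n) \<in> Ipow H n)"
      by (simp add: a(1) malcev_map_cls H.zero_malcev H.alg_cls_eq_iff)
    also have "\<dots> \<longleftrightarrow> a i \<in> Ipow G i"
      using reflect[OF order_refl G.lie_repD(2)[OF a(2)]]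
        H.lie_rep_nilpotent[OF nil i lie_rep_pushforward[OF a(2)]] pushforward_power by blast
    also have "\<dots> \<longleftrightarrow> x \<in> filt ?M i"
    proof
      assume "x \<in> filt ?M i"
      then obtain a' where a': "x = G.alg_cls a'" "a' i \<in> Ipow G i" by (auto simp: G.filt_malcev)
      have "a i - a' i \<in> Ipow G i" using a(1) a'(1) G.alg_cls_eq_iff by metis
      then show "a i \<in> Ipow G i" using a'(2) subspace_diff_cancel[OF G.subspace_power] by blast
    qed (use a in \<open>simp add: G.filt_malcevI\<close>)
    finally show ?thesis .
  qed
  assume "y \<in> carrier ?M"
  then obtain b where b: "y = G.alg_cls b" "G.lie_rep b" by (auto simp: G.carrier_malcev)
  show "malcev_map (x \<oplus>\<^bsub>?M\<^esub> y) = malcev_map x \<oplus>\<^bsub>?L\<^esub> malcev_map y"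
    by (simp add: a b G.add_malcev H.add_malcev malcev_map_cls pushforward_lin)
  show "malcev_map (x \<otimes>\<^bsub>?M\<^esub> y) = malcev_map x \<otimes>\<^bsub>?L\<^esub> malcev_map y"
    using a b
    by (simp add: G.bracket_malcev H.bracket_malcev lie_rep_pushforward malcev_map_cls pushforward_lin
        pushforward_gmul G.lie_repD(2))
next
  let ?M = "malcev_lie G :: ('k, _) filtered_lie" and ?L = "malcev_lie H :: ('k, _) filtered_lie"
  fix k :: nat assume k: "1 \<le> k"
  show "malcev_map ` filt ?M k = filt ?L k"
  proof (intro equalityI subsetI)
    fix z assume "z \<in> malcev_map ` filt ?M k"
    then obtain a where a: "z = malcev_map (G.alg_cls a)" "G.lie_rep a" "a k \<in> Ipow G k"
      by (auto simp: G.filt_malcev)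
    then show "z \<in> filt ?L k"
      using lie_rep_pushforward[OF a(2)] pushforward_power[OF a(3)] by (simp add: a(1) H.filt_malcevI malcev_map_cls)
  next
    fix z assume "z \<in> filt ?L k"
    then obtain y where y: "z = H.alg_cls y" "H.lie_rep y" "y k \<in> Ipow H k"
      by (auto simp: H.filt_malcev)
    show "z \<in> malcev_map ` filt ?M k"
    proof (cases "i \<le> k")
      case True
      have "y i \<in> Ipow H i"
        using subspace_diff_cancel[OF H.subspace_power H.lie_repD(4)[OF y(2) True]] y(3) H.power_antimono[OF True] by blast
      then have "y m \<in> Ipow H m" for m by (rule H.lie_rep_nilpotent[OF nil i y(2)])
      then have "z = malcev_map (G.alg_cls (\<lambda>n. 0))"
        by (simp add: y(1) malcev_map_cls H.alg_cls_eq_iff pushforward_lin)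
      moreover have "G.alg_cls (\<lambda>n. 0) \<in> filt ?M k"
        unfolding G.filt_malcev using G.lie_rep_zero pm.subspace_0[OF G.subspace_power] by blast
      ultimately show ?thesis by blast
    next
      case False
      obtain x where x: "G.lie_rep x" "\<And>m. pushforward h (x m) - y m \<in> Ipow H m"
        using lie_rep_lift[OF surj nil i y(2) order_refl H.lie_rep_augmentation[OF y(2) order_refl]] by blast
      have "k \<le> i" using False by simp
      have "pushforward h (x k) \<in> Ipow H k"
        using subspace_diff_cancel[OF H.subspace_power x(2)[of k]] y(3) by blast
      then have "x k \<in> Ipow G k"
        by (intro pushforward_reflects_power[OF surj _ \<open>k \<le> i\<close> G.lie_repD(2)[OF x(1)]] G.lower_central_power ker)
      then have "G.alg_cls x \<in> filt ?M k" using x(1) by (simp add: G.filt_malcevI)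
      moreover have "malcev_map (G.alg_cls x) = z"
        using x(2) by (simp add: y(1) malcev_map_cls H.alg_cls_eq_iff)
      ultimately show ?thesis by blast
    qed
  qed
qed

end

theorem theorem7p13:
  fixes G :: "('g, 'b) monoid_scheme"
  assumes "finitely_generated_group G"
    and "filtered_formal_group TYPE('k::field_char_0) G"
  shows "\<forall>i\<ge>1. filtered_formal_group TYPE('k) (G Mod lower_central G i)"
proof (intro allI impI)
  fix i :: nat assume i: "1 \<le> i"
  interpret G: group G using assms(1) by (simp add: finitely_generated_group_def)
  let ?N = "lower_central G i"
  interpret N: normal ?N G by (rule G.lower_central_normal)
  let ?H = "G Mod ?N" and ?q = "\<lambda>g. ?N #>\<^bsub>G\<^esub> g"
  interpret H: group ?H by (rule N.factorgroup_is_group)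
  interpret q: group_hom G ?H ?q
    by (intro group_hom.intro group_hom_axioms.intro G.is_group H.is_group N.r_coset_hom_Mod)
  have surj: "?q ` carrier G = carrier ?H" by (simp add: carrier_FactGroup)
  have in_N: "?q g = \<one>\<^bsub>?H\<^esub> \<longleftrightarrow> g \<in> ?N" if "g \<in> carrier G" for g
    using that N.rcos_const[OF G.is_group] G.rcos_self[OF that N.subgroup_axioms] by auto
  have "lower_central ?H i \<subseteq> ?q ` ?N" by (rule q.lower_central_img[OF surj])
  also have "\<dots> \<subseteq> {\<one>\<^bsub>?H\<^esub>}" using in_N N.subset by blast
  finally have nil: "lower_central ?H i \<subseteq> {\<one>\<^bsub>?H\<^esub>}" .
  have "filtered_lie_quotient (malcev_lie G :: ('k, _) filtered_lie) (malcev_lie ?H) q.malcev_map i"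
    using in_N by (intro q.malcev_quotient[OF surj i _ nil]) blast
  from filtered_lie_quotient.filtered_formal_quotient[OF this] assms(2)
  show "filtered_formal_group TYPE('k) (G Mod lower_central G i)"
    by (simp add: filtered_formal_group_def)
qed

end
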